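(* Consider Cantor space $2^{\mathbb N}$ with the Lebesgue measure $\lambda$, and let $n\ge 1$. Then $x\in 2^{\mathbb N}$ is Schnorr $n$-random if and only if for any $\Pi^0_n$ set $A$ such that $\lambda(A)>0$ and $\lambda(A)$ is $\emptyset^{(n-1)}$-computable, and any computable ergodic measure-preserving transformation $T:\subseteq 2^{\mathbb N}\to 2^{\mathbb N}$ with $x\in\operatorname{dom}T$, we have $T^k(x)\in A$ for some $k>0$.
   Context: Uniformity: a sequence of objects has a property (whose definition involves an index in $\mathbb N$) uniformly if a computable function produces suitable indices. $\emptyset^{(m)}$ denotes the $m$-th Turing jump of $\emptyset$. For a finite binary string $\sigma$, $[\![\sigma]\!]=\{x\in 2^{\mathbb N}:\sigma\text{ is an initial segment of }x\}$; these cylinders are the basic open sets of Cantor space. The Lebesgue measure $\lambda$ is the Borel probability measure with $\lambda[\![\sigma]\!]=2^{-|\sigma|}$. A set is $\Sigma^0_1$ if it is $\bigcup_{\sigma\in W}[\![\sigma]\!]$ for a c.e. set $W$ of strings (its index is an index of $W$). A set is $\Pi^0_n$ if its complement is $\Sigma^0_n$. A set is $\Sigma^0_{n+1}$ if it equals $\bigcup_{i\in W}(2^{\mathbb N}\setminus U^n_i)$ for some c.e. $W\subseteq\mathbb N$, where $U^n_i$ is the $i$-th $\Sigma^0_n$ set. A Schnorr $n$-test is a sequence $(U_k)_k$ of uniformly $\Sigma^0_n$ sets with $\lambda(U_k)\le 2^{-k}$ for all $k$ and $\lambda(U_k)$ uniformly $\emptyset^{(n-1)}$-computable in $k$. A point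 $x$ is Schnorr $n$-random if $x\notin\bigcap_kU_k$ for every Schnorr $n$-test. A measure-preserving transformation is a partial Borel measurable map $T:\subseteq 2^{\mathbb N}\to 2^{\mathbb N}$ such that $\lambda(T^{-1}(B))=\lambda(B)$ for every Borel $B$ (so $\operatorname{dom}T$ has full measure) and $x\in\operatorname{dom}T$ implies $T(x)\in\operatorname{dom}T$. It is computable if, uniformly in $\sigma$, $T^{-1}[\![\sigma]\!]$ is the intersection of $\operatorname{dom}T$ with a $\Sigma^0_1$ set. It is ergodic if every Borel $B$ with $T^{-1}(B)=B$ has measure $0$ or $1$. *)

theory Defs
  imports "HOL-Probability.Probability" "HOL-Library.Nat_Bijection"
begin

section \<open>Computability relative to an oracle\<close>

text \<open>
  The partial recursive functions relative to an oracle, presented as unary functions on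
  \<open>nat\<close>; several arguments are packed with \<^const>\<open>prod_encode\<close>, which is a bijection, so that
  \<open>Pairing First Second\<close> is the identity.
\<close>

datatype prog =
    Zero
  | Succ
  | First
  | Second
  | Oracle
  | Pairing prog prog
  | Compose prog prog
  | PrimRec prog prog
  | Minimize prog

text \<open>\<open>eval Q p x = None\<close> means that \<open>p\<close> diverges on input \<open>x\<close> with oracle \<open>Q\<close>.\<close>

primrec eval :: "nat set \<Rightarrow> prog \<Rightarrow> nat \<Rightarrow> nat option" where
  "eval Q Zero x = Some 0"
| "eval Q Succ x = Some (Suc x)"
| "eval Q First x = Some (fst (prod_decode x))"
| "eval Q Second x = Some (snd (prod_decode x))"
| "eval Q Oracle x = Some (if x \<in> Q then 1 else 0)"
| "eval Q (Pairing p q) x =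
     Option.bind (eval Q p x) (\<lambda>a. Option.bind (eval Q q x) (\<lambda>b. Some (prod_encode (a, b))))"
| "eval Q (Compose p q) x = Option.bind (eval Q q x) (eval Q p)"
| "eval Q (PrimRec p q) x =
     (let (a, n) = prod_decode x in
        rec_nat (eval Q p a)
          (\<lambda>m r. Option.bind r (\<lambda>b. eval Q q (prod_encode (a, prod_encode (m, b))))) n)"
| "eval Q (Minimize p) x =
     (if \<exists>n. eval Q p (prod_encode (x, n)) = Some 0 \<and>
             (\<forall>m<n. eval Q p (prod_encode (x, m)) \<noteq> None)
      then Some (LEAST n. eval Q p (prod_encode (x, n)) = Some 0)
      else None)"

primrec prog_index :: "prog \<Rightarrow> nat" where
  "prog_index Zero = prod_encode (0, 0)"
| "prog_index Succ = prod_encode (1, 0)"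
| "prog_index First = prod_encode (2, 0)"
| "prog_index Second = prod_encode (3, 0)"
| "prog_index Oracle = prod_encode (4, 0)"
| "prog_index (Pairing p q) = prod_encode (5, prod_encode (prog_index p, prog_index q))"
| "prog_index (Compose p q) = prod_encode (6, prod_encode (prog_index p, prog_index q))"
| "prog_index (PrimRec p q) = prod_encode (7, prod_encode (prog_index p, prog_index q))"
| "prog_index (Minimize p) = prod_encode (8, prog_index p)"

lemma inj_prog_index: "inj prog_index"
proof (rule injI)
  fix p q assume "prog_index p = prog_index q"
  then show "p = q"
  proof (induction p arbitrary: q)
    case Zero then show ?case by (cases q) simp_all
  next
    case Succ then show ?case by (cases q) simp_all
  next
    case First then show ?case by (cases q) simp_all
  next
    case Second then show ?case by (cases q) simp_all
  next
    case Oracle then show ?case by (cases q) simp_all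
  next
    case (Pairing a b)
    from Pairing.prems Pairing.IH show ?case by (cases q) auto
  next
    case (Compose a b)
    from Compose.prems Compose.IH show ?case by (cases q) auto
  next
    case (PrimRec a b)
    from PrimRec.prems PrimRec.IH show ?case by (cases q) auto
  next
    case (Minimize a)
    from Minimize.prems Minimize.IH show ?case by (cases q) auto
  qed
qed

text \<open>
  The \<open>e\<close>-th set c.e. in \<open>Q\<close>, as the domain of the \<open>e\<close>-th partial \<open>Q\<close>-recursive function;
  it is empty if \<open>e\<close> is not the index of a program.
\<close>

definition ce_set :: "nat set \<Rightarrow> nat \<Rightarrow> nat set" where
  "ce_set Q e = {x. \<exists>p. prog_index p = e \<and> eval Q p x \<noteq> None}"

definition turing_jump :: "nat set \<Rightarrow> nat set" where
  "turing_jump Q = {e. e \<in> ce_set Q e}"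

definition zero_jump :: "nat \<Rightarrow> nat set" where
  "zero_jump m = (turing_jump ^^ m) {}"

definition computable_in :: "nat set \<Rightarrow> (nat \<Rightarrow> nat) \<Rightarrow> bool" where
  "computable_in Q f \<longleftrightarrow> (\<exists>p. \<forall>x. eval Q p x = Some (f x))"

abbreviation computable :: "(nat \<Rightarrow> nat) \<Rightarrow> bool" where
  "computable \<equiv> computable_in {}"

definition rational :: "nat \<Rightarrow> real" where
  "rational c = (let (a, b) = prod_decode c in of_int (int_decode a) / real (Suc b))"

definition computable_real_in :: "nat set \<Rightarrow> real \<Rightarrow> bool" where
  "computable_real_in Q r \<longleftrightarrow>
     (\<exists>f. computable_in Q f \<and> (\<forall>j. \<bar>r - rational (f j)\<bar> \<le> (1/2) ^ j))"

definition uniformly_computable_reals_in :: "nat set \<Rightarrow> (nat \<Rightarrow> real) \<Rightarrow> bool" where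
  "uniformly_computable_reals_in Q r \<longleftrightarrow>
     (\<exists>f. computable_in Q f \<and>
        (\<forall>k j. \<bar>r k - rational (f (prod_encode (k, j)))\<bar> \<le> (1/2) ^ j))"


section \<open>Cantor space\<close>

type_synonym cantor = "nat \<Rightarrow> bool"

definition cylinder :: "bool list \<Rightarrow> cantor set" where
  "cylinder \<sigma> = {x. \<forall>i<length \<sigma>. x i = \<sigma> ! i}"

definition fair_measure :: "cantor measure" where
  "fair_measure = PiM UNIV (\<lambda>_. measure_pmf (bernoulli_pmf (1/2)))"

instance bool :: second_countable_topology
proof
  have "open = generate_topology (UNIV :: bool set set)"
  proof
    fix A :: "bool set"
    have "open A" by (rule discrete_topology_class.open_discrete)
    then show "open A = generate_topology UNIV A"
      by (simp add: generate_topology.Basis)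
  qed
  then show "\<exists>B::bool set set. countable B \<and> open = generate_topology B"
    by (intro exI[of _ UNIV]) simp
qed

lemma sets_fair_measure: "sets fair_measure = sets borel"
proof -
  have "sets fair_measure = sets (PiM UNIV (\<lambda>_. borel :: bool measure))"
    unfolding fair_measure_def by (intro sets_PiM_cong) (simp_all add: sets_borel_eq_count_space)
  then show ?thesis by (simp add: sets_PiM_equal_borel)
qed

lemma prob_space_fair_measure: "prob_space fair_measure"
  unfolding fair_measure_def by (intro prob_space_PiM measure_pmf.prob_space_axioms)

lemma measure_cylinder: "measure fair_measure (cylinder \<sigma>) = (1/2) ^ length \<sigma>"
proof -
  interpret product_prob_space "\<lambda>_::nat. measure_pmf (bernoulli_pmf (1/2))" UNIV
    ..
  have "cylinder \<sigma> = prod_emb UNIV (\<lambda>_. measure_pmf (bernoulli_pmf (1/2))) {..<length \<sigma>}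
      (Pi\<^sub>E {..<length \<sigma>} (\<lambda>i. {\<sigma> ! i}))"
    unfolding cylinder_def prod_emb_def
    by (intro set_eqI) (simp add: restrict_PiE_iff Pi_iff Ball_def)
  then have "measure fair_measure (cylinder \<sigma>)
      = (\<Prod>i<length \<sigma>. measure (measure_pmf (bernoulli_pmf (1/2))) {\<sigma> ! i})"
    by (simp only: fair_measure_def measure_PiM_emb[OF subset_UNIV finite_lessThan] sets_measure_pmf UNIV_I)
  also have "\<dots> = (\<Prod>i<length \<sigma>. 1/2)"
  proof (intro prod.cong refl)
    fix i
    have "pmf (bernoulli_pmf (1/2)) b = 1/2" for b by (cases b) simp_all
    then show "measure (measure_pmf (bernoulli_pmf (1/2))) {\<sigma> ! i} = 1/2"
      by (simp only: measure_pmf_single)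
  qed
  finally show ?thesis by simp
qed

definition string_index :: "bool list \<Rightarrow> nat" where
  "string_index \<sigma> = list_encode (map of_bool \<sigma>)"

text \<open>
  \<open>sigma_set n i\<close> is the \<open>i\<close>-th \<open>\<Sigma>\<^sup>0\<^sub>n\<close> set. The hierarchy starts at \<open>n = 1\<close>; the value at
  \<open>n = 0\<close> is a dummy.
\<close>

fun sigma_set :: "nat \<Rightarrow> nat \<Rightarrow> cantor set" where
  "sigma_set 0 i = {}"
| "sigma_set (Suc 0) i = (\<Union>\<sigma>\<in>{\<sigma>. string_index \<sigma> \<in> ce_set {} i}. cylinder \<sigma>)"
| "sigma_set (Suc (Suc n)) i = (\<Union>j\<in>ce_set {} i. UNIV - sigma_set (Suc n) j)"

definition is_Sigma :: "nat \<Rightarrow> cantor set \<Rightarrow> bool" where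
  "is_Sigma n A \<longleftrightarrow> (\<exists>i. A = sigma_set n i)"

definition is_Pi :: "nat \<Rightarrow> cantor set \<Rightarrow> bool" where
  "is_Pi n A \<longleftrightarrow> is_Sigma n (UNIV - A)"

definition uniformly_Sigma :: "nat \<Rightarrow> (nat \<Rightarrow> cantor set) \<Rightarrow> bool" where
  "uniformly_Sigma n U \<longleftrightarrow> (\<exists>f. computable f \<and> (\<forall>k. U k = sigma_set n (f k)))"


section \<open>Schnorr randomness\<close>

definition schnorr_test :: "nat \<Rightarrow> (nat \<Rightarrow> cantor set) \<Rightarrow> bool" where
  "schnorr_test n U \<longleftrightarrow>
     uniformly_Sigma n U \<and>
     (\<forall>k. measure fair_measure (U k) \<le> (1/2) ^ k) \<and>
     uniformly_computable_reals_in (zero_jump (n - 1)) (\<lambda>k. measure fair_measure (U k))"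

definition schnorr_random :: "nat \<Rightarrow> cantor \<Rightarrow> bool" where
  "schnorr_random n x \<longleftrightarrow> (\<forall>U. schnorr_test n U \<longrightarrow> x \<notin> (\<Inter>k. U k))"


section \<open>Partial transformations\<close>

definition preimage :: "(cantor \<rightharpoonup> cantor) \<Rightarrow> cantor set \<Rightarrow> cantor set" where
  "preimage T B = {x. \<exists>y\<in>B. T x = Some y}"

text \<open>
  Measurability is part of the definition: all preimages of Borel sets, in particular
  \<open>dom T = preimage T UNIV\<close>, are Borel.
\<close>

definition measure_preserving :: "(cantor \<rightharpoonup> cantor) \<Rightarrow> bool" where
  "measure_preserving T \<longleftrightarrow>
     (\<forall>B\<in>sets borel. preimage T B \<in> sets borel \<and>
        measure fair_measure (preimage T B) = measure fair_measure B) \<and>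
     (\<forall>x y. T x = Some y \<longrightarrow> y \<in> dom T)"

definition computable_map :: "(cantor \<rightharpoonup> cantor) \<Rightarrow> bool" where
  "computable_map T \<longleftrightarrow>
     (\<exists>f. computable f \<and>
        (\<forall>\<sigma>. preimage T (cylinder \<sigma>) = dom T \<inter> sigma_set 1 (f (string_index \<sigma>))))"

definition ergodic :: "(cantor \<rightharpoonup> cantor) \<Rightarrow> bool" where
  "ergodic T \<longleftrightarrow>
     (\<forall>B\<in>sets borel. preimage T B = B \<longrightarrow>
        measure fair_measure B = 0 \<or> measure fair_measure B = 1)"

primrec iterate :: "(cantor \<rightharpoonup> cantor) \<Rightarrow> nat \<Rightarrow> cantor \<rightharpoonup> cantor" where
  "iterate T 0 x = Some x"
| "iterate T (Suc k) x = Option.bind (iterate T k x) T"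

end

theory Submission
  imports Defs
begin

text \<open>
  Let \<open>A\<close> be the complement of the \<open>\<Sigma>\<^sub>n\<close> set \<open>U\<close>, and let \<open>V\<^sub>m\<close> consist of the points whose first \<open>m\<close>
  iterates lie in \<open>U\<close>. Preimages under a computable map preserve \<open>\<Sigma>\<^sub>n\<close> effectively, and by ergodicity
  \<open>V\<^sub>m\<close> shrinks to a null set. Measures of \<open>\<Sigma>\<^sub>n\<close> sets are lower semicomputable in the \<open>(n-1)\<close>-st
  jump; since all preimages of \<open>U\<close> have the same computable measure, inclusion-exclusion turns
  this into upper semicomputability of the measure of \<open>V\<^sub>m\<close>. So the oracle finds a subsequence with
  measures at most \<open>2^-j\<close>, and it is a Schnorr test because \<open>\<Sigma>\<^sub>n\<close> sets are effectively closed
  under unions over index sets that are c.e. in the oracle.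

  Conversely, let \<open>x\<close> fail the Schnorr test \<open>U\<close> and let \<open>T\<close> be the shift. The union over all
  strings \<open>\<tau>\<close> of the sets \<open>{y. \<tau>y \<in> U c}\<close>, where \<open>c\<close> depends on \<open>\<tau>\<close> and is so large that the measures
  sum to at most \<open>1/2\<close>, contains all tails of \<open>x\<close>, and \<open>A\<close> is its complement.
\<close>

section \<open>Relative computability\<close>

text \<open>The index set of a \<open>\<Sigma>\<^sub>n\<close> union must be c.e. without an oracle,
  whereas measures are accessible only to \<open>zero_jump (n - 1)\<close>. Every choice made with
  the oracle is therefore phrased as a union over an oracle-c.e. index set, and one half of Post's
  theorem converts the oracle into quantifiers that the hierarchy already has. Upper bounds on
  measures are the scarce side. The measures of an intersection and of a union of two sets add up to
  the sum of the two measures. So upper bounds for the single sets and a lower bound for the union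
  give an upper bound for the intersection, and vice versa. In the first direction this is where
  computability of the measure of \<open>A\<close> enters. As \<open>T\<close> is partial, index
  computations describe preimages only on the domain, which has full measure. In the converse the
  union runs over all strings and not just over the initial segments of \<open>x\<close>, since
  \<open>x\<close> itself need not be computable. The price is a factor \<open>2 ^ l\<close> for
  each string of length \<open>l\<close>, which the choice of the test component has to pay.\<close>

abbreviation pair :: "nat \<Rightarrow> nat \<Rightarrow> nat" where
  "pair a b \<equiv> prod_encode (a, b)"

abbreviation pfst :: "nat \<Rightarrow> nat" where
  "pfst z \<equiv> fst (prod_decode z)"

abbreviation psnd :: "nat \<Rightarrow> nat" where
  "psnd z \<equiv> snd (prod_decode z)"

lemma computable_id: "computable_in Q (\<lambda>x. x)"
  unfolding computable_in_def by (intro exI[of _ "Pairing First Second"]) simp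

lemma computable_compose:
  assumes "computable_in Q f" "computable_in Q g"
  shows "computable_in Q (\<lambda>x. f (g x))"
proof -
  obtain p q where "\<And>x. eval Q p x = Some (f x)" "\<And>x. eval Q q x = Some (g x)"
    using assms unfolding computable_in_def by blast
  then show ?thesis
    unfolding computable_in_def by (intro exI[of _ "Compose p q"]) simp
qed

lemma computable_Suc: "computable_in Q f \<Longrightarrow> computable_in Q (\<lambda>x. Suc (f x))"
  by (rule computable_compose[of Q Suc]) (auto simp: computable_in_def intro: exI[of _ Succ])

lemma computable_const: "computable_in Q (\<lambda>x. c)"
proof (induction c)
  case 0
  show ?case unfolding computable_in_def by (intro exI[of _ Zero]) simp
qed (rule computable_Suc)

lemma computable_pfst: "computable_in Q f \<Longrightarrow> computable_in Q (\<lambda>x. pfst (f x))"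
  by (rule computable_compose[of Q pfst]) (auto simp: computable_in_def intro: exI[of _ First])

lemma computable_psnd: "computable_in Q f \<Longrightarrow> computable_in Q (\<lambda>x. psnd (f x))"
  by (rule computable_compose[of Q psnd]) (auto simp: computable_in_def intro: exI[of _ Second])

lemma computable_pair:
  assumes "computable_in Q f" "computable_in Q g"
  shows "computable_in Q (\<lambda>x. pair (f x) (g x))"
proof -
  obtain p q where "\<And>x. eval Q p x = Some (f x)" "\<And>x. eval Q q x = Some (g x)"
    using assms unfolding computable_in_def by blast
  then show ?thesis
    unfolding computable_in_def by (intro exI[of _ "Pairing p q"]) simp
qed

text \<open>The parameter handed to \<open>PrimRec\<close> is the whole input \<open>x\<close> and
  not \<open>a x\<close>, so \<open>h\<close> may depend on \<open>x\<close>; its three arguments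
  arrive in the packing that \<open>eval\<close> uses for a recursion step.\<close>

lemma computable_rec_nat:
  assumes "computable_in Q a" "computable_in Q n"
    and "computable_in Q (\<lambda>z. h (pfst z) (pfst (psnd z)) (psnd (psnd z)))"
  shows "computable_in Q (\<lambda>x. rec_nat (a x) (h x) (n x))"
proof -
  obtain p q r where *: "\<And>x. eval Q p x = Some (a x)" "\<And>x. eval Q q x = Some (n x)"
    "\<And>z. eval Q r z = Some (h (pfst z) (pfst (psnd z)) (psnd (psnd z)))"
    using assms unfolding computable_in_def by metis
  have "rec_nat (Some (a x))
      (\<lambda>m y. Option.bind y (\<lambda>b. eval Q r (pair x (pair m b)))) k = Some (rec_nat (a x) (h x) k)"
    for x k by (induction k) (simp_all add: *)
  then have "eval Q (Compose (PrimRec p r) (Pairing (Pairing First Second) q)) x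
      = Some (rec_nat (a x) (h x) (n x))" for x
    by (simp add: *)
  then show ?thesis unfolding computable_in_def by blast
qed

section \<open>Decidable predicates and computable arithmetic\<close>

definition decidable_in :: "nat set \<Rightarrow> (nat \<Rightarrow> bool) \<Rightarrow> bool" where
  "decidable_in Q P \<longleftrightarrow> computable_in Q (\<lambda>x. of_bool (P x))"

lemma decidable_oracle: "computable_in Q f \<Longrightarrow> decidable_in Q (\<lambda>x. f x \<in> Q)"
  unfolding decidable_in_def
  by (rule computable_compose[of Q "\<lambda>x. of_bool (x \<in> Q)"])
    (auto simp: computable_in_def of_bool_def intro!: exI[of _ Oracle])

lemma decidable_subst:
  "decidable_in Q P \<Longrightarrow> computable_in Q f \<Longrightarrow> decidable_in Q (\<lambda>x. P (f x))"
  unfolding decidable_in_def by (rule computable_compose)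

lemma decidable_subst2:
  assumes "decidable_in Q (\<lambda>z. P (pfst z) (psnd z))" "computable_in Q f" "computable_in Q g"
  shows "decidable_in Q (\<lambda>x. P (f x) (g x))"
  using decidable_subst[OF assms(1) computable_pair[OF assms(2,3)]] by simp

text \<open>A case distinction is a recursion of length 0 or 1: one branch is the base value, the
  other is the result of the single step.\<close>

lemma computable_if:
  assumes "decidable_in Q P" "computable_in Q f" "computable_in Q g"
  shows "computable_in Q (\<lambda>x. if P x then f x else g x)"
proof -
  have "(\<lambda>x. if P x then f x else g x)
      = (\<lambda>x. rec_nat (g x) (\<lambda>_ _. f x) (of_bool (P x)))"
    by (auto simp: fun_eq_iff)
  moreover have "computable_in Q (\<lambda>x. rec_nat (g x) (\<lambda>_ _. f x) (of_bool (P x)))"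
    using assms unfolding decidable_in_def
    by (intro computable_rec_nat computable_compose[OF assms(2)] computable_pfst computable_id)
  ultimately show ?thesis by simp
qed

lemma decidable_const: "decidable_in Q (\<lambda>x. c)"
  unfolding decidable_in_def by (rule computable_const)

lemma decidable_if:
  assumes "decidable_in Q P" "decidable_in Q R" "decidable_in Q S"
  shows "decidable_in Q (\<lambda>x. if P x then R x else S x)"
proof -
  have "(\<lambda>x. of_bool (if P x then R x else S x) :: nat)
      = (\<lambda>x. if P x then of_bool (R x) else of_bool (S x))" by auto
  then show ?thesis
    using computable_if[OF assms(1), of "\<lambda>x. of_bool (R x)" "\<lambda>x. of_bool (S x)"] assms
    unfolding decidable_in_def by simp
qed

lemma decidable_not: "decidable_in Q P \<Longrightarrow> decidable_in Q (\<lambda>x. \<not> P x)"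
  using decidable_if[of Q P "\<lambda>_. False" "\<lambda>_. True"] by (simp add: decidable_const if_bool_eq_disj)

lemma decidable_conj:
  "decidable_in Q P \<Longrightarrow> decidable_in Q R \<Longrightarrow> decidable_in Q (\<lambda>x. P x \<and> R x)"
  using decidable_if[of Q P R "\<lambda>_. False"] by (simp add: decidable_const if_bool_eq_disj)

lemma decidable_disj:
  "decidable_in Q P \<Longrightarrow> decidable_in Q R \<Longrightarrow> decidable_in Q (\<lambda>x. P x \<or> R x)"
  using decidable_not[OF decidable_conj[OF decidable_not decidable_not], of Q P R] by simp

lemma decidable_imp:
  "decidable_in Q P \<Longrightarrow> decidable_in Q R \<Longrightarrow> decidable_in Q (\<lambda>x. P x \<longrightarrow> R x)"
  using decidable_disj[OF decidable_not, of Q P R] by simp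

lemma decidable_all_less:
  assumes "decidable_in Q (\<lambda>z. P (pfst z) (psnd z))" "computable_in Q f"
  shows "decidable_in Q (\<lambda>x. \<forall>i<f x. P x i)"
proof -
  have eq: "of_bool (\<forall>i<k. P x i) = (rec_nat 1 (\<lambda>i r. if P x i then r else 0) k :: nat)" for x k
    by (induction k) (auto simp: less_Suc_eq)
  show ?thesis
    unfolding decidable_in_def eq
    by (intro computable_rec_nat computable_if decidable_subst2[OF assms(1)] computable_const assms(2)
        computable_pfst computable_psnd computable_id)
qed

lemma decidable_ex_less:
  assumes "decidable_in Q (\<lambda>z. P (pfst z) (psnd z))" "computable_in Q f"
  shows "decidable_in Q (\<lambda>x. \<exists>i<f x. P x i)"
  using decidable_not[OF decidable_all_less[OF decidable_not[OF assms(1)] assms(2)]] by simp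

lemma computable_Least:
  assumes "decidable_in Q (\<lambda>z. P (pfst z) (psnd z))" "\<And>x. \<exists>n. P x n"
  shows "computable_in Q (\<lambda>x. LEAST n. P x n)"
proof -
  \<comment> \<open>\<open>Minimize\<close> searches for the value 0, so truth of \<open>P\<close>
    has to be coded by 0.\<close>
  have "computable_in Q (\<lambda>z. of_bool (\<not> P (pfst z) (psnd z)))"
    using decidable_not[OF assms(1)] unfolding decidable_in_def .
  then obtain p where p: "\<And>z. eval Q p z = Some (of_bool (\<not> P (pfst z) (psnd z)))"
    unfolding computable_in_def by blast
  have "eval Q (Minimize p) x = Some (LEAST n. P x n)" for x
    using assms(2)[of x] by (simp add: p)
  then show ?thesis unfolding computable_in_def by blast
qed

lemma computable_pred:
  assumes "computable_in Q f"
  shows "computable_in Q (\<lambda>x. f x - 1)"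
proof -
  have "k - 1 = rec_nat 0 (\<lambda>m r. m) k" for k :: nat by (cases k) auto
  then have eq: "(\<lambda>x. f x - 1) = (\<lambda>x. rec_nat 0 (\<lambda>m r. m) (f x))" by (intro ext)
  show ?thesis unfolding eq
    by (intro computable_rec_nat assms computable_const computable_psnd computable_pfst computable_id)
qed

lemma computable_add:
  assumes "computable_in Q f" "computable_in Q g"
  shows "computable_in Q (\<lambda>x. f x + g x)"
proof -
  have "a + b = rec_nat a (\<lambda>m r. Suc r) b" for a b :: nat by (induction b) auto
  then have eq: "(\<lambda>x. f x + g x) = (\<lambda>x. rec_nat (f x) (\<lambda>m r. Suc r) (g x))" by (intro ext)
  show ?thesis unfolding eq
    by (intro computable_rec_nat computable_Suc assms computable_compose[OF assms(1)]
        computable_const computable_psnd computable_pfst computable_id)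
qed

lemma computable_minus:
  assumes "computable_in Q f" "computable_in Q g"
  shows "computable_in Q (\<lambda>x. f x - g x)"
proof -
  have "a - b = rec_nat a (\<lambda>m r. r - 1) b" for a b :: nat by (induction b) auto
  then have eq: "(\<lambda>x. f x - g x) = (\<lambda>x. rec_nat (f x) (\<lambda>m r. r - 1) (g x))" by (intro ext)
  show ?thesis unfolding eq
    by (intro computable_rec_nat computable_pred assms computable_compose[OF assms(1)]
        computable_const computable_psnd computable_pfst computable_id)
qed

lemma computable_mult:
  assumes "computable_in Q f" "computable_in Q g"
  shows "computable_in Q (\<lambda>x. f x * g x)"
proof -
  have "a * b = rec_nat 0 (\<lambda>m r. r + a) b" for a b :: nat by (induction b) auto
  then have eq: "(\<lambda>x. f x * g x) = (\<lambda>x. rec_nat 0 (\<lambda>m r. r + f x) (g x))" by (intro ext)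
  show ?thesis unfolding eq
    by (intro computable_rec_nat computable_add assms computable_compose[OF assms(1)]
        computable_const computable_psnd computable_pfst computable_id)
qed

lemma computable_power:
  assumes "computable_in Q f" "computable_in Q g"
  shows "computable_in Q (\<lambda>x. f x ^ g x)"
proof -
  have "a ^ b = rec_nat 1 (\<lambda>m r. r * a) b" for a b :: nat by (induction b) auto
  then have eq: "(\<lambda>x. f x ^ g x) = (\<lambda>x. rec_nat 1 (\<lambda>m r. r * f x) (g x))" by (intro ext)
  show ?thesis unfolding eq
    by (intro computable_rec_nat computable_mult assms computable_compose[OF assms(1)]
        computable_const computable_psnd computable_pfst computable_id)
qed

lemma decidable_less:
  "computable_in Q f \<Longrightarrow> computable_in Q g \<Longrightarrow> decidable_in Q (\<lambda>x. f x < g x)"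
proof -
  assume *: "computable_in Q f" "computable_in Q g"
  \<comment> \<open>Truncated subtraction from 1, applied twice, turns every positive difference
    into 1.\<close>
  have "of_bool (a < b) = (1 - (1 - (b - a)) :: nat)" for a b :: nat by auto
  then show ?thesis unfolding decidable_in_def
    by (simp only:) (intro computable_minus computable_const *)
qed

lemma decidable_le:
  "computable_in Q f \<Longrightarrow> computable_in Q g \<Longrightarrow> decidable_in Q (\<lambda>x. f x \<le> g x)"
  using decidable_not[OF decidable_less, of Q g f] by (simp add: not_less)

lemma decidable_eq:
  "computable_in Q f \<Longrightarrow> computable_in Q g \<Longrightarrow> decidable_in Q (\<lambda>x. f x = g x)"
  using decidable_conj[OF decidable_le decidable_le, of Q f g g f] by (simp add: eq_iff)

lemmas computable_basic_intros =
  computable_id computable_Suc computable_pfst computable_psnd computable_pair computable_if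
  computable_add computable_minus computable_mult computable_power computable_const computable_rec_nat
  decidable_if decidable_not decidable_conj decidable_disj decidable_imp decidable_all_less
  decidable_ex_less decidable_less decidable_le decidable_eq decidable_const

lemma computable_div:
  assumes "computable_in Q f" "computable_in Q g"
  shows "computable_in Q (\<lambda>x. f x div g x)"
proof -
  have "a div b = (LEAST q. b = 0 \<or> a < Suc q * b)" for a b :: nat
  proof (rule Least_equality[symmetric])
    show "b = 0 \<or> a < Suc (a div b) * b"
      using dividend_less_div_times[of b a] by (auto simp: add.commute)
    show "a div b \<le> q" if "b = 0 \<or> a < Suc q * b" for q
      using that by (auto simp: less_mult_imp_div_less less_Suc_eq_le[symmetric] simp del: mult_Suc)
  qed
  moreover have "computable_in Q (\<lambda>x. LEAST q. g x = 0 \<or> f x < Suc q * g x)"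
  proof (rule computable_Least)
    show "decidable_in Q (\<lambda>z. g (pfst z) = 0 \<or> f (pfst z) < Suc (psnd z) * g (pfst z))"
      by (intro computable_basic_intros computable_compose[OF assms(1)] computable_compose[OF assms(2)])
    show "\<exists>n. g x = 0 \<or> f x < Suc n * g x" for x
      by (rule exI[of _ "f x"]) (cases "g x", auto)
  qed
  ultimately show ?thesis by simp
qed

lemma computable_mod:
  assumes "computable_in Q f" "computable_in Q g"
  shows "computable_in Q (\<lambda>x. f x mod g x)"
  unfolding minus_div_mult_eq_mod[symmetric]
  by (intro computable_minus computable_mult computable_div assms)

lemma decidable_even: "computable_in Q f \<Longrightarrow> decidable_in Q (\<lambda>x. even (f x))"
  unfolding even_iff_mod_2_eq_zero
  by (intro decidable_eq computable_mod computable_const)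

lemmas computable_intros = computable_basic_intros computable_div computable_mod decidable_even

text \<open>The oracle \<open>{}\<close> answers every query by 0, so \<open>Zero\<close> can stand
  for \<open>Oracle\<close>; afterwards the result is the same for all oracles.\<close>

primrec strip_oracle :: "prog \<Rightarrow> prog" where
  "strip_oracle Zero = Zero"
| "strip_oracle Succ = Succ"
| "strip_oracle First = First"
| "strip_oracle Second = Second"
| "strip_oracle Oracle = Zero"
| "strip_oracle (Pairing p q) = Pairing (strip_oracle p) (strip_oracle q)"
| "strip_oracle (Compose p q) = Compose (strip_oracle p) (strip_oracle q)"
| "strip_oracle (PrimRec p q) = PrimRec (strip_oracle p) (strip_oracle q)"
| "strip_oracle (Minimize p) = Minimize (strip_oracle p)"

lemma eval_strip_oracle: "eval Q (strip_oracle p) = eval {} p"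
  by (induction p) (rule ext, simp)+

lemma computable_imp_computable_in: "computable f \<Longrightarrow> computable_in Q f"
  unfolding computable_in_def by (metis eval_strip_oracle)

lemma decidable_imp_decidable_in: "decidable_in {} P \<Longrightarrow> decidable_in Q P"
  unfolding decidable_in_def by (rule computable_imp_computable_in)

section \<open>Recursively enumerable predicates\<close>

definition re_in :: "nat set \<Rightarrow> (nat \<Rightarrow> bool) \<Rightarrow> bool" where
  "re_in Q P \<longleftrightarrow>
     (\<exists>R. decidable_in Q (\<lambda>z. R (pfst z) (psnd z)) \<and> (\<forall>x. P x \<longleftrightarrow> (\<exists>n. R x n)))"

text \<open>The class \<open>\<Sigma>\<^sub>2\<close> relative to \<open>Q\<close>. The inner
  relation is kept c.e. and negated, which is the shape in which complements occur in the definition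
  of \<open>sigma_set\<close>.\<close>

definition sigma2_in :: "nat set \<Rightarrow> (nat \<Rightarrow> bool) \<Rightarrow> bool" where
  "sigma2_in Q P \<longleftrightarrow>
     (\<exists>R. re_in Q (\<lambda>z. R (pfst z) (psnd z)) \<and> (\<forall>x. P x \<longleftrightarrow> (\<exists>n. \<not> R x n)))"

text \<open>What is needed to put one existential quantifier in front of a class:
  \<open>projection\<close> then yields a class closed under unbounded quantifiers as well. Applied
  to decidable predicates it gives the c.e. ones, applied to complements of c.e. predicates it gives
  \<open>sigma2_in\<close>.\<close>

locale bounded_class =
  fixes D :: "(nat \<Rightarrow> bool) \<Rightarrow> bool"
  assumes decidable: "decidable_in {} P \<Longrightarrow> D P"
    and subst: "D P \<Longrightarrow> computable f \<Longrightarrow> D (\<lambda>x. P (f x))"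
    and conj: "D P \<Longrightarrow> D R \<Longrightarrow> D (\<lambda>x. P x \<and> R x)"
    and disj: "D P \<Longrightarrow> D R \<Longrightarrow> D (\<lambda>x. P x \<or> R x)"
    and all_less: "D (\<lambda>z. S (pfst z) (psnd z)) \<Longrightarrow> computable f \<Longrightarrow> D (\<lambda>x. \<forall>i<f x. S x i)"
    and ex_less: "D (\<lambda>z. S (pfst z) (psnd z)) \<Longrightarrow> computable f \<Longrightarrow> D (\<lambda>x. \<exists>i<f x. S x i)"
begin

lemma subst2:
  assumes "D (\<lambda>z. P (pfst z) (psnd z))" "computable f" "computable g"
  shows "D (\<lambda>x. P (f x) (g x))"
  using subst[OF assms(1) computable_pair[OF assms(2,3)]] by simp

end

locale projective_class = bounded_class +
  assumes ex: "D (\<lambda>z. S (pfst z) (psnd z)) \<Longrightarrow> D (\<lambda>x. \<exists>n. S x n)"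

context bounded_class
begin

definition projection :: "(nat \<Rightarrow> bool) \<Rightarrow> bool" where
  "projection P \<longleftrightarrow> (\<exists>R. D (\<lambda>z. R (pfst z) (psnd z)) \<and> (\<forall>x. P x \<longleftrightarrow> (\<exists>n. R x n)))"

lemma projectionI: "D (\<lambda>z. R (pfst z) (psnd z)) \<Longrightarrow> (\<And>x. P x \<longleftrightarrow> (\<exists>n. R x n)) \<Longrightarrow> projection P"
  unfolding projection_def by blast

lemma projection_of: "D P \<Longrightarrow> projection P"
  by (rule projectionI[of "\<lambda>x _. P x"]) (rule subst, assumption, intro computable_pfst computable_id, simp)

lemma projection_subst:
  assumes "projection P" "computable f" shows "projection (\<lambda>x. P (f x))"
proof -
  obtain R where R: "D (\<lambda>z. R (pfst z) (psnd z))" "\<And>x. P x \<longleftrightarrow> (\<exists>n. R x n)"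
    using assms unfolding projection_def by blast
  show ?thesis
    by (rule projectionI[of "\<lambda>x n. R (f x) n"])
      (auto simp: R(2) intro!: subst2[OF R(1)] computable_intros computable_compose[OF assms(2)])
qed

lemma projection_ex:
  assumes "projection (\<lambda>z. S (pfst z) (psnd z))" shows "projection (\<lambda>x. \<exists>m. S x m)"
proof -
  obtain R where R: "D (\<lambda>z. R (pfst z) (psnd z))" "\<And>z. S (pfst z) (psnd z) \<longleftrightarrow> (\<exists>n. R z n)"
    using assms unfolding projection_def by blast
  have S: "S x m \<longleftrightarrow> (\<exists>n. R (pair x m) n)" for x m using R(2)[of "pair x m"] by simp
  show ?thesis
  proof (rule projectionI[of "\<lambda>x w. R (pair x (pfst w)) (psnd w)"])
    show "D (\<lambda>z. R (pair (pfst z) (pfst (psnd z))) (psnd (psnd z)))"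
      by (intro subst2[OF R(1)] computable_intros)
    show "(\<exists>m. S x m) \<longleftrightarrow> (\<exists>w. R (pair x (pfst w)) (psnd w))" for x
      unfolding S by (metis prod_encode_inverse fst_conv snd_conv)
  qed
qed

lemma projection_conj:
  assumes "projection P" "projection S" shows "projection (\<lambda>x. P x \<and> S x)"
proof -
  obtain R where R: "D (\<lambda>z. R (pfst z) (psnd z))" "\<And>x. P x \<longleftrightarrow> (\<exists>n. R x n)"
    using assms unfolding projection_def by blast
  obtain R' where R': "D (\<lambda>z. R' (pfst z) (psnd z))" "\<And>x. S x \<longleftrightarrow> (\<exists>n. R' x n)"
    using assms unfolding projection_def by blast
  show ?thesis
  proof (rule projectionI[of "\<lambda>x w. R x (pfst w) \<and> R' x (psnd w)"])
    show "D (\<lambda>z. R (pfst z) (pfst (psnd z)) \<and> R' (pfst z) (psnd (psnd z)))"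
      by (intro conj subst2[OF R(1)] subst2[OF R'(1)] computable_intros)
    show "P x \<and> S x \<longleftrightarrow> (\<exists>w. R x (pfst w) \<and> R' x (psnd w))" for x
      unfolding R R' by (metis prod_encode_inverse fst_conv snd_conv)
  qed
qed

lemma projection_disj:
  assumes "projection P" "projection S" shows "projection (\<lambda>x. P x \<or> S x)"
proof -
  obtain R where R: "D (\<lambda>z. R (pfst z) (psnd z))" "\<And>x. P x \<longleftrightarrow> (\<exists>n. R x n)"
    using assms unfolding projection_def by blast
  obtain R' where R': "D (\<lambda>z. R' (pfst z) (psnd z))" "\<And>x. S x \<longleftrightarrow> (\<exists>n. R' x n)"
    using assms unfolding projection_def by blast
  show ?thesis
    by (rule projectionI[of "\<lambda>x n. R x n \<or> R' x n"]) (auto simp: R(2) R'(2) intro: disj R(1) R'(1))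
qed

text \<open>Finitely many witnesses have a common bound \<open>N\<close>, so the unbounded
  quantifier moves in front of the bounded one and leaves a bounded quantifier behind.\<close>

lemma projection_all_less:
  assumes "projection (\<lambda>z. S (pfst z) (psnd z))" "computable f"
  shows "projection (\<lambda>x. \<forall>i<f x. S x i)"
proof -
  obtain R where R: "D (\<lambda>z. R (pfst z) (psnd z))" "\<And>z. S (pfst z) (psnd z) \<longleftrightarrow> (\<exists>n. R z n)"
    using assms unfolding projection_def by blast
  have S: "S x m \<longleftrightarrow> (\<exists>n. R (pair x m) n)" for x m using R(2)[of "pair x m"] by simp
  show ?thesis
  proof (rule projectionI[of "\<lambda>x N. \<forall>i<f x. \<exists>n<N. R (pair x i) n"])
    show "D (\<lambda>z. \<forall>i<f (pfst z). \<exists>n<psnd z. R (pair (pfst z) i) n)"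
      by (intro all_less ex_less subst2[OF R(1)] computable_intros computable_compose[OF assms(2)])
    show "(\<forall>i<f x. S x i) \<longleftrightarrow> (\<exists>N. \<forall>i<f x. \<exists>n<N. R (pair x i) n)" for x
    proof -
      have "\<exists>N. \<forall>i<k. \<exists>n<N. R (pair x i) n" if "\<forall>i<k. \<exists>n. R (pair x i) n" for k
        using that
      proof (induction k)
        case (Suc k)
        then obtain N n where "\<forall>i<k. \<exists>n<N. R (pair x i) n" "R (pair x k) n" by auto
        then show ?case
          by (intro exI[of _ "max N (Suc n)"]) (auto simp: less_Suc_eq less_max_iff_disj)
      qed auto
      then show ?thesis unfolding S by blast
    qed
  qed
qed

lemma projection_ex_less:
  assumes "projection (\<lambda>z. S (pfst z) (psnd z))" "computable f"
  shows "projection (\<lambda>x. \<exists>i<f x. S x i)"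
proof -
  have "projection (\<lambda>x. \<exists>i. i < f x \<and> S x i)"
    by (intro projection_ex projection_conj assms(1) projection_of[OF decidable]
        decidable_less computable_intros computable_compose[OF assms(2)])
  then show ?thesis .
qed

lemma projective_class_projection: "projective_class projection"
  by unfold_locales
    (auto intro: projection_of decidable projection_subst projection_conj projection_disj
      projection_all_less projection_ex_less projection_ex)

end

lemma bounded_class_decidable: "bounded_class (decidable_in Q)"
  by unfold_locales
    (auto intro: decidable_imp_decidable_in decidable_subst decidable_conj decidable_disj
      decidable_all_less decidable_ex_less computable_imp_computable_in)

interpretation re: projective_class "re_in Q"
proof -
  have "re_in Q = bounded_class.projection (decidable_in Q)"
    unfolding fun_eq_iff re_in_def bounded_class.projection_def[OF bounded_class_decidable] by blast
  then show "projective_class (re_in Q)"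
    using bounded_class.projective_class_projection[OF bounded_class_decidable] by metis
qed

text \<open>Negation exchanges the two bounded quantifiers and the two connectives, so closure is
  inherited from the c.e. predicates.\<close>

lemma bounded_class_co_re: "bounded_class (\<lambda>P. re_in Q (\<lambda>x. \<not> P x))"
proof unfold_locales
  fix P R :: "nat \<Rightarrow> bool" and S f
  show "decidable_in {} P \<Longrightarrow> re_in Q (\<lambda>x. \<not> P x)"
    by (intro re.decidable decidable_not)
  show "re_in Q (\<lambda>x. \<not> P x) \<Longrightarrow> computable f \<Longrightarrow> re_in Q (\<lambda>x. \<not> P (f x))"
    by (rule re.subst)
  show "re_in Q (\<lambda>x. \<not> P x) \<Longrightarrow> re_in Q (\<lambda>x. \<not> R x) \<Longrightarrow> re_in Q (\<lambda>x. \<not> (P x \<and> R x))"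
    using re.disj[of Q "\<lambda>x. \<not> P x" "\<lambda>x. \<not> R x"] by (simp only: de_Morgan_conj)
  show "re_in Q (\<lambda>x. \<not> P x) \<Longrightarrow> re_in Q (\<lambda>x. \<not> R x) \<Longrightarrow> re_in Q (\<lambda>x. \<not> (P x \<or> R x))"
    using re.conj by simp
  show "re_in Q (\<lambda>z. \<not> S (pfst z) (psnd z)) \<Longrightarrow> computable f \<Longrightarrow> re_in Q (\<lambda>x. \<not> (\<forall>i<f x. S x i))"
    using re.ex_less[of Q "\<lambda>x i. \<not> S x i"] by simp
  show "re_in Q (\<lambda>z. \<not> S (pfst z) (psnd z)) \<Longrightarrow> computable f \<Longrightarrow> re_in Q (\<lambda>x. \<not> (\<exists>i<f x. S x i))"
    using re.all_less[of Q "\<lambda>x i. \<not> S x i"] by simp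
qed

interpretation sigma2: projective_class "sigma2_in Q"
proof -
  have "sigma2_in Q P \<longleftrightarrow> bounded_class.projection (\<lambda>P. re_in Q (\<lambda>x. \<not> P x)) P" for P
  proof -
    have "sigma2_in Q P \<longleftrightarrow>
        (\<exists>R. re_in Q (\<lambda>z. \<not> \<not> R (pfst z) (psnd z)) \<and> (\<forall>x. P x \<longleftrightarrow> (\<exists>n. \<not> R x n)))"
      unfolding sigma2_in_def by simp
    also have "\<dots> \<longleftrightarrow> (\<exists>R. re_in Q (\<lambda>z. \<not> R (pfst z) (psnd z)) \<and> (\<forall>x. P x \<longleftrightarrow> (\<exists>n. R x n)))"
    proof (intro iffI; elim exE)
      fix R assume "re_in Q (\<lambda>z. \<not> \<not> R (pfst z) (psnd z)) \<and> (\<forall>x. P x \<longleftrightarrow> (\<exists>n. \<not> R x n))"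
      then show "\<exists>R. re_in Q (\<lambda>z. \<not> R (pfst z) (psnd z)) \<and> (\<forall>x. P x \<longleftrightarrow> (\<exists>n. R x n))"
        by (intro exI[of _ "\<lambda>x n. \<not> R x n"])
    next
      fix R assume "re_in Q (\<lambda>z. \<not> R (pfst z) (psnd z)) \<and> (\<forall>x. P x \<longleftrightarrow> (\<exists>n. R x n))"
      then show "\<exists>R. re_in Q (\<lambda>z. \<not> \<not> R (pfst z) (psnd z)) \<and> (\<forall>x. P x \<longleftrightarrow> (\<exists>n. \<not> R x n))"
        by (intro exI[of _ "\<lambda>x n. \<not> R x n"]) simp
    qed
    finally show ?thesis unfolding bounded_class.projection_def[OF bounded_class_co_re] .
  qed
  then have "sigma2_in Q = bounded_class.projection (\<lambda>P. re_in Q (\<lambda>x. \<not> P x))" by blast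
  then show "projective_class (sigma2_in Q)"
    using bounded_class.projective_class_projection[OF bounded_class_co_re] by metis
qed


section \<open>Universality, parametrization and the jump\<close>

text \<open>Sequences are iterated pairs without a length: every number codes an infinite sequence,
  every finite sequence is an initial part of one, and lengths are quantified separately.\<close>

definition cnth :: "nat \<Rightarrow> nat \<Rightarrow> nat" where
  "cnth c i = pfst ((psnd ^^ i) c)"

lemma computable_cnth:
  assumes "computable_in Q f" "computable_in Q g"
  shows "computable_in Q (\<lambda>x. cnth (f x) (g x))"
proof -
  have "(psnd ^^ i) c = rec_nat c (\<lambda>m r. psnd r) i" for c i by (induction i) auto
  then have eq: "(\<lambda>x. cnth (f x) (g x)) = (\<lambda>x. pfst (rec_nat (f x) (\<lambda>m r. psnd r) (g x)))"
    unfolding cnth_def by (intro ext) simp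
  show ?thesis unfolding eq by (intro computable_intros assms)
qed

lemma ex_cnth: "\<exists>c. \<forall>i<n. cnth c i = f i"
proof (induction n arbitrary: f)
  case (Suc n)
  from Suc.IH[of "\<lambda>i. f (Suc i)"] obtain c where c: "\<forall>i<n. cnth c i = f (Suc i)" by blast
  have "cnth (pair (f 0) c) i = f i" if "i < Suc n" for i
  proof (cases i)
    case (Suc j)
    have "(psnd ^^ Suc j) (pair (f 0) c) = (psnd ^^ j) c"
      by (simp only: funpow_Suc_right comp_apply prod_encode_inverse snd_conv)
    then show ?thesis using that c Suc unfolding cnth_def by simp
  qed (simp add: cnth_def)
  then show ?case by blast
qed simp

abbreviation index_fact :: "nat \<Rightarrow> nat" where
  "index_fact e \<equiv> pair 0 e"

abbreviation eval_fact :: "nat \<Rightarrow> nat \<Rightarrow> nat \<Rightarrow> nat" where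
  "eval_fact e x y \<equiv> pair (Suc 0) (pair e (pair x y))"

text \<open>
  Computations are replaced by finite derivations. As only two rules look at the oracle, any
  projective class containing \<open>Q\<close> and its complement contains derivability relative to \<open>Q\<close>. With
  the class \<open>re_in Q\<close> this is universality, and with \<open>sigma2_in Q\<close> and the oracle
  \<open>turing_jump Q\<close> it is one half of Post's theorem. The second form of facts says nothing
  if \<open>e\<close> is not the index of a program, which is why the first form is needed.
\<close>

inductive justified :: "nat set \<Rightarrow> nat set \<Rightarrow> nat \<Rightarrow> bool" for Q S where
  index_atom: "k < 5 \<Longrightarrow> justified Q S (index_fact (pair k 0))"
| index_binary: "4 < k \<Longrightarrow> k < 8 \<Longrightarrow> index_fact p \<in> S \<Longrightarrow> index_fact q \<in> S \<Longrightarrow>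
    justified Q S (index_fact (pair k (pair p q)))"
| index_minimize: "index_fact p \<in> S \<Longrightarrow> justified Q S (index_fact (pair 8 p))"
| zero: "justified Q S (eval_fact (pair 0 0) x 0)"
| succ: "justified Q S (eval_fact (pair 1 0) x (Suc x))"
| first: "justified Q S (eval_fact (pair 2 0) x (pfst x))"
| second: "justified Q S (eval_fact (pair 3 0) x (psnd x))"
| oracle_in: "x \<in> Q \<Longrightarrow> justified Q S (eval_fact (pair 4 0) x 1)"
| oracle_not_in: "x \<notin> Q \<Longrightarrow> justified Q S (eval_fact (pair 4 0) x 0)"
| pairing: "eval_fact p x a \<in> S \<Longrightarrow> eval_fact q x b \<in> S \<Longrightarrow>
    justified Q S (eval_fact (pair 5 (pair p q)) x (pair a b))"
| compose: "eval_fact q x a \<in> S \<Longrightarrow> eval_fact p a b \<in> S \<Longrightarrow>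
    justified Q S (eval_fact (pair 6 (pair p q)) x b)"
| primrec_0: "eval_fact p a b \<in> S \<Longrightarrow>
    justified Q S (eval_fact (pair 7 (pair p q)) (pair a 0) b)"
| primrec_Suc: "eval_fact (pair 7 (pair p q)) (pair a m) b \<in> S \<Longrightarrow>
    eval_fact q (pair a (pair m b)) d \<in> S \<Longrightarrow>
    justified Q S (eval_fact (pair 7 (pair p q)) (pair a (Suc m)) d)"
| minimize: "eval_fact p (pair x n) 0 \<in> S \<Longrightarrow>
    (\<forall>m<n. \<exists>b. eval_fact p (pair x m) (Suc b) \<in> S) \<Longrightarrow>
    justified Q S (eval_fact (pair 8 p) x n)"

lemma justified_mono: "justified Q S c \<Longrightarrow> S \<subseteq> S' \<Longrightarrow> justified Q S' c"
  by (erule justified.cases; hypsubst; rule justified.intros; blast)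

definition true_fact :: "nat set \<Rightarrow> nat \<Rightarrow> bool" where
  "true_fact Q c \<longleftrightarrow>
     (\<forall>e. c = index_fact e \<longrightarrow> (\<exists>p. prog_index p = e)) \<and>
     (\<forall>e x y. c = eval_fact e x y \<longrightarrow> (\<forall>p. prog_index p = e \<longrightarrow> eval Q p x = Some y))"

lemma true_index_fact: "true_fact Q (index_fact e) \<longleftrightarrow> (\<exists>p. prog_index p = e)"
  and true_eval_fact:
    "true_fact Q (eval_fact e x y) \<longleftrightarrow> (\<forall>p. prog_index p = e \<longrightarrow> eval Q p x = Some y)"
  by (auto simp: true_fact_def)

lemma prog_index_eq_pair_iff:
  "prog_index r = pair 0 a \<longleftrightarrow> r = Zero \<and> a = 0"
  "prog_index r = pair (Suc 0) a \<longleftrightarrow> r = Succ \<and> a = 0"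
  "prog_index r = pair 2 a \<longleftrightarrow> r = First \<and> a = 0"
  "prog_index r = pair 3 a \<longleftrightarrow> r = Second \<and> a = 0"
  "prog_index r = pair 4 a \<longleftrightarrow> r = Oracle \<and> a = 0"
  "prog_index r = pair 5 a \<longleftrightarrow> (\<exists>p q. r = Pairing p q \<and> a = pair (prog_index p) (prog_index q))"
  "prog_index r = pair 6 a \<longleftrightarrow> (\<exists>p q. r = Compose p q \<and> a = pair (prog_index p) (prog_index q))"
  "prog_index r = pair 7 a \<longleftrightarrow> (\<exists>p q. r = PrimRec p q \<and> a = pair (prog_index p) (prog_index q))"
  "prog_index r = pair 8 a \<longleftrightarrow> (\<exists>p. r = Minimize p \<and> a = prog_index p)"
  by (cases r; auto)+

lemma justified_sound:
  assumes "justified Q S c" "\<And>s. s \<in> S \<Longrightarrow> true_fact Q s"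
  shows "true_fact Q c"
  using assms(1)
proof cases
  case (index_atom k)
  then have "k = 0 \<or> k = 1 \<or> k = 2 \<or> k = 3 \<or> k = 4" by auto
  then show ?thesis
    unfolding index_atom true_index_fact
    by (auto simp: prog_index_eq_pair_iff)
next
  case (index_binary k p q)
  then obtain p' q' where "prog_index p' = p" "prog_index q' = q"
    using assms(2) by (metis true_index_fact)
  moreover from index_binary have "k = 5 \<or> k = 6 \<or> k = 7" by auto
  ultimately show ?thesis
    unfolding index_binary true_index_fact
    by (auto simp: prog_index_eq_pair_iff)
next
  case (index_minimize p)
  then obtain p' where "prog_index p' = p" using assms(2) by (metis true_index_fact)
  then show ?thesis
    unfolding index_minimize true_index_fact by (auto simp: prog_index_eq_pair_iff)
next
  case (pairing p x a q b)
  then show ?thesis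
    using assms(2)[OF pairing(2)] assms(2)[OF pairing(3)]
    by (auto simp: true_eval_fact prog_index_eq_pair_iff)
next
  case (compose q x a p b)
  then show ?thesis
    using assms(2)[OF compose(2)] assms(2)[OF compose(3)]
    by (auto simp: true_eval_fact prog_index_eq_pair_iff)
next
  case (primrec_0 p a b q)
  then show ?thesis
    using assms(2)[OF primrec_0(2)] by (auto simp: true_eval_fact prog_index_eq_pair_iff)
next
  case (primrec_Suc p q a m b d)
  show ?thesis
    unfolding primrec_Suc(1) true_eval_fact
  proof (intro allI impI)
    fix r assume "prog_index r = pair 7 (pair p q)"
    then obtain p' q' where r: "r = PrimRec p' q'" "prog_index p' = p" "prog_index q' = q"
      by (auto simp: prog_index_eq_pair_iff)
    have "eval Q (PrimRec p' q') (pair a m) = Some b"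
      using assms(2)[OF primrec_Suc(2)] r unfolding true_eval_fact by (metis prog_index.simps(8))
    moreover have "eval Q q' (pair a (pair m b)) = Some d"
      using assms(2)[OF primrec_Suc(3)] r by (auto simp: true_eval_fact)
    ultimately show "eval Q r (pair a (Suc m)) = Some d"
      unfolding r(1) by simp
  qed
next
  case (minimize p x n)
  show ?thesis
    unfolding minimize(1) true_eval_fact
  proof (intro allI impI)
    fix r assume "prog_index r = pair 8 p"
    then obtain p' where r: "r = Minimize p'" "prog_index p' = p"
      by (auto simp: prog_index_eq_pair_iff)
    have 0: "eval Q p' (pair x n) = Some 0"
      using assms(2)[OF minimize(2)] r by (auto simp: true_eval_fact)
    have S: "\<exists>b. eval Q p' (pair x m) = Some (Suc b)" if "m < n" for m
      using minimize(3) assms(2) r that by (meson true_eval_fact)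
    have "(LEAST n. eval Q p' (pair x n) = Some 0) = n"
      using 0 S by (intro Least_equality) (force simp: not_less[symmetric])+
    then show "eval Q r x = Some n"
      using 0 S unfolding r(1) by fastforce
  qed
qed (auto simp: true_eval_fact prog_index_eq_pair_iff)

definition valid_derivation :: "nat set \<Rightarrow> nat list \<Rightarrow> bool" where
  "valid_derivation Q l \<longleftrightarrow> (\<forall>i<length l. justified Q (set (take i l)) (l ! i))"

definition derivable :: "nat set \<Rightarrow> nat \<Rightarrow> bool" where
  "derivable Q c \<longleftrightarrow> (\<exists>l. valid_derivation Q l \<and> c \<in> set l)"

lemma derivable_sound:
  assumes "derivable Q c" shows "true_fact Q c"
proof -
  obtain l where l: "valid_derivation Q l" "c \<in> set l"
    using assms unfolding derivable_def by blast
  have "true_fact Q (l ! i)" if "i < length l" for i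
    using that
  proof (induction i rule: less_induct)
    case (less i)
    show ?case
    proof (rule justified_sound)
      show "justified Q (set (take i l)) (l ! i)"
        using l(1) less.prems unfolding valid_derivation_def by blast
      show "true_fact Q s" if "s \<in> set (take i l)" for s
        using that less by (auto simp: in_set_conv_nth)
    qed
  qed
  then show ?thesis using l(2) by (auto simp: in_set_conv_nth)
qed

lemma valid_derivation_append:
  assumes "valid_derivation Q l" "valid_derivation Q l'"
  shows "valid_derivation Q (l @ l')"
  unfolding valid_derivation_def
proof (intro allI impI)
  fix i assume i: "i < length (l @ l')"
  show "justified Q (set (take i (l @ l'))) ((l @ l') ! i)"
  proof (cases "i < length l")
    case True
    then show ?thesis using assms(1) by (simp add: valid_derivation_def nth_append)
  next
    case False
    then have "justified Q (set (take (i - length l) l')) (l' ! (i - length l))"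
      using i assms(2) by (simp add: valid_derivation_def)
    then show ?thesis using False by (auto simp: nth_append intro: justified_mono)
  qed
qed

text \<open>The derivations of the finitely many premises are concatenated;
  \<open>justified_mono\<close> makes additional earlier lines harmless.\<close>

lemma derivable_step:
  assumes "finite S" "\<And>s. s \<in> S \<Longrightarrow> derivable Q s" "justified Q S c"
  shows "derivable Q c"
proof -
  have "\<exists>l. valid_derivation Q l \<and> S \<subseteq> set l"
    using assms(1,2)
  proof (induction S)
    case empty
    show ?case by (intro exI[of _ "[]"]) (simp add: valid_derivation_def)
  next
    case (insert s S)
    then obtain l l' where "valid_derivation Q l" "S \<subseteq> set l" "valid_derivation Q l'" "s \<in> set l'"
      unfolding derivable_def by (metis insert_iff)
    then show ?case by (intro exI[of _ "l @ l'"]) (auto intro: valid_derivation_append)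
  qed
  then obtain l where l: "valid_derivation Q l" "S \<subseteq> set l" by blast
  have "valid_derivation Q (l @ [c])"
    unfolding valid_derivation_def
  proof (intro allI impI)
    fix i assume "i < length (l @ [c])"
    then consider "i < length l" | "i = length l" by fastforce
    then show "justified Q (set (take i (l @ [c]))) ((l @ [c]) ! i)"
      using l justified_mono[OF assms(3) l(2)] by cases (auto simp: valid_derivation_def nth_append)
  qed
  then show ?thesis unfolding derivable_def by (intro exI[of _ "l @ [c]"]) simp
qed

lemma derivable_index: "derivable Q (index_fact (prog_index p))"
proof (induction p)
  case (Pairing p q)
  show ?case
    unfolding prog_index.simps by (rule derivable_step[OF _ _ index_binary[of _ "prog_index p"
        "{index_fact (prog_index p), index_fact (prog_index q)}" "prog_index q"]]) (use Pairing in auto)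
next
  case (Compose p q)
  show ?case
    unfolding prog_index.simps by (rule derivable_step[OF _ _ index_binary[of _ "prog_index p"
        "{index_fact (prog_index p), index_fact (prog_index q)}" "prog_index q"]]) (use Compose in auto)
next
  case (PrimRec p q)
  show ?case
    unfolding prog_index.simps by (rule derivable_step[OF _ _ index_binary[of _ "prog_index p"
        "{index_fact (prog_index p), index_fact (prog_index q)}" "prog_index q"]]) (use PrimRec in auto)
next
  case (Minimize p)
  show ?case
    unfolding prog_index.simps by (rule derivable_step[OF _ _ index_minimize[of "prog_index p" "{index_fact (prog_index p)}"]]) (use Minimize in auto)
qed ((rule derivable_step[of "{}"]; (auto intro: index_atom)?)+)

lemma derivable_eval: "eval Q p x = Some y \<Longrightarrow> derivable Q (eval_fact (prog_index p) x y)"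
proof (induction p arbitrary: x y)
  case (Pairing p q)
  then obtain a b where ab: "eval Q p x = Some a" "eval Q q x = Some b" "y = pair a b"
    by (auto simp: bind_eq_Some_conv)
  show ?case unfolding ab(3) prog_index.simps
    by (rule derivable_step[OF _ _ pairing[of "prog_index p" x a
      "{eval_fact (prog_index p) x a, eval_fact (prog_index q) x b}"]])
      (use Pairing.IH ab in auto)
next
  case (Compose p q)
  then obtain a where a: "eval Q q x = Some a" "eval Q p a = Some y"
    by (auto simp: bind_eq_Some_conv)
  show ?case unfolding prog_index.simps
    by (rule derivable_step[OF _ _ compose[of "prog_index q" x a
      "{eval_fact (prog_index q) x a, eval_fact (prog_index p) a y}"]])
      (use Compose.IH a in auto)
next
  case (PrimRec p q)
  define a where "a = pfst x"
  have "eval Q (PrimRec p q) (pair a n) = Some y \<Longrightarrow>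
      derivable Q (eval_fact (prog_index (PrimRec p q)) (pair a n) y)" for n y
  proof (induction n arbitrary: y)
    case 0
    show ?case unfolding prog_index.simps
      by (rule derivable_step[OF _ _ primrec_0[of "prog_index p" a y
        "{eval_fact (prog_index p) a y}"]]) (use PrimRec.IH 0 in auto)
  next
    case (Suc n)
    then obtain b where b: "eval Q (PrimRec p q) (pair a n) = Some b"
      "eval Q q (pair a (pair n b)) = Some y"
      by (auto simp: bind_eq_Some_conv)
    show ?case unfolding prog_index.simps
      by (rule derivable_step[OF _ _ primrec_Suc[of "prog_index p" "prog_index q" a n b
        "{eval_fact (prog_index (PrimRec p q)) (pair a n) b,
          eval_fact (prog_index q) (pair a (pair n b)) y}"]])
        (use PrimRec.IH Suc.IH b in auto)
  qed
  from this[of "psnd x" y] PrimRec.prems show ?case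
    unfolding a_def by (simp del: eval.simps prog_index.simps)
next
  case (Minimize p)
  define n where "n = (LEAST n. eval Q p (pair x n) = Some 0)"
  from Minimize.prems obtain n0 where n0: "eval Q p (pair x n0) = Some 0"
    "\<forall>m<n0. eval Q p (pair x m) \<noteq> None" and y: "y = n"
    unfolding n_def by (auto split: if_splits)
  have n: "eval Q p (pair x n) = Some 0" "n \<le> n0"
    unfolding n_def using n0(1) by (auto intro: LeastI Least_le)
  have "\<forall>m. m < n \<longrightarrow> (\<exists>b. eval Q p (pair x m) = Some (Suc b))"
  proof (intro allI impI)
    fix m assume "m < n"
    then have "eval Q p (pair x m) \<noteq> None" "eval Q p (pair x m) \<noteq> Some 0"
      using n(2) n0(2) unfolding n_def by (auto dest: not_less_Least)
    then show "\<exists>b. eval Q p (pair x m) = Some (Suc b)"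
      by (metis not0_implies_Suc option.exhaust)
  qed
  then obtain b where b: "\<And>m. m < n \<Longrightarrow> eval Q p (pair x m) = Some (Suc (b m))" by metis
  show ?case unfolding prog_index.simps y
    by (rule derivable_step[OF _ _ minimize[of "prog_index p" x n
      "insert (eval_fact (prog_index p) (pair x n) 0)
        ((\<lambda>m. eval_fact (prog_index p) (pair x m) (Suc (b m))) ` {..<n})"]])
      (use Minimize.IH n(1) b in auto)
next
  case Zero
  then show ?case using derivable_step[OF _ _ justified.zero[of Q "{}" x]] by simp
next
  case Succ
  then show ?case using derivable_step[OF _ _ justified.succ[of Q "{}" x]] by simp
next
  case First
  then show ?case using derivable_step[OF _ _ justified.first[of Q "{}" x]] by simp
next
  case Second
  then show ?case using derivable_step[OF _ _ justified.second[of Q "{}" x]] by simp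
next
  case Oracle
  then show ?case
    using derivable_step[OF _ _ justified.oracle_in[of x Q "{}"]]
      derivable_step[OF _ _ justified.oracle_not_in[of x Q "{}"]] by (auto split: if_splits)
qed

lemma in_ce_set_iff_derivable:
  "x \<in> ce_set Q e \<longleftrightarrow> derivable Q (index_fact e) \<and> (\<exists>y. derivable Q (eval_fact e x y))"
proof
  assume "x \<in> ce_set Q e"
  then show "derivable Q (index_fact e) \<and> (\<exists>y. derivable Q (eval_fact e x y))"
    unfolding ce_set_def using derivable_index derivable_eval by fast
next
  assume "derivable Q (index_fact e) \<and> (\<exists>y. derivable Q (eval_fact e x y))"
  then show "x \<in> ce_set Q e"
    unfolding ce_set_def using derivable_sound true_index_fact true_eval_fact by blast
qed

text \<open>Derivability expressed by numbers only: a code \<open>d\<close>, a length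
  \<open>n\<close>, a position \<open>i\<close> and bounded quantifiers. This is the form to which
  the closure properties of a projective class apply.\<close>

lemma derivable_iff_cnth:
  "derivable Q c \<longleftrightarrow>
    (\<exists>d n i. i < n \<and> (\<forall>j<n. justified Q (cnth d ` {..<j}) (cnth d j)) \<and> cnth d i = c)"
proof
  assume "derivable Q c"
  then obtain l i where l: "valid_derivation Q l" "i < length l" "l ! i = c"
    unfolding derivable_def in_set_conv_nth by blast
  obtain d where d: "\<forall>i<length l. cnth d i = l ! i" using ex_cnth by blast
  have "set (take j l) = cnth d ` {..<j}" if "j < length l" for j
    using that d by (force simp: set_conv_nth image_iff)
  then show "\<exists>d n i. i < n \<and> (\<forall>j<n. justified Q (cnth d ` {..<j}) (cnth d j)) \<and> cnth d i = c"
    using l d unfolding valid_derivation_def by metis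
next
  assume "\<exists>d n i. i < n \<and> (\<forall>j<n. justified Q (cnth d ` {..<j}) (cnth d j)) \<and> cnth d i = c"
  then obtain d n i where d: "i < n" "\<forall>j<n. justified Q (cnth d ` {..<j}) (cnth d j)" "cnth d i = c"
    by blast
  have "valid_derivation Q (map (cnth d) [0..<n])"
    unfolding valid_derivation_def using d(2) by (simp add: take_map atLeast_upt[symmetric] lessThan_atLeast0)
  then show "derivable Q c" unfolding derivable_def using d(1,3) by force
qed

context projective_class
begin

lemma derivable:
  assumes "D (\<lambda>x. x \<in> Q)" "D (\<lambda>x. x \<notin> Q)" "computable f"
  shows "D (\<lambda>x. derivable Q (f x))"
proof -
  note intros = computable_intros computable_cnth
  have "D (\<lambda>z. justified Q (cnth (pfst z) ` {..<psnd z}) (cnth (pfst z) (psnd z)))"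
    \<comment> \<open>The rules become a disjunction of existential statements whose atoms are
      decidable, apart from the two oracle clauses.\<close>
    unfolding justified.simps image_iff Bex_def lessThan_iff
    by (intro disj; (intro ex conj all_less)?)
      ((((rule subst[OF assms(1)] subst[OF assms(2)] decidable)?; intro intros))+)
  then have J: "D (\<lambda>z. justified Q (cnth (pfst z) ` {..<psnd z}) (cnth (pfst z) (psnd z)))" .
  show ?thesis
    unfolding derivable_iff_cnth
    by (intro ex conj all_less
        subst2[of "\<lambda>d j. justified Q (cnth d ` {..<j}) (cnth d j)", OF J]; (rule decidable)?;
        intro intros computable_compose[OF assms(3)])
qed

theorem in_ce_set:
  assumes "D (\<lambda>x. x \<in> Q)" "D (\<lambda>x. x \<notin> Q)" "computable f" "computable g"
  shows "D (\<lambda>x. f x \<in> ce_set Q (g x))"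
  unfolding in_ce_set_iff_derivable
proof (intro conj ex)
  show "D (\<lambda>x. derivable Q (index_fact (g x)))"
    by (rule derivable[OF assms(1,2)]) (intro computable_intros assms(4))
  show "D (\<lambda>z. derivable Q (eval_fact (g (pfst z)) (f (pfst z)) (psnd z)))"
    by (rule derivable[OF assms(1,2)])
      (intro computable_intros computable_compose[OF assms(3)] computable_compose[OF assms(4)])
qed

end

section \<open>Programs for c.e. predicates, parametrization and Post's theorem\<close>

lemma re_in_of_decidable_in: "decidable_in Q P \<Longrightarrow> re_in Q P"
  unfolding re_in_def
  by (rule exI[of _ "\<lambda>x _. P x"]) (simp add: decidable_subst[of Q P pfst] computable_pfst computable_id)

lemma re_in_ce_set:
  "computable f \<Longrightarrow> computable g \<Longrightarrow> re_in Q (\<lambda>x. f x \<in> ce_set Q (g x))"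
  by (intro re.in_ce_set re_in_of_decidable_in decidable_not decidable_oracle computable_id)

text \<open>The decidable matrix is total, so the search by \<open>Minimize\<close> halts exactly
  when a witness exists.\<close>

lemma re_in_imp_program:
  assumes "re_in Q P"
  shows "\<exists>p. \<forall>x. P x \<longleftrightarrow> eval Q p x \<noteq> None"
proof -
  obtain R where R: "decidable_in Q (\<lambda>z. R (pfst z) (psnd z))" "\<And>x. P x \<longleftrightarrow> (\<exists>n. R x n)"
    using assms unfolding re_in_def by blast
  from decidable_not[OF R(1)] obtain p
    where p: "\<And>z. eval Q p z = Some (of_bool (\<not> R (pfst z) (psnd z)))"
    unfolding decidable_in_def computable_in_def by blast
  show ?thesis by (intro exI[of _ "Minimize p"]) (simp add: p R(2))
qed

primrec const_prog :: "nat \<Rightarrow> prog" where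
  "const_prog 0 = Zero"
| "const_prog (Suc n) = Compose Succ (const_prog n)"

lemma eval_const_prog: "eval Q (const_prog n) x = Some n"
  by (induction n) auto

text \<open>The s-m-n theorem: \<open>k\<close> is hard-wired by a constant program, and the index
  of the resulting program is obtained from \<open>k\<close> by primitive recursion.\<close>

lemma parametrization:
  assumes "re_in Q (\<lambda>z. P (pfst z) (psnd z))"
  shows "\<exists>s. computable s \<and> (\<forall>k. ce_set Q (s k) = {x. P k x})"
proof -
  obtain p where p: "\<And>z. P (pfst z) (psnd z) \<longleftrightarrow> eval Q p z \<noteq> None"
    using re_in_imp_program[OF assms] by blast
  define q where "q k = Compose p (Pairing (const_prog k) (Pairing First Second))" for k
  have "prog_index (const_prog k)
      = rec_nat (prog_index Zero) (\<lambda>_ r. pair 6 (pair (prog_index Succ) r)) k" for k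
    by (induction k) auto
  then have "computable (\<lambda>k. prog_index (q k))"
    unfolding q_def prog_index.simps by (simp only:) (intro computable_intros)
  moreover have "ce_set Q (prog_index (q k)) = {x. P k x}" for k
  proof -
    have "ce_set Q (prog_index (q k)) = {x. eval Q (q k) x \<noteq> None}"
      unfolding ce_set_def using inj_prog_index by (auto simp: inj_eq)
    also have "\<dots> = {x. P k x}"
      using p[of "pair k _"] by (simp add: q_def eval_const_prog)
    finally show ?thesis .
  qed
  ultimately show ?thesis by blast
qed

text \<open>For fixed \<open>x\<close> the set \<open>{y. P x}\<close> is everything or nothing. By
  parametrization it has an index computable from \<open>x\<close>, and this index lies in the jump
  exactly when \<open>P x\<close> holds.\<close>

lemma decidable_in_jump:
  assumes "re_in Q P" shows "decidable_in (turing_jump Q) P"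
proof -
  have "re_in Q (\<lambda>z. P (pfst z))"
    by (intro re.subst[OF assms] computable_intros)
  from parametrization[OF this] obtain s where s: "computable s" "\<And>k. ce_set Q (s k) = {x. P k}"
    by blast
  have P: "P = (\<lambda>x. s x \<in> turing_jump Q)"
    unfolding turing_jump_def by (simp add: s(2))
  show ?thesis
    unfolding P by (rule decidable_oracle[OF computable_imp_computable_in[OF s(1)]])
qed

lemma sigma2_in_of_re_in:
  assumes "re_in Q P" shows "sigma2_in Q P"
proof -
  obtain R where R: "decidable_in Q (\<lambda>z. R (pfst z) (psnd z))" "\<And>x. P x \<longleftrightarrow> (\<exists>n. R x n)"
    using assms unfolding re_in_def by blast
  show ?thesis
    unfolding sigma2_in_def R(2)
    by (rule exI[of _ "\<lambda>x n. \<not> R x n"]) (simp add: re_in_of_decidable_in decidable_not R(1))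
qed

lemma sigma2_in_of_co_re_in:
  assumes "re_in Q P" shows "sigma2_in Q (\<lambda>x. \<not> P x)"
  unfolding sigma2_in_def
  by (rule exI[of _ "\<lambda>x _. P x"])
    (simp add: re.subst[OF assms, of pfst] computable_pfst computable_id)

text \<open>The jump is c.e. in \<open>Q\<close>, so both it and its complement satisfy
  \<open>sigma2_in Q\<close>; evaluating programs with the jump as oracle then stays inside this
  projective class.\<close>

theorem sigma2_in_of_re_in_jump:
  assumes "re_in (turing_jump Q) P" shows "sigma2_in Q P"
proof -
  obtain p where p: "\<And>x. P x \<longleftrightarrow> eval (turing_jump Q) p x \<noteq> None"
    using re_in_imp_program[OF assms] by blast
  have P: "P = (\<lambda>x. x \<in> ce_set (turing_jump Q) (prog_index p))"
    unfolding ce_set_def using inj_prog_index by (auto simp: inj_eq p)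
  have J: "re_in Q (\<lambda>x. x \<in> turing_jump Q)"
    unfolding turing_jump_def mem_Collect_eq by (intro re_in_ce_set computable_intros)
  show ?thesis
    unfolding P
    by (rule sigma2.in_ce_set)
      (rule sigma2_in_of_re_in[OF J] sigma2_in_of_co_re_in[OF J] computable_id computable_const)+
qed

lemma re_in_subst:
  assumes "re_in Q P" "computable_in Q f" shows "re_in Q (\<lambda>x. P (f x))"
proof -
  obtain R where R: "decidable_in Q (\<lambda>z. R (pfst z) (psnd z))" "\<And>x. P x \<longleftrightarrow> (\<exists>n. R x n)"
    using assms unfolding re_in_def by blast
  show ?thesis
    unfolding re_in_def R(2)
    by (rule exI[of _ "\<lambda>x n. R (f x) n"])
      (auto intro!: decidable_subst2[OF R(1)] computable_intros computable_compose[OF assms(2)])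
qed

lemma re_in_subst3:
  assumes "re_in Q (\<lambda>z. P (pfst z) (pfst (psnd z)) (psnd (psnd z)))"
    "computable_in Q f" "computable_in Q g" "computable_in Q h"
  shows "re_in Q (\<lambda>x. P (f x) (g x) (h x))"
  using re_in_subst[OF assms(1) computable_pair[OF assms(2) computable_pair[OF assms(3,4)]]] by simp

text \<open>Value and witness are sought together in one packed number, so an always successful
  search over a decidable relation suffices although \<open>P\<close> is only c.e.\<close>

lemma computable_selection:
  assumes "re_in Q (\<lambda>z. P (pfst z) (psnd z))" "\<And>x. \<exists>n. P x n"
  shows "\<exists>f. computable_in Q f \<and> (\<forall>x. P x (f x))"
proof -
  obtain R where R: "decidable_in Q (\<lambda>z. R (pfst z) (psnd z))"
    "\<And>z. P (pfst z) (psnd z) \<longleftrightarrow> (\<exists>n. R z n)"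
    using assms(1) unfolding re_in_def by blast
  have P: "P x n \<longleftrightarrow> (\<exists>w. R (pair x n) w)" for x n using R(2)[of "pair x n"] by simp
  define w where "w x = (LEAST w. R (pair x (pfst w)) (psnd w))" for x
  have ex: "\<exists>w. R (pair x (pfst w)) (psnd w)" for x
    using assms(2)[of x] unfolding P by (metis prod_encode_inverse fst_conv snd_conv)
  have "computable_in Q w"
    unfolding w_def
    by (rule computable_Least) (intro decidable_subst2[OF R(1)] computable_intros, rule ex)
  then have "computable_in Q (\<lambda>x. pfst (w x))" by (rule computable_pfst)
  moreover have "P x (pfst (w x))" for x
    unfolding P w_def using LeastI_ex[OF ex[of x]] by blast
  ultimately show ?thesis by blast
qed


section \<open>Effective operations on the hierarchy\<close>

lemma zero_jump_0 [simp]: "zero_jump 0 = {}"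
  and zero_jump_Suc [simp]: "zero_jump (Suc n) = turing_jump (zero_jump n)"
  by (simp_all add: zero_jump_def)

text \<open>Binary digits, lowest first. A string is named by a number and a length, so quantifiers
  over strings become quantifiers over numbers, and truncating a string changes only the
  length.\<close>

definition bits :: "nat \<Rightarrow> nat \<Rightarrow> bool list" where
  "bits v l = map (\<lambda>i. odd (v div 2 ^ i)) [0..<l]"

lemma length_bits [simp]: "length (bits v l) = l"
  by (simp add: bits_def)

lemma nth_bits [simp]: "i < l \<Longrightarrow> bits v l ! i = odd (v div 2 ^ i)"
  by (simp add: bits_def)

lemma ex_bits: "\<exists>v<2 ^ length \<sigma>. bits v (length \<sigma>) = \<sigma>"
proof (induction \<sigma>)
  case (Cons b \<sigma>)
  then obtain v where v: "v < 2 ^ length \<sigma>" "bits v (length \<sigma>) = \<sigma>" by blast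
  define w where "w = of_bool b + 2 * v"
  have "odd (w div 2 ^ i) = (b # \<sigma>) ! i" if "i < Suc (length \<sigma>)" for i
  proof (cases i)
    case (Suc j)
    have "w div 2 ^ i = v div 2 ^ j" unfolding Suc w_def by (simp add: div_mult2_eq)
    moreover have "\<sigma> ! j = odd (v div 2 ^ j)"
      using nth_bits[of j "length \<sigma>" v] v(2) that Suc by simp
    ultimately show ?thesis using Suc by simp
  qed (simp add: w_def)
  then have "bits w (length (b # \<sigma>)) = b # \<sigma>"
    by (intro nth_equalityI) auto
  moreover have "w < 2 ^ length (b # \<sigma>)" using v(1) unfolding w_def by (cases b) auto
  ultimately show ?case by blast
qed (simp add: bits_def)

lemma mem_cylinder_bits: "x \<in> cylinder (bits v l) \<longleftrightarrow> (\<forall>i<l. x i = odd (v div 2 ^ i))"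
  by (simp add: cylinder_def)

lemma ex_mem_cylinder_bits: "\<exists>v<2 ^ l. x \<in> cylinder (bits v l)"
proof -
  obtain v where "v < 2 ^ l" "bits v l = map x [0..<l]"
    using ex_bits[of "map x [0..<l]"] by auto
  moreover from this(2) have "x \<in> cylinder (bits v l)" by (simp only:) (simp add: cylinder_def)
  ultimately show ?thesis by blast
qed

lemma bits_eq_of_mem:
  assumes "x \<in> cylinder (bits v l)" "k \<le> l" shows "bits v k = map x [0..<k]"
  using assms by (intro nth_equalityI) (auto simp: mem_cylinder_bits)

text \<open>\<open>list_encode\<close> grows at the head, so the recursion attaches the bits from
  the last one to the first.\<close>

lemma string_index_bits:
  "string_index (bits v l) = rec_nat 0 (\<lambda>j r. Suc (pair (v div 2 ^ (l - Suc j) mod 2) r)) l"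
proof -
  have "rec_nat 0 (\<lambda>j r. Suc (pair (v div 2 ^ (l - Suc j) mod 2) r)) j
      = list_encode (map (\<lambda>i. of_bool (odd (v div 2 ^ i))) [l - j..<l])" if "j \<le> l" for j
    using that
  proof (induction j)
    case (Suc j)
    then have "[l - Suc j..<l] = (l - Suc j) # [l - j..<l]"
      by (simp add: upt_conv_Cons Suc_diff_Suc)
    then show ?case using Suc by (simp add: mod_2_eq_odd)
  qed simp
  from this[of l] show ?thesis by (simp add: string_index_def bits_def o_def)
qed

lemma computable_string_index_bits:
  assumes "computable_in Q f" "computable_in Q g"
  shows "computable_in Q (\<lambda>x. string_index (bits (f x) (g x)))"
  unfolding string_index_bits
  by (intro computable_intros computable_compose[OF assms(1)] computable_compose[OF assms(2)] assms(2))

lemma string_index_eq_iff: "string_index \<sigma> = string_index \<tau> \<longleftrightarrow> \<sigma> = \<tau>"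
proof
  assume "string_index \<sigma> = string_index \<tau>"
  then have "map of_bool \<sigma> = (map of_bool \<tau> :: nat list)"
    by (metis string_index_def list_encode_inverse)
  then show "\<sigma> = \<tau>" by (rule map_injective) (simp add: inj_def)
qed simp

lemma mem_sigma_set_1:
  "x \<in> sigma_set (Suc 0) i \<longleftrightarrow> (\<exists>l. string_index (map x [0..<l]) \<in> ce_set {} i)"
proof
  assume "x \<in> sigma_set (Suc 0) i"
  then obtain \<sigma> where \<sigma>: "string_index \<sigma> \<in> ce_set {} i" "x \<in> cylinder \<sigma>" by auto
  then have "\<sigma> = map x [0..<length \<sigma>]" by (intro nth_equalityI) (auto simp: cylinder_def)
  then show "\<exists>l. string_index (map x [0..<l]) \<in> ce_set {} i" using \<sigma>(1) by metis
next
  assume "\<exists>l. string_index (map x [0..<l]) \<in> ce_set {} i"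
  then show "x \<in> sigma_set (Suc 0) i" by (auto simp: cylinder_def)
qed

lemma mem_sigma_set_1_bits:
  "x \<in> sigma_set (Suc 0) i \<longleftrightarrow>
    (\<exists>v l. x \<in> cylinder (bits v l) \<and> string_index (bits v l) \<in> ce_set {} i)"
  unfolding mem_sigma_set_1 using bits_eq_of_mem ex_mem_cylinder_bits by (metis order_refl)

lemma mem_sigma_set_Suc: "x \<in> sigma_set (Suc (Suc n)) i \<longleftrightarrow> (\<exists>j\<in>ce_set {} i. x \<notin> sigma_set (Suc n) j)"
  by auto

declare sigma_set.simps(2,3) [simp del]

lemma re_in_mono: "re_in {} P \<Longrightarrow> re_in Q P"
  unfolding re_in_def by (meson decidable_imp_decidable_in)

lemma ex_ce_index:
  assumes "re_in Q P" shows "\<exists>e. ce_set Q e = {x. P x}"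
  using parametrization[of Q "\<lambda>_. P"] re.subst[OF assms computable_psnd[OF computable_id]] by auto

section \<open>Closure properties of uniform families of sets\<close>

lemma uniformly_SigmaI:
  "computable f \<Longrightarrow> (\<And>k. U k = sigma_set n (f k)) \<Longrightarrow> uniformly_Sigma n U"
  unfolding uniformly_Sigma_def by blast

lemma uniformly_Sigma_sigma_set: "computable f \<Longrightarrow> uniformly_Sigma n (\<lambda>k. sigma_set n (f k))"
  unfolding uniformly_Sigma_def by blast

lemma uniformly_Sigma_subst:
  "uniformly_Sigma n U \<Longrightarrow> computable f \<Longrightarrow> uniformly_Sigma n (\<lambda>k. U (f k))"
  unfolding uniformly_Sigma_def using computable_compose by blast

lemma uniformly_Sigma_if:
  assumes "decidable_in {} P" "uniformly_Sigma n U" "uniformly_Sigma n V"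
  shows "uniformly_Sigma n (\<lambda>k. if P k then U k else V k)"
proof -
  obtain f g where "computable f" "\<And>k. U k = sigma_set n (f k)"
    "computable g" "\<And>k. V k = sigma_set n (g k)"
    using assms(2,3) unfolding uniformly_Sigma_def by blast
  then show ?thesis
    by (intro uniformly_SigmaI[of "\<lambda>k. if P k then f k else g k"] computable_if assms(1)) auto
qed

text \<open>Parametrization supplies the index function, so a closure proof at the first level only
  has to exhibit a c.e. condition on strings.\<close>

lemma uniformly_Sigma_1I:
  assumes "re_in {} (\<lambda>z. P (pfst z) (psnd z))"
    and "\<And>k x. x \<in> U k \<longleftrightarrow> (\<exists>v l. x \<in> cylinder (bits v l) \<and> P k (string_index (bits v l)))"
  shows "uniformly_Sigma (Suc 0) U"
proof -
  obtain s where s: "computable s" "\<And>k. ce_set {} (s k) = {x. P k x}"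
    using parametrization[OF assms(1)] by blast
  show ?thesis
    using s by (intro uniformly_SigmaI[of s]) (auto simp: mem_sigma_set_1_bits assms(2))
qed

lemma uniformly_Sigma_SucI:
  assumes "re_in {} (\<lambda>z. P (pfst z) (psnd z))"
    and "\<And>k x. x \<in> U k \<longleftrightarrow> (\<exists>j. P k j \<and> x \<notin> sigma_set (Suc n) j)"
  shows "uniformly_Sigma (Suc (Suc n)) U"
proof -
  obtain s where s: "computable s" "\<And>k. ce_set {} (s k) = {x. P k x}"
    using parametrization[OF assms(1)] by blast
  show ?thesis
    using s by (intro uniformly_SigmaI[of s]) (auto simp: mem_sigma_set_Suc assms(2))
qed

lemma uniformly_Sigma_Compl:
  assumes "uniformly_Sigma (Suc n) U"
  shows "uniformly_Sigma (Suc (Suc n)) (\<lambda>k. - U k)"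
proof -
  obtain f where f: "computable f" "\<And>k. U k = sigma_set (Suc n) (f k)"
    using assms unfolding uniformly_Sigma_def by blast
  show ?thesis
  proof (rule uniformly_Sigma_SucI[of "\<lambda>k j. j = f k"])
    show "re_in {} (\<lambda>z. psnd z = f (pfst z))"
      by (intro re.decidable computable_intros computable_compose[OF f(1)])
  qed (simp add: f(2))
qed

text \<open>The empty set and the whole space are indexed together, since complementation exchanges
  them from one level to the next.\<close>

lemma ex_index_UNIV: "\<exists>e. sigma_set (Suc n) e = UNIV"
proof -
  have "\<exists>e e'. sigma_set (Suc n) e = {} \<and> sigma_set (Suc n) e' = UNIV"
  proof (induction n)
    case 0
    obtain e e' where "ce_set {} e = {x. False}" "ce_set {} e' = {x. True}"
      using ex_ce_index[OF re.decidable[OF decidable_const]] by metis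
    then have "sigma_set (Suc 0) e = {}" "sigma_set (Suc 0) e' = UNIV"
      by (auto simp: mem_sigma_set_1)
    then show ?case by blast
  next
    case (Suc n)
    then obtain e e' where e: "sigma_set (Suc n) e = {}" "sigma_set (Suc n) e' = UNIV" by blast
    obtain d where "ce_set {} d = {x. x = e'}"
      using ex_ce_index[OF re.decidable[OF decidable_eq[OF computable_id computable_const]]] by metis
    moreover obtain d' where "ce_set {} d' = {x. x = e}"
      using ex_ce_index[OF re.decidable[OF decidable_eq[OF computable_id computable_const]]] by metis
    ultimately have "sigma_set (Suc (Suc n)) d = {}" "sigma_set (Suc (Suc n)) d' = UNIV"
      using e by (auto simp: mem_sigma_set_Suc)
    then show ?case by blast
  qed
  then show ?thesis by blast
qed

lemma uniformly_Sigma_UNIV: "uniformly_Sigma (Suc n) (\<lambda>k. UNIV)"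
  using ex_index_UNIV[of n] uniformly_SigmaI[OF computable_const] by metis

text \<open>
  A condition that is c.e. in \<open>zero_jump (Suc n)\<close> has the form \<open>\<exists>s. \<not> R' s\<close> with \<open>R'\<close> c.e. in
  \<open>zero_jump n\<close>, so each complement in the union is intersected with \<open>\<not> R' s\<close> by adding the
  whole space to the complemented set when \<open>R' s\<close> holds.
\<close>

theorem uniformly_Sigma_UN:
  assumes "uniformly_Sigma (Suc n) U" "re_in (zero_jump n) (\<lambda>z. R (pfst z) (psnd z))"
  shows "uniformly_Sigma (Suc n) (\<lambda>k. \<Union>i\<in>{i. R k i}. U (pair k i))"
  using assms
proof (induction n arbitrary: U R)
  case 0
  then obtain f where f: "computable f" "\<And>k. U k = sigma_set (Suc 0) (f k)"
    unfolding uniformly_Sigma_def by blast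
  show ?case
  proof (rule uniformly_Sigma_1I[of "\<lambda>k s. \<exists>i. R k i \<and> s \<in> ce_set {} (f (pair k i))"])
    have R: "re_in {} (\<lambda>z. R (pfst z) (psnd z))" using 0(2) by simp
    show "re_in {} (\<lambda>z. \<exists>i. R (pfst z) i \<and> psnd z \<in> ce_set {} (f (pair (pfst z) i)))"
      by (intro re.ex re.conj re_in_ce_set re.subst2[OF R] computable_intros
          computable_compose[OF f(1)])
  qed (auto simp: f(2) mem_sigma_set_1_bits)
next
  case (Suc n)
  then obtain f where f: "computable f" "\<And>k. U k = sigma_set (Suc (Suc n)) (f k)"
    unfolding uniformly_Sigma_def by blast
  have "sigma2_in (zero_jump n) (\<lambda>z. R (pfst z) (psnd z))"
    using Suc.prems(2) by (intro sigma2_in_of_re_in_jump) simp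
  then obtain R' where R': "re_in (zero_jump n) (\<lambda>z. R' (pfst z) (psnd z))"
    "\<And>z. R (pfst z) (psnd z) \<longleftrightarrow> (\<exists>s. \<not> R' z s)"
    unfolding sigma2_in_def by blast
  have R: "R k i \<longleftrightarrow> (\<exists>s. \<not> R' (pair k i) s)" for k i using R'(2)[of "pair k i"] by simp
  \<comment> \<open>Index 0 always contributes the set with index \<open>j\<close>; the positive
    indices contribute the whole space and belong to the union exactly when \<open>R'\<close> holds
    of the pair and the witness stored in the first component.\<close>
  define V where "V z = (if psnd z = 0 then sigma_set (Suc n) (psnd (pfst z)) else UNIV)" for z
  define P where "P w i \<longleftrightarrow> i = 0 \<or> R' (pfst (pfst w)) (psnd (pfst w))" for w i :: nat
  have "uniformly_Sigma (Suc n) V"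
    unfolding V_def
    by (intro uniformly_Sigma_if uniformly_Sigma_sigma_set uniformly_Sigma_UNIV computable_intros)
  moreover have "re_in (zero_jump n) (\<lambda>z. P (pfst z) (psnd z))"
    unfolding P_def
    by (intro re.disj re.subst2[OF R'(1)] computable_intros)
      (intro re.decidable computable_intros)
  ultimately have "uniformly_Sigma (Suc n) (\<lambda>w. \<Union>i\<in>{i. P w i}. V (pair w i))"
    by (rule Suc.IH)
  then obtain g where g: "computable g"
    "\<And>w. (\<Union>i\<in>{i. P w i}. V (pair w i)) = sigma_set (Suc n) (g w)"
    unfolding uniformly_Sigma_def by blast
  have mem_g: "x \<notin> sigma_set (Suc n) (g (pair (pair w s) j)) \<longleftrightarrow>
      x \<notin> sigma_set (Suc n) j \<and> \<not> R' w s" for x w s j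
  proof -
    let ?W = "pair (pair w s) j"
    have V: "V (pair ?W 0) = sigma_set (Suc n) j" "V (pair ?W (Suc i)) = UNIV" for i
      by (simp_all add: V_def)
    have P: "P ?W 0" "P ?W (Suc i) \<longleftrightarrow> R' w s" for i
      by (simp_all add: P_def)
    have "x \<in> sigma_set (Suc n) (g ?W) \<longleftrightarrow> (\<exists>i. P ?W i \<and> x \<in> V (pair ?W i))"
      unfolding g(2)[of ?W, symmetric] by blast
    also have "\<dots> \<longleftrightarrow> x \<in> sigma_set (Suc n) j \<or> R' w s"
      using V P by (metis UNIV_I not0_implies_Suc)
    finally show ?thesis by blast
  qed
  show ?case
  proof (rule uniformly_Sigma_SucI[of "\<lambda>k m. \<exists>i s j. j \<in> ce_set {} (f (pair k i)) \<and>
        m = g (pair (pair (pair k i) s) j)"])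
    show "re_in {} (\<lambda>z. \<exists>i s j. j \<in> ce_set {} (f (pair (pfst z) i)) \<and>
        psnd z = g (pair (pair (pair (pfst z) i) s) j))"
      by (intro re.ex re.conj re_in_ce_set computable_intros computable_compose[OF f(1)]
          re.decidable computable_compose[OF g(1)])
    show "x \<in> (\<Union>i\<in>{i. R k i}. U (pair k i)) \<longleftrightarrow>
       (\<exists>m. (\<exists>i s j. j \<in> ce_set {} (f (pair k i)) \<and> m = g (pair (pair (pair k i) s) j)) \<and>
         x \<notin> sigma_set (Suc n) m)" for k x
      unfolding f(2) R by (auto simp: mem_sigma_set_Suc) (use mem_g in blast)+
  qed
qed

lemma uniformly_Sigma_Un:
  assumes "uniformly_Sigma (Suc n) U" "uniformly_Sigma (Suc n) V"
  shows "uniformly_Sigma (Suc n) (\<lambda>k. U k \<union> V k)"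
proof -
  have "uniformly_Sigma (Suc n) (\<lambda>k. \<Union>i\<in>{i. i < 2}.
      if psnd (pair k i) = 0 then U (pfst (pair k i)) else V (pfst (pair k i)))"
    by (rule uniformly_Sigma_UN)
      (intro uniformly_Sigma_if uniformly_Sigma_subst[OF assms(1)] uniformly_Sigma_subst[OF assms(2)]
        re.decidable computable_intros)+
  moreover have "{i. i < 2} = {0, Suc 0}" by auto
  ultimately show ?thesis by (simp add: Un_commute)
qed

lemma uniformly_Sigma_Int:
  assumes "uniformly_Sigma (Suc n) U" "uniformly_Sigma (Suc n) V"
  shows "uniformly_Sigma (Suc n) (\<lambda>k. U k \<inter> V k)"
proof (cases n)
  case 0
  obtain f g where fg: "computable f" "\<And>k. U k = sigma_set (Suc 0) (f k)"
    "computable g" "\<And>k. V k = sigma_set (Suc 0) (g k)"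
    using assms 0 unfolding uniformly_Sigma_def by auto
  show ?thesis
    unfolding 0
  proof (rule uniformly_Sigma_1I[of "\<lambda>k s. \<exists>v l i j. s = string_index (bits v l) \<and> i \<le> l \<and> j \<le> l \<and>
      string_index (bits v i) \<in> ce_set {} (f k) \<and> string_index (bits v j) \<in> ce_set {} (g k)"])
    show "re_in {} (\<lambda>z. \<exists>v l i j. psnd z = string_index (bits v l) \<and> i \<le> l \<and> j \<le> l \<and>
        string_index (bits v i) \<in> ce_set {} (f (pfst z)) \<and>
        string_index (bits v j) \<in> ce_set {} (g (pfst z)))"
      by (intro re.ex re.conj re_in_ce_set; (rule re.decidable)?;
          intro computable_intros computable_string_index_bits
            computable_compose[OF fg(1)] computable_compose[OF fg(3)])
    fix k x
    show "x \<in> U k \<inter> V k \<longleftrightarrow> (\<exists>w m. x \<in> cylinder (bits w m) \<and>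
        (\<exists>v l i j. string_index (bits w m) = string_index (bits v l) \<and> i \<le> l \<and> j \<le> l \<and>
      string_index (bits v i) \<in> ce_set {} (f k) \<and> string_index (bits v j) \<in> ce_set {} (g k)))"
      (is "_ \<longleftrightarrow> ?R")
    proof
      assume "x \<in> U k \<inter> V k"
      then obtain i j where ij: "string_index (map x [0..<i]) \<in> ce_set {} (f k)"
        "string_index (map x [0..<j]) \<in> ce_set {} (g k)"
        unfolding fg(2,4) by (auto simp: mem_sigma_set_1)
      obtain v where v: "x \<in> cylinder (bits v (max i j))" using ex_mem_cylinder_bits by blast
      then have "bits v i = map x [0..<i]" "bits v j = map x [0..<j]"
        by (auto intro: bits_eq_of_mem)
      then show ?R using ij v by (metis max.cobounded1 max.cobounded2)
    next
      assume ?R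
      then obtain v l i j where *: "x \<in> cylinder (bits v l)" "i \<le> l" "j \<le> l"
        "string_index (bits v i) \<in> ce_set {} (f k)" "string_index (bits v j) \<in> ce_set {} (g k)"
        unfolding string_index_eq_iff by metis
      have "bits v i = map x [0..<i]" "bits v j = map x [0..<j]"
        using * by (auto intro: bits_eq_of_mem)
      then show "x \<in> U k \<inter> V k" using * unfolding fg(2,4) by (auto simp: mem_sigma_set_1)
    qed
  qed
next
  case (Suc m)
  obtain f g where fg: "computable f" "\<And>k. U k = sigma_set (Suc (Suc m)) (f k)"
    "computable g" "\<And>k. V k = sigma_set (Suc (Suc m)) (g k)"
    using assms Suc unfolding uniformly_Sigma_def by auto
  have "uniformly_Sigma (Suc m) (\<lambda>z. sigma_set (Suc m) (pfst z) \<union> sigma_set (Suc m) (psnd z))"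
    by (intro uniformly_Sigma_Un uniformly_Sigma_sigma_set computable_intros)
  then obtain h where h: "computable h"
    "\<And>z. sigma_set (Suc m) (pfst z) \<union> sigma_set (Suc m) (psnd z) = sigma_set (Suc m) (h z)"
    unfolding uniformly_Sigma_def by blast
  have mem_h: "x \<notin> sigma_set (Suc m) (h (pair i j)) \<longleftrightarrow>
      x \<notin> sigma_set (Suc m) i \<and> x \<notin> sigma_set (Suc m) j" for x i j
    using h(2)[of "pair i j"] by auto
  show ?thesis
    unfolding Suc
  proof (rule uniformly_Sigma_SucI[of "\<lambda>k w. \<exists>i j. i \<in> ce_set {} (f k) \<and> j \<in> ce_set {} (g k) \<and>
      w = h (pair i j)"])
    show "re_in {} (\<lambda>z. \<exists>i j. i \<in> ce_set {} (f (pfst z)) \<and> j \<in> ce_set {} (g (pfst z)) \<and>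
        psnd z = h (pair i j))"
      by (intro re.ex re.conj re_in_ce_set re.decidable computable_intros
          computable_compose[OF fg(1)] computable_compose[OF fg(3)] computable_compose[OF h(1)])
    show "x \<in> U k \<inter> V k \<longleftrightarrow> (\<exists>w. (\<exists>i j. i \<in> ce_set {} (f k) \<and> j \<in> ce_set {} (g k) \<and>
      w = h (pair i j)) \<and> x \<notin> sigma_set (Suc m) w)" for x k
      unfolding fg(2,4) using mem_h by (auto simp: mem_sigma_set_Suc) 
  qed
qed

text \<open>The index function for binary intersections is iterated, starting from an index of the
  whole space for the empty intersection.\<close>

lemma uniformly_Sigma_INT_less:
  assumes "uniformly_Sigma (Suc n) U"
  shows "uniformly_Sigma (Suc n) (\<lambda>z. \<Inter>i<psnd z. U (pair (pfst z) i))"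
proof -
  obtain f where f: "computable f" "\<And>k. U k = sigma_set (Suc n) (f k)"
    using assms unfolding uniformly_Sigma_def by blast
  have "uniformly_Sigma (Suc n) (\<lambda>z. sigma_set (Suc n) (pfst z) \<inter> sigma_set (Suc n) (psnd z))"
    by (intro uniformly_Sigma_Int uniformly_Sigma_sigma_set computable_intros)
  then obtain h where h: "computable h"
    "\<And>z. sigma_set (Suc n) (pfst z) \<inter> sigma_set (Suc n) (psnd z) = sigma_set (Suc n) (h z)"
    unfolding uniformly_Sigma_def by blast
  obtain u where u: "sigma_set (Suc n) u = UNIV" using ex_index_UNIV by blast
  define g where "g k m = rec_nat u (\<lambda>i r. h (pair r (f (pair k i)))) m" for k m
  have "sigma_set (Suc n) (g k m) = (\<Inter>i<m. U (pair k i))" for k m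
  proof (induction m)
    case (Suc m)
    have "sigma_set (Suc n) (g k (Suc m)) = sigma_set (Suc n) (g k m) \<inter> U (pair k m)"
      using h(2)[of "pair (g k m) (f (pair k m))"] by (simp add: g_def f(2))
    then show ?case using Suc by (auto simp: less_Suc_eq)
  qed (simp add: g_def u)
  moreover have "computable (\<lambda>z. g (pfst z) (psnd z))"
    unfolding g_def
    by (intro computable_intros computable_compose[OF h(1)] computable_compose[OF f(1)])
  ultimately show ?thesis by (intro uniformly_SigmaI[of "\<lambda>z. g (pfst z) (psnd z)"]) auto
qed

text \<open>Both families are carried through the induction because complementation raises the level
  and exchanges them. At the first level the complement of a cylinder is the union of the other
  cylinders of the same length.\<close>

lemma uniformly_Sigma_cylinder_and_Compl:
  "uniformly_Sigma (Suc n) (\<lambda>z. cylinder (bits (pfst z) (psnd z))) \<and>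
    uniformly_Sigma (Suc n) (\<lambda>z. - cylinder (bits (pfst z) (psnd z)))"
proof (induction n)
  case 0
  have "uniformly_Sigma (Suc 0) (\<lambda>z. cylinder (bits (pfst z) (psnd z)))"
  proof (rule uniformly_Sigma_1I[of "\<lambda>z s. s = string_index (bits (pfst z) (psnd z))"])
    show "re_in {} (\<lambda>z. psnd z = string_index (bits (pfst (pfst z)) (psnd (pfst z))))"
      by (intro re.decidable computable_intros computable_string_index_bits)
  qed (auto simp: string_index_eq_iff)
  moreover have "uniformly_Sigma (Suc 0) (\<lambda>z. - cylinder (bits (pfst z) (psnd z)))"
  proof (rule uniformly_Sigma_1I[of "\<lambda>z s. \<exists>v. s = string_index (bits v (psnd z)) \<and>
        s \<noteq> string_index (bits (pfst z) (psnd z))"])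
    show "re_in {} (\<lambda>z. \<exists>v. psnd z = string_index (bits v (psnd (pfst z))) \<and>
        psnd z \<noteq> string_index (bits (pfst (pfst z)) (psnd (pfst z))))"
      by (intro re.ex re.decidable computable_intros computable_string_index_bits)
    fix z x
    show "x \<in> - cylinder (bits (pfst z) (psnd z)) \<longleftrightarrow> (\<exists>v l. x \<in> cylinder (bits v l) \<and>
      (\<exists>w. string_index (bits v l) = string_index (bits w (psnd z)) \<and>
        string_index (bits v l) \<noteq> string_index (bits (pfst z) (psnd z))))"
      (is "_ \<longleftrightarrow> ?R")
    proof
      assume x: "x \<in> - cylinder (bits (pfst z) (psnd z))"
      obtain v where "x \<in> cylinder (bits v (psnd z))" using ex_mem_cylinder_bits by blast
      then show ?R using x unfolding string_index_eq_iff by (metis ComplD)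
    next
      assume ?R
      then obtain v where "x \<in> cylinder (bits v (psnd z))" "bits v (psnd z) \<noteq> bits (pfst z) (psnd z)"
        unfolding string_index_eq_iff by metis
      then show "x \<in> - cylinder (bits (pfst z) (psnd z))"
        using bits_eq_of_mem by (metis ComplI order_refl)
    qed
  qed
  ultimately show ?case ..
next
  case (Suc n)
  then show ?case using uniformly_Sigma_Compl[of n] by fastforce
qed

lemmas uniformly_Sigma_Compl_cylinder = uniformly_Sigma_cylinder_and_Compl[THEN conjunct2]

section \<open>Preimages under computable partial maps\<close>

lemma preimage_Compl: "preimage T (- B) = dom T - preimage T B"
  by (auto simp: preimage_def)

lemma preimage_UN: "preimage T (\<Union>i\<in>I. B i) = (\<Union>i\<in>I. preimage T (B i))"
  by (auto simp: preimage_def)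

text \<open>A family version of \<open>computable_map\<close>: the converse direction pulls back
  along all maps that prepend a string, with indices computable from the string.\<close>

definition uniformly_computable_maps :: "(nat \<Rightarrow> cantor \<rightharpoonup> cantor) \<Rightarrow> bool" where
  "uniformly_computable_maps T \<longleftrightarrow>
     (\<exists>f. computable f \<and> (\<forall>z \<sigma>. preimage (T z) (cylinder \<sigma>)
        = dom (T z) \<inter> sigma_set 1 (f (pair z (string_index \<sigma>)))))"

text \<open>Taking preimages commutes with unions, and with complements relative to the domain. So
  the index can be transformed level by level as long as everything is read inside
  \<open>dom (T z)\<close>.\<close>

theorem preimage_sigma_set:
  assumes "uniformly_computable_maps T"
  shows "\<exists>t. computable t \<and>
    (\<forall>z i. preimage (T z) (sigma_set (Suc n) i) = dom (T z) \<inter> sigma_set (Suc n) (t (pair z i)))"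
proof (induction n)
  case 0
  obtain f where f: "computable f" "\<And>z \<sigma>. preimage (T z) (cylinder \<sigma>)
      = dom (T z) \<inter> sigma_set (Suc 0) (f (pair z (string_index \<sigma>)))"
    using assms unfolding uniformly_computable_maps_def by auto
  define P where "P z s \<longleftrightarrow> (\<exists>v l. string_index (bits v l) \<in> ce_set {} (psnd z) \<and>
      s \<in> ce_set {} (f (pair (pfst z) (string_index (bits v l)))))" for z s
  have "re_in {} (\<lambda>z. P (pfst z) (psnd z))"
    unfolding P_def
    by (intro re.ex re.conj re_in_ce_set computable_intros computable_string_index_bits
        computable_compose[OF f(1)])
  then obtain t where t: "computable t" "\<And>k. ce_set {} (t k) = {s. P k s}"
    using parametrization by blast
  have "preimage (T z) (sigma_set (Suc 0) i) = dom (T z) \<inter> sigma_set (Suc 0) (t (pair z i))" for z i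
  proof -
    have "sigma_set (Suc 0) i = (\<Union>w\<in>{w. string_index (bits (fst w) (snd w)) \<in> ce_set {} i}.
        cylinder (bits (fst w) (snd w)))"
      by (auto simp: mem_sigma_set_1_bits) blast+
    then have "preimage (T z) (sigma_set (Suc 0) i) = dom (T z) \<inter>
        (\<Union>w\<in>{w. string_index (bits (fst w) (snd w)) \<in> ce_set {} i}.
          sigma_set (Suc 0) (f (pair z (string_index (bits (fst w) (snd w))))))"
      by (simp only: preimage_UN f(2)) blast
    also have "\<dots> = dom (T z) \<inter> sigma_set (Suc 0) (t (pair z i))"
      by (auto simp: mem_sigma_set_1 t(2) P_def) blast+
    finally show ?thesis .
  qed
  then show ?case using t(1) by blast
next
  case (Suc n)
  then obtain t where t: "computable t" "\<And>z i. preimage (T z) (sigma_set (Suc n) i)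
      = dom (T z) \<inter> sigma_set (Suc n) (t (pair z i))"
    by blast
  define P where "P z m \<longleftrightarrow> (\<exists>j. j \<in> ce_set {} (psnd z) \<and> m = t (pair (pfst z) j))" for z m
  have "re_in {} (\<lambda>z. P (pfst z) (psnd z))"
    unfolding P_def
    by (intro re.ex re.conj re_in_ce_set re.decidable computable_intros computable_compose[OF t(1)])
  then obtain s where s: "computable s" "\<And>k. ce_set {} (s k) = {s. P k s}"
    using parametrization by blast
  have "preimage (T z) (sigma_set (Suc (Suc n)) i)
      = dom (T z) \<inter> sigma_set (Suc (Suc n)) (s (pair z i))" for z i
    unfolding sigma_set.simps(3) preimage_UN preimage_Compl[unfolded Compl_eq_Diff_UNIV] t(2) s(2) P_def
    by auto
  then show ?case using s(1) by blast
qed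


section \<open>Measures of effective sets\<close>

interpretation fair: prob_space fair_measure
  by (rule prob_space_fair_measure)

lemma space_fair_measure [simp]: "space fair_measure = UNIV"
  using sets_eq_imp_space_eq[OF sets_fair_measure] by simp

lemma open_cylinder: "open (cylinder \<sigma>)"
proof -
  have "cylinder \<sigma> = (\<Inter>i<length \<sigma>. (\<lambda>x. x i) -` {\<sigma> ! i})"
    by (auto simp: cylinder_def)
  moreover have "open ((\<lambda>x::cantor. x i) -` {b})" for i b
    by (rule open_vimage, rule discrete_topology_class.open_discrete, rule continuous_on_product_coordinates)
  ultimately show ?thesis by (simp only:) (rule open_INT, auto)
qed

lemma cylinder_borel: "cylinder \<sigma> \<in> sets borel"
  by (intro borel_open open_cylinder)

lemma sigma_set_borel: "sigma_set n i \<in> sets borel"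
proof (induction n i rule: sigma_set.induct)
  case (2 i)
  then show ?case
    unfolding sigma_set.simps by (intro borel_open open_UN ballI open_cylinder)
next
  case (3 n i)
  then show ?case
    unfolding sigma_set.simps by (intro sets.countable_UN') auto
qed simp

lemma sigma_set_fair [simp]: "sigma_set n i \<in> sets fair_measure"
  by (simp add: sets_fair_measure sigma_set_borel)

lemma uniformly_Sigma_borel: "uniformly_Sigma n U \<Longrightarrow> U k \<in> sets borel"
  unfolding uniformly_Sigma_def by (auto simp: sigma_set_borel)

lemma uniformly_Sigma_fair: "uniformly_Sigma n U \<Longrightarrow> U k \<in> sets fair_measure"
  by (simp add: sets_fair_measure uniformly_Sigma_borel)

text \<open>Comparison with the fraction \<open>a / Suc b\<close>, with the denominator cleared.
  Natural numerators are enough for the nonnegative numbers that occur here.\<close>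

definition lower_semicomputable_in :: "nat set \<Rightarrow> (nat \<Rightarrow> real) \<Rightarrow> bool" where
  "lower_semicomputable_in Q r \<longleftrightarrow>
     re_in Q (\<lambda>z. real (pfst (psnd z)) < r (pfst z) * real (Suc (psnd (psnd z))))"

definition upper_semicomputable_in :: "nat set \<Rightarrow> (nat \<Rightarrow> real) \<Rightarrow> bool" where
  "upper_semicomputable_in Q r \<longleftrightarrow>
     re_in Q (\<lambda>z. r (pfst z) * real (Suc (psnd (psnd z))) < real (pfst (psnd z)))"

lemma lower_semicomputable_inD:
  assumes "lower_semicomputable_in Q r"
    "computable_in Q f" "computable_in Q g" "computable_in Q h"
  shows "re_in Q (\<lambda>x. real (g x) < r (f x) * real (Suc (h x)))"
  using re_in_subst3[of Q "\<lambda>k a b. real a < r k * real (Suc b)" f g h] assms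
  unfolding lower_semicomputable_in_def by blast

lemma upper_semicomputable_inD:
  assumes "upper_semicomputable_in Q r"
    "computable_in Q f" "computable_in Q g" "computable_in Q h"
  shows "re_in Q (\<lambda>x. r (f x) * real (Suc (h x)) < real (g x))"
  using re_in_subst3[of Q "\<lambda>k a b. r k * real (Suc b) < real a" f g h] assms
  unfolding upper_semicomputable_in_def by blast

lemma lower_semicomputable_in_subst:
  "lower_semicomputable_in Q r \<Longrightarrow> computable_in Q f \<Longrightarrow> lower_semicomputable_in Q (\<lambda>k. r (f k))"
  unfolding lower_semicomputable_in_def[of Q "\<lambda>k. r (f k)"]
  by (rule lower_semicomputable_inD, assumption, rule computable_compose, assumption)
    (intro computable_intros)+

lemma upper_semicomputable_in_subst:
  "upper_semicomputable_in Q r \<Longrightarrow> computable_in Q f \<Longrightarrow> upper_semicomputable_in Q (\<lambda>k. r (f k))"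
  unfolding upper_semicomputable_in_def[of Q "\<lambda>k. r (f k)"]
  by (rule upper_semicomputable_inD, assumption, rule computable_compose, assumption)
    (intro computable_intros)+

section \<open>Approximating measures from below\<close>

lemma ex_nat_between:
  fixes x y :: real
  assumes "0 \<le> x" "x + 1 < y"
  shows "\<exists>a::nat. x < real a \<and> real a < y"
  using assms by (intro exI[of _ "nat \<lfloor>x\<rfloor> + 1"]) (auto; linarith)

lemma ex_fraction_between:
  fixes x y :: real
  assumes "0 \<le> x" "x < y"
  shows "\<exists>a b. x * real (Suc b) < real a \<and> real a < y * real (Suc b)"
proof -
  obtain b where "1 < real b * (y - x)"
    using reals_Archimedean3[of "y - x"] assms by (auto)
  then have "x * real (Suc b) + 1 < y * real (Suc b)"
    using assms by (simp add: algebra_simps)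
  from ex_nat_between[OF _ this] assms obtain a
    where "x * real (Suc b) < real a" "real a < y * real (Suc b)" by auto
  then show ?thesis by blast
qed

lemma inj_on_bits: "inj_on (\<lambda>v. bits v l) {..<2 ^ l}"
proof (rule eq_card_imp_inj_on)
  have "(\<lambda>v. bits v l) ` {..<2 ^ l} = {\<sigma>. set \<sigma> \<subseteq> UNIV \<and> length \<sigma> = l}"
  proof (intro equalityI subsetI)
    fix \<sigma> :: "bool list" assume "\<sigma> \<in> {\<sigma>. set \<sigma> \<subseteq> UNIV \<and> length \<sigma> = l}"
    then show "\<sigma> \<in> (\<lambda>v. bits v l) ` {..<2 ^ l}" using ex_bits[of \<sigma>] by force
  qed auto
  then show "card ((\<lambda>v. bits v l) ` {..<2 ^ l}) = card {..<2 ^ l :: nat}"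
    using card_lists_length_eq[of "UNIV :: bool set" l] by simp
qed simp

lemma measure_UN_cylinder_bits:
  assumes "C \<subseteq> {..<2 ^ l}"
  shows "measure fair_measure (\<Union>v\<in>C. cylinder (bits v l)) = real (card C) / 2 ^ l"
proof -
  have "disjoint_family_on (\<lambda>v. cylinder (bits v l)) C"
    unfolding disjoint_family_on_def
  proof (intro ballI impI)
    fix v w assume vw: "v \<in> C" "w \<in> C" "v \<noteq> w"
    then have "bits v l \<noteq> bits w l"
      using inj_on_bits[of l] assms unfolding inj_on_def by blast
    then show "cylinder (bits v l) \<inter> cylinder (bits w l) = {}"
      by (metis bits_eq_of_mem disjoint_iff order_refl)
  qed
  moreover have "finite C" using assms finite_subset by blast
  ultimately have "measure fair_measure (\<Union>v\<in>C. cylinder (bits v l))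
      = (\<Sum>v\<in>C. measure fair_measure (cylinder (bits v l)))"
    by (intro fair.finite_measure_finite_Union) (auto simp: sets_fair_measure cylinder_borel)
  then show ?thesis by (simp add: measure_cylinder power_one_over)
qed

text \<open>Enumerated strings of length at most \<open>l\<close> are refined to length
  \<open>l\<close>, so that the measure of their union is a count of disjoint cylinders.\<close>

definition covered :: "nat \<Rightarrow> nat \<Rightarrow> nat set" where
  "covered i l = {v. v < 2 ^ l \<and> (\<exists>k<Suc l. string_index (bits v k) \<in> ce_set {} i)}"

lemma UN_covered:
  "(\<Union>v\<in>covered i l. cylinder (bits v l))
    = {x. \<exists>k<Suc l. string_index (map x [0..<k]) \<in> ce_set {} i}"
proof (intro equalityI subsetI)
  fix x assume "x \<in> {x. \<exists>k<Suc l. string_index (map x [0..<k]) \<in> ce_set {} i}"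
  moreover obtain v where v: "v < 2 ^ l" "x \<in> cylinder (bits v l)"
    using ex_mem_cylinder_bits by blast
  ultimately have "v \<in> covered i l"
    unfolding covered_def using bits_eq_of_mem[OF v(2)] by fastforce
  then show "x \<in> (\<Union>v\<in>covered i l. cylinder (bits v l))" using v by blast
next
  fix x assume "x \<in> (\<Union>v\<in>covered i l. cylinder (bits v l))"
  then obtain v where "v \<in> covered i l" "x \<in> cylinder (bits v l)" by blast
  then show "x \<in> {x. \<exists>k<Suc l. string_index (map x [0..<k]) \<in> ce_set {} i}"
    unfolding covered_def using bits_eq_of_mem[of x v l] by (fastforce simp: less_Suc_eq_le)
qed

lemma measure_sigma_set_1_limit:
  "(\<lambda>l. real (card (covered i l)) / 2 ^ l) \<longlonglongrightarrow> measure fair_measure (sigma_set (Suc 0) i)"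
  and card_covered_le: "real (card (covered i l)) / 2 ^ l \<le> measure fair_measure (sigma_set (Suc 0) i)"
proof -
  let ?A = "\<lambda>l. \<Union>v\<in>covered i l. cylinder (bits v l)"
  have meas: "?A l \<in> sets fair_measure" for l
    by (intro sets.countable_UN') (auto simp: sets_fair_measure cylinder_borel)
  have A: "measure fair_measure (?A l) = real (card (covered i l)) / 2 ^ l" for l
    by (rule measure_UN_cylinder_bits) (auto simp: covered_def)
  have "incseq ?A" unfolding UN_covered by (auto simp: incseq_def) (meson Suc_le_mono less_le_trans)
  moreover have U: "(\<Union>l. ?A l) = sigma_set (Suc 0) i"
    unfolding UN_covered set_eq_iff mem_sigma_set_1 using lessI by blast
  ultimately show "(\<lambda>l. real (card (covered i l)) / 2 ^ l) \<longlonglongrightarrow> measure fair_measure (sigma_set (Suc 0) i)"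
    using fair.finite_Lim_measure_incseq[of ?A] meas unfolding A by auto
  have "?A l \<subseteq> sigma_set (Suc 0) i" unfolding U[symmetric] by blast
  then show "real (card (covered i l)) / 2 ^ l \<le> measure fair_measure (sigma_set (Suc 0) i)"
    unfolding A[symmetric] by (intro fair.finite_measure_mono) auto
qed

text \<open>Membership in \<open>covered i l\<close> is c.e. but need not be decidable, so its
  cardinality is bounded from below by exhibiting a strictly increasing list \<open>c\<close> of
  \<open>m\<close> members.\<close>

lemma lower_semicomputable_measure_1:
  "lower_semicomputable_in {} (\<lambda>i. measure fair_measure (sigma_set (Suc 0) i))"
proof -
  have eq: "real a < measure fair_measure (sigma_set (Suc 0) i) * real (Suc b) \<longleftrightarrow>
    (\<exists>l m c. (\<forall>j<m. cnth c j < 2 ^ l \<and>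
        (\<exists>k. k < Suc l \<and> string_index (bits (cnth c j) k) \<in> ce_set {} i) \<and>
        (\<forall>k<j. cnth c k < cnth c j)) \<and> a * 2 ^ l < m * Suc b)" (is "?L \<longleftrightarrow> ?R") for i a b
  proof
    assume ?L
    moreover have "(\<lambda>l. real (card (covered i l)) / 2 ^ l * real (Suc b)) \<longlonglongrightarrow>
        measure fair_measure (sigma_set (Suc 0) i) * real (Suc b)"
      by (intro tendsto_intros measure_sigma_set_1_limit)
    ultimately have "eventually (\<lambda>l. real a < real (card (covered i l)) / 2 ^ l * real (Suc b)) sequentially"
      by (intro order_tendstoD(1))
    then obtain l where "real a < real (card (covered i l)) / 2 ^ l * real (Suc b)"
      by (auto simp: eventually_sequentially)
    then have "real a * 2 ^ l < real (card (covered i l)) * real (Suc b)"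
      by (simp add: field_simps del: of_nat_Suc)
    then have "real (a * 2 ^ l) < real (card (covered i l) * Suc b)"
      by (simp only: of_nat_mult of_nat_power of_nat_numeral)
    then have l: "a * 2 ^ l < card (covered i l) * Suc b" by (simp only: of_nat_less_iff)
    define s where "s = sorted_list_of_set (covered i l)"
    have fin: "finite (covered i l)" by (rule finite_subset[of _ "{..<2 ^ l}"]) (auto simp: covered_def)
    have s: "set s = covered i l" "length s = card (covered i l)" "sorted_wrt (<) s"
      using fin by (auto simp: s_def)
    obtain c where c: "\<forall>j<length s. cnth c j = s ! j" using ex_cnth by blast
    have mem: "cnth c j \<in> covered i l" if "j < length s" for j
      using that c s(1) by (metis nth_mem)
    have "cnth c k < cnth c j" if "j < length s" "k < j" for j k
      using that c s(3) by (simp add: sorted_wrt_iff_nth_less)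
    then show ?R
      using l mem s(2) unfolding covered_def
      by (intro exI[of _ l] exI[of _ "length s"] exI[of _ c]) auto
  next
    assume ?R
    then obtain l m c where c: "\<forall>j<m. cnth c j < 2 ^ l \<and>
        (\<exists>k. k < Suc l \<and> string_index (bits (cnth c j) k) \<in> ce_set {} i) \<and>
        (\<forall>k<j. cnth c k < cnth c j)" and m: "a * 2 ^ l < m * Suc b"
      by blast
    have "inj_on (cnth c) {..<m}"
      using c by (intro linorder_inj_onI) (auto, metis less_irrefl)
    moreover have "cnth c ` {..<m} \<subseteq> covered i l"
      using c by (auto simp: covered_def)
    moreover have "finite (covered i l)"
      by (rule finite_subset[of _ "{..<2 ^ l}"]) (auto simp: covered_def)
    ultimately have "m \<le> card (covered i l)"
      by (metis card_image card_mono card_lessThan)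
    then have "a * 2 ^ l < card (covered i l) * Suc b"
      using m by (meson less_le_trans mult_le_mono1)
    then have "real (a * 2 ^ l) < real (card (covered i l) * Suc b)" by (simp only: of_nat_less_iff)
    then have "real a < real (card (covered i l)) / 2 ^ l * real (Suc b)"
      by (simp add: field_simps)
    also have "\<dots> \<le> measure fair_measure (sigma_set (Suc 0) i) * real (Suc b)"
      by (intro mult_right_mono card_covered_le) simp
    finally show ?L .
  qed
  show ?thesis
    unfolding lower_semicomputable_in_def eq
    by (intro re.ex re.conj re.all_less re_in_ce_set; (rule re.decidable)?;
        intro computable_intros computable_string_index_bits computable_cnth)
qed

text \<open>A set of the next level is an increasing union of complements of finite intersections
  from the level below. Bounding such a complement from below means bounding the intersection from
  above, which is the negation of a c.e. condition and hence decidable one jump higher.\<close>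

theorem lower_semicomputable_measure_sigma_set:
  "lower_semicomputable_in (zero_jump n) (\<lambda>i. measure fair_measure (sigma_set (Suc n) i))"
proof (induction n)
  case 0
  then show ?case using lower_semicomputable_measure_1 by simp
next
  case (Suc n)
  let ?S = "sigma_set (Suc n)"
  have "uniformly_Sigma (Suc n) (\<lambda>z. \<Inter>k<psnd z. ?S (cnth (pfst (pair (pfst z) k)) (psnd (pair (pfst z) k))))"
    by (intro uniformly_Sigma_INT_less uniformly_Sigma_sigma_set computable_cnth computable_intros)
  then obtain h where h: "computable h" "\<And>z. (\<Inter>k<psnd z. ?S (cnth (pfst z) k)) = ?S (h z)"
    unfolding uniformly_Sigma_def by auto
  have h': "?S (h (pair c m)) = (\<Inter>k<m. ?S (cnth c k))" for c m
    using h(2)[of "pair c m"] by simp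
  \<comment> \<open>The last inequality says \<open>a / Suc b < 1 - a' / Suc b'\<close>, where
    \<open>a' / Suc b'\<close> is an upper bound for the measure of the intersection coded by
    \<open>c\<close> and \<open>m\<close>.\<close>
  have eq: "real a < measure fair_measure (sigma_set (Suc (Suc n)) i) * real (Suc b) \<longleftrightarrow>
    (\<exists>c m a' b'. (\<forall>k<m. cnth c k \<in> ce_set {} i) \<and>
      \<not> real a' < measure fair_measure (?S (h (pair c m))) * real (Suc b') \<and>
      a' * Suc b + a * Suc b' < Suc b * Suc b')" (is "?L \<longleftrightarrow> ?R") for i a b
  proof
    assume L: ?L
    \<comment> \<open>A set of positive measure has a nonempty index set, which can therefore be
      listed as the range of a total sequence \<open>j\<close>.\<close>
    have ne: "ce_set {} i \<noteq> {}"
      using L by (auto simp: sigma_set.simps(3))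
    define j where "j = from_nat_into (ce_set {} i)"
    have range_j: "range j = ce_set {} i"
      unfolding j_def by (rule range_from_nat_into[OF ne]) simp
    let ?A = "\<lambda>m. - (\<Inter>k<m. ?S (j k))"
    have "?A m = (\<Union>k<m. - ?S (j k))" for m by auto
    then have "?A m \<in> sets fair_measure" for m
      by (auto simp: sets_fair_measure intro!: borel_comp sigma_set_borel)
    then have "(\<lambda>m. measure fair_measure (?A m)) \<longlonglongrightarrow> measure fair_measure (\<Union>m. ?A m)"
    proof (intro fair.finite_Lim_measure_incseq)
      show "incseq ?A" unfolding incseq_def using less_le_trans by blast
    qed blast
    moreover have "(\<Union>m. ?A m) = sigma_set (Suc (Suc n)) i"
    proof -
      have "(\<Union>m. ?A m) = (\<Union>k. - ?S (j k))" using lessI by blast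
      also have "\<dots> = (\<Union>i\<in>range j. UNIV - ?S i)" by blast
      finally show ?thesis unfolding range_j sigma_set.simps(3) .
    qed
    ultimately have "(\<lambda>m. measure fair_measure (?A m) * real (Suc b))
        \<longlonglongrightarrow> measure fair_measure (sigma_set (Suc (Suc n)) i) * real (Suc b)"
      by (intro tendsto_intros) simp
    then have "eventually (\<lambda>m. real a < measure fair_measure (?A m) * real (Suc b)) sequentially"
      using L by (intro order_tendstoD(1))
    then obtain m where m: "real a < measure fair_measure (?A m) * real (Suc b)"
      by (auto simp: eventually_sequentially)
    obtain c where c: "\<forall>k<m. cnth c k = j k" using ex_cnth by blast
    then have A: "?A m = - ?S (h (pair c m))" unfolding h' by simp
    define r where "r = measure fair_measure (?S (h (pair c m)))"
    have "measure fair_measure (?A m) = 1 - r"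
      unfolding A r_def using fair.prob_compl[of "?S (h (pair c m))"] by (simp add: Compl_eq_Diff_UNIV)
    with m have "real a < (1 - r) * real (Suc b)" by (simp only:)
    then have "r < 1 - real a / real (Suc b)" by (simp add: field_simps)
    moreover have "0 \<le> r" by (simp add: r_def)
    ultimately obtain a' b' where ab: "r * real (Suc b') < real a'"
      "real a' < (1 - real a / real (Suc b)) * real (Suc b')"
      using ex_fraction_between by blast
    from ab(2) have "real a' * real (Suc b) < (1 - real a / real (Suc b)) * real (Suc b') * real (Suc b)"
      by (intro mult_strict_right_mono) simp_all
    also have "\<dots> = real (Suc b) * real (Suc b') - real a * real (Suc b')"
      by (simp add: field_simps)
    finally have "real (a' * Suc b + a * Suc b') < real (Suc b * Suc b')"
      by (simp add: algebra_simps)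
    then have "a' * Suc b + a * Suc b' < Suc b * Suc b'" by (simp only: of_nat_less_iff)
    moreover have "\<forall>k<m. cnth c k \<in> ce_set {} i" using c range_j by auto
    ultimately show ?R using ab(1) unfolding r_def by (metis less_asym)
  next
    assume ?R
    then obtain c m a' b' where c: "\<forall>k<m. cnth c k \<in> ce_set {} i"
      and a': "\<not> real a' < measure fair_measure (?S (h (pair c m))) * real (Suc b')"
      and ab: "a' * Suc b + a * Suc b' < Suc b * Suc b'"
      by blast
    define r where "r = measure fair_measure (?S (h (pair c m)))"
    have "- ?S (h (pair c m)) \<subseteq> sigma_set (Suc (Suc n)) i"
      unfolding h' subset_iff Compl_iff mem_sigma_set_Suc using c by blast
    then have "measure fair_measure (- ?S (h (pair c m))) \<le> measure fair_measure (sigma_set (Suc (Suc n)) i)"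
      by (intro fair.finite_measure_mono) auto
    moreover have "measure fair_measure (- ?S (h (pair c m))) = 1 - r"
      unfolding r_def Compl_eq_Diff_UNIV using fair.prob_compl[of "?S (h (pair c m))"] by simp
    ultimately have le: "1 - r \<le> measure fair_measure (sigma_set (Suc (Suc n)) i)" by simp
    have "real (a' * Suc b + a * Suc b') < real (Suc b * Suc b')" using ab by (simp only: of_nat_less_iff)
    then have "real a * real (Suc b') < real (Suc b) * real (Suc b') - real a' * real (Suc b)"
      by (simp only: of_nat_mult of_nat_add)
    also have "\<dots> \<le> real (Suc b) * real (Suc b') - r * real (Suc b') * real (Suc b)"
      using mult_right_mono[of "r * real (Suc b')" "real a'" "real (Suc b)"] a' unfolding r_def by simp
    also have "\<dots> = (1 - r) * real (Suc b) * real (Suc b')" by (simp add: algebra_simps)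
    finally have "real a < (1 - r) * real (Suc b)" by (simp only: mult_less_cancel_right_pos of_nat_0_less_iff zero_less_Suc)
    also have "\<dots> \<le> measure fair_measure (sigma_set (Suc (Suc n)) i) * real (Suc b)"
      using le by (intro mult_right_mono) auto
    finally show ?L .
  qed
  have D: "re_in (zero_jump (Suc n)) (\<lambda>x. \<not> real (f x) < measure fair_measure (?S (g x)) * real (Suc (k x)))"
    if "computable f" "computable g" "computable k" for f g k
  proof -
    have "re_in (zero_jump n) (\<lambda>x. real (f x) < measure fair_measure (?S (g x)) * real (Suc (k x)))"
      by (rule lower_semicomputable_inD[OF Suc that(2,1,3)[THEN computable_imp_computable_in]])
    then show ?thesis
      by (simp add: re_in_of_decidable_in decidable_not decidable_in_jump)
  qed
  show ?case
    unfolding lower_semicomputable_in_def eq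
    by (intro re.ex re.conj re.all_less D re_in_mono[OF re_in_ce_set]; (rule re.decidable)?;
        intro computable_intros computable_cnth computable_compose[OF h(1)])
qed

lemma lower_semicomputable_measure:
  assumes "uniformly_Sigma (Suc n) U"
  shows "lower_semicomputable_in (zero_jump n) (\<lambda>k. measure fair_measure (U k))"
proof -
  obtain f where "computable f" "\<And>k. U k = sigma_set (Suc n) (f k)"
    using assms unfolding uniformly_Sigma_def by blast
  then show ?thesis
    using lower_semicomputable_in_subst[OF lower_semicomputable_measure_sigma_set
        computable_imp_computable_in] by simp
qed

section \<open>Semicomputable and computable reals\<close>

lemma upper_semicomputable_in_diff:
  assumes "lower_semicomputable_in Q r" "\<And>k. 0 \<le> r k"
  shows "upper_semicomputable_in Q (\<lambda>k. 1 - r k)"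
proof -
  \<comment> \<open>The first disjunct covers the case in which natural subtraction would truncate;
    there the bound holds trivially.\<close>
  have eq: "(1 - r k) * real (Suc b) < real a \<longleftrightarrow>
      Suc b < a \<or> real (Suc b - a) < r k * real (Suc b)" for k a b
  proof (cases "Suc b < a")
    case True
    have "(1 - r k) * real (Suc b) \<le> real (Suc b)" using assms(2)[of k] by (simp add: mult_left_le_one_le)
    then show ?thesis using True by linarith
  next
    case False
    then show ?thesis by (simp add: algebra_simps of_nat_diff)
  qed
  show ?thesis
    unfolding upper_semicomputable_in_def eq
    by (intro re.disj lower_semicomputable_inD[OF assms(1)] computable_intros)
      (intro re.decidable computable_intros)
qed

lemma lower_semicomputable_in_diff:
  assumes "upper_semicomputable_in Q r" "\<And>k. 0 \<le> r k"
  shows "lower_semicomputable_in Q (\<lambda>k. 1 - r k)"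
proof -
  have eq: "real a < (1 - r k) * real (Suc b) \<longleftrightarrow> r k * real (Suc b) < real (Suc b - a)" for k a b
  proof (cases "Suc b < a")
    case True
    have "(1 - r k) * real (Suc b) \<le> real (Suc b)" "0 \<le> r k * real (Suc b)"
      using assms(2)[of k] by (simp_all add: mult_left_le_one_le)
    then have "\<not> real a < (1 - r k) * real (Suc b)" "\<not> r k * real (Suc b) < real (Suc b - a)"
      using True by linarith+
    then show ?thesis by blast
  next
    case False
    then show ?thesis by (simp add: algebra_simps of_nat_diff)
  qed
  show ?thesis
    unfolding lower_semicomputable_in_def eq
    by (intro upper_semicomputable_inD[OF assms(1)] computable_intros)
qed

text \<open>\<open>int_decode\<close> sends even codes to the nonnegative integers.\<close>

lemma rational_pair: "rational (pair (2 * a) b) = real a / real (Suc b)"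
  by (simp add: rational_def int_decode_def sum_decode_def)

lemma uniformly_computable_realsI:
  assumes "lower_semicomputable_in Q r" "upper_semicomputable_in Q r" "\<And>k. 0 \<le> r k"
  shows "uniformly_computable_reals_in Q r"
proof -
  \<comment> \<open>The open intervals of radius 1 around the integers overlap, so strict
    comparisons, which are c.e., always accept some \<open>a\<close> as numerator over
    \<open>2 ^ psnd z\<close>. For \<open>a = 0\<close> the lower bound is dropped because
    \<open>r\<close> may vanish.\<close>
  define P where "P z a \<longleftrightarrow>
      (a = 0 \<or> real (a - 1) < r (pfst z) * real (Suc (2 ^ psnd z - 1))) \<and>
      r (pfst z) * real (Suc (2 ^ psnd z - 1)) < real (Suc a)" for z a
  have "re_in Q (\<lambda>z. P (pfst z) (psnd z))"
    unfolding P_def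
    by (intro re.conj re.disj lower_semicomputable_inD[OF assms(1)]
        upper_semicomputable_inD[OF assms(2)] computable_intros)
      (intro re.decidable computable_intros)
  moreover have "\<exists>a. P z a" for z
  proof -
    define y where "y = r (pfst z) * real (Suc (2 ^ psnd z - 1))"
    have "0 \<le> y" unfolding y_def using assms(3) by simp
    then have "P z (nat \<lceil>y\<rceil>)" unfolding P_def y_def[symmetric] by (cases "y = 0") (auto; linarith)+
    then show ?thesis ..
  qed
  ultimately obtain f where f: "computable_in Q f" "\<And>z. P z (f z)"
    using computable_selection by blast
  define g where "g z = pair (2 * f z) (2 ^ psnd z - 1)" for z
  have "computable_in Q g"
    unfolding g_def by (intro computable_intros f(1))
  moreover have "\<bar>r k - rational (g (pair k j))\<bar> \<le> (1/2) ^ j" for k j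
  proof -
    let ?a = "f (pair k j)"
    have 2: "Suc (2 ^ j - 1) = 2 ^ j" by simp
    have "?a = 0 \<or> real (?a - 1) < r k * 2 ^ j" "r k * 2 ^ j < real (Suc ?a)"
      using f(2)[of "pair k j"] unfolding P_def prod_encode_inverse fst_conv snd_conv 2 by simp_all
    moreover have "0 \<le> r k * 2 ^ j" using assms(3) by simp
    ultimately have "\<bar>r k * 2 ^ j - real ?a\<bar> \<le> 1" by (cases ?a) (auto simp: abs_le_iff)
    also have "r k * 2 ^ j - real ?a = (r k - real ?a / 2 ^ j) * 2 ^ j" by (simp add: field_simps)
    finally have "\<bar>r k - real ?a / 2 ^ j\<bar> * 2 ^ j \<le> 1" by (simp add: abs_mult)
    then have "\<bar>r k - real ?a / 2 ^ j\<bar> \<le> 1 / 2 ^ j" by (simp add: field_simps)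
    then show ?thesis
      unfolding g_def prod_encode_inverse snd_conv rational_pair 2 by (simp add: power_one_over)
  qed
  ultimately show ?thesis unfolding uniformly_computable_reals_in_def by blast
qed

lemma add_fraction_less_iff:
  fixes a b c d t :: real
  assumes "0 < b" "0 < d" "0 < t"
  shows "a / b + 1 / t < c / d \<longleftrightarrow> a * d * t + b * d < c * b * t"
  using assms by (simp add: field_simps)

text \<open>A strict inequality is certified by a precision \<open>j\<close> at which the
  approximation clears the bound by the possible error \<open>(1/2) ^ j\<close>.\<close>

lemma uniformly_computable_realsD:
  assumes "uniformly_computable_reals_in Q r" "\<And>k. 0 \<le> r k"
  shows "lower_semicomputable_in Q r" "upper_semicomputable_in Q r"
proof -
  obtain f where f: "computable_in Q f"
    "\<And>k j. \<bar>r k - rational (f (pair k j))\<bar> \<le> (1/2) ^ j"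
    using assms(1) unfolding uniformly_computable_reals_in_def by blast
  \<comment> \<open>Negative approximations, which have odd codes, are replaced by 0; as
    \<open>r\<close> is nonnegative this does not increase the error.\<close>
  define p where "p z = (if even (pfst (f z)) then pfst (f z) div 2 else 0)" for z
  define d where "d z = psnd (f z)" for z
  have p: "computable_in Q p" unfolding p_def by (intro computable_intros f(1))
  have d: "computable_in Q d" unfolding d_def by (intro computable_intros f(1))
  have approx: "\<bar>r k - real (p (pair k j)) / real (Suc (d (pair k j)))\<bar> \<le> (1/2) ^ j" for k j
  proof -
    have "real (p (pair k j)) / real (Suc (d (pair k j))) = max 0 (rational (f (pair k j)))"
    proof -
      have "rational c = (if even (pfst c) then real (pfst c div 2) else - real (pfst c div 2) - 1)
          / real (Suc (psnd c))" for c
        by (simp add: rational_def int_decode_def sum_decode_def Let_def case_prod_unfold)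
      moreover have "(- real a - 1) / real (Suc b) < 0" for a b
        by (intro divide_neg_pos) auto
      ultimately show ?thesis by (auto simp: p_def d_def max_def simp del: of_nat_Suc dest: leD)
    qed
    then show ?thesis using f(2)[of k j] assms(2)[of k] by (auto simp: max_def abs_le_iff)
  qed
  \<comment> \<open>The error counts twice: once for the approximation itself and once for the
    margin demanded of it.\<close>
  have small: "\<exists>j. 2 * (1/2) ^ j < e" if "0 < e" for e :: real
  proof -
    obtain j where "(1/2) ^ j < e / 2" using real_arch_pow_inv[of "e / 2" "1/2"] \<open>0 < e\<close> by auto
    then show ?thesis by (intro exI[of _ j]) simp
  qed
  have lower: "real a < r k * real (Suc b) \<longleftrightarrow> (\<exists>j. a * Suc (d (pair k j)) * 2 ^ j +
      Suc b * Suc (d (pair k j)) < p (pair k j) * Suc b * 2 ^ j)" (is "?L \<longleftrightarrow> ?R") for k a b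
  proof -
    have "a * Suc (d (pair k j)) * 2 ^ j + Suc b * Suc (d (pair k j)) < p (pair k j) * Suc b * 2 ^ j
        \<longleftrightarrow> real a / real (Suc b) + (1/2) ^ j < real (p (pair k j)) / real (Suc (d (pair k j)))" for j
    proof -
      have "a * Suc (d (pair k j)) * 2 ^ j + Suc b * Suc (d (pair k j)) < p (pair k j) * Suc b * 2 ^ j
        \<longleftrightarrow> real (a * Suc (d (pair k j)) * 2 ^ j + Suc b * Suc (d (pair k j)))
          < real (p (pair k j) * Suc b * 2 ^ j)" by (simp only: of_nat_less_iff)
      also have "\<dots> \<longleftrightarrow> real a / real (Suc b) + (1/2) ^ j
          < real (p (pair k j)) / real (Suc (d (pair k j)))"
        unfolding power_one_over of_nat_add of_nat_mult of_nat_power of_nat_numeral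
        by (rule add_fraction_less_iff[symmetric]) simp_all
      finally show ?thesis .
    qed
    moreover have "?L \<longleftrightarrow> (\<exists>j. real a / real (Suc b) + (1/2) ^ j
        < real (p (pair k j)) / real (Suc (d (pair k j))))"
    proof
      assume ?L
      then have "0 < r k - real a / real (Suc b)" by (simp add: field_simps)
      from small[OF this] obtain j where "2 * (1/2) ^ j < r k - real a / real (Suc b)" by blast
      then show "\<exists>j. real a / real (Suc b) + (1/2) ^ j
        < real (p (pair k j)) / real (Suc (d (pair k j)))"
        using approx[of k j] by (intro exI[of _ j]) linarith
    next
      assume "\<exists>j. real a / real (Suc b) + (1/2) ^ j
        < real (p (pair k j)) / real (Suc (d (pair k j)))"
      then obtain j where "real a / real (Suc b) + (1/2) ^ j
        < real (p (pair k j)) / real (Suc (d (pair k j)))" ..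
      then have "real a / real (Suc b) < r k" using approx[of k j] by linarith
      then show ?L by (simp add: field_simps)
    qed
    ultimately show ?thesis by simp
  qed
  have upper: "r k * real (Suc b) < real a \<longleftrightarrow> (\<exists>j. p (pair k j) * Suc b * 2 ^ j +
      Suc (d (pair k j)) * Suc b < a * Suc (d (pair k j)) * 2 ^ j)" (is "?L \<longleftrightarrow> ?R") for k a b
  proof -
    have "p (pair k j) * Suc b * 2 ^ j + Suc (d (pair k j)) * Suc b < a * Suc (d (pair k j)) * 2 ^ j
        \<longleftrightarrow> real (p (pair k j)) / real (Suc (d (pair k j))) + (1/2) ^ j < real a / real (Suc b)" for j
    proof -
      have "p (pair k j) * Suc b * 2 ^ j + Suc (d (pair k j)) * Suc b < a * Suc (d (pair k j)) * 2 ^ j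
        \<longleftrightarrow> real (p (pair k j) * Suc b * 2 ^ j + Suc (d (pair k j)) * Suc b)
          < real (a * Suc (d (pair k j)) * 2 ^ j)" by (simp only: of_nat_less_iff)
      also have "\<dots> \<longleftrightarrow> real (p (pair k j)) / real (Suc (d (pair k j))) + (1/2) ^ j
          < real a / real (Suc b)"
        unfolding power_one_over of_nat_add of_nat_mult of_nat_power of_nat_numeral
        by (rule add_fraction_less_iff[symmetric]) simp_all
      finally show ?thesis .
    qed
    moreover have "?L \<longleftrightarrow> (\<exists>j. real (p (pair k j)) / real (Suc (d (pair k j))) + (1/2) ^ j
        < real a / real (Suc b))"
    proof
      assume ?L
      then have "0 < real a / real (Suc b) - r k" by (simp add: field_simps)
      from small[OF this] obtain j where "2 * (1/2) ^ j < real a / real (Suc b) - r k" by blast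
      then show "\<exists>j. real (p (pair k j)) / real (Suc (d (pair k j))) + (1/2) ^ j
        < real a / real (Suc b)"
        using approx[of k j] by (intro exI[of _ j]) linarith
    next
      assume "\<exists>j. real (p (pair k j)) / real (Suc (d (pair k j))) + (1/2) ^ j
        < real a / real (Suc b)"
      then obtain j where "real (p (pair k j)) / real (Suc (d (pair k j))) + (1/2) ^ j
        < real a / real (Suc b)" ..
      then have "r k < real a / real (Suc b)" using approx[of k j] by linarith
      then show ?L by (simp add: field_simps)
    qed
    ultimately show ?thesis by simp
  qed
  show "lower_semicomputable_in Q r"
    unfolding lower_semicomputable_in_def lower
    by (intro re.ex re_in_of_decidable_in computable_intros computable_compose[OF p]
        computable_compose[OF d])
  show "upper_semicomputable_in Q r"
    unfolding upper_semicomputable_in_def upper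
    by (intro re.ex re_in_of_decidable_in computable_intros computable_compose[OF p]
        computable_compose[OF d])
qed

lemma computable_real_in_iff:
  "computable_real_in Q c \<longleftrightarrow> uniformly_computable_reals_in Q (\<lambda>_. c)"
proof
  assume "computable_real_in Q c"
  then obtain f where "computable_in Q f" "\<And>j. \<bar>c - rational (f j)\<bar> \<le> (1/2) ^ j"
    unfolding computable_real_in_def by blast
  then show "uniformly_computable_reals_in Q (\<lambda>_. c)"
    unfolding uniformly_computable_reals_in_def
    by (intro exI[of _ "\<lambda>z. f (psnd z)"]) (simp add: computable_compose[of Q f psnd] computable_psnd computable_id)
next
  assume "uniformly_computable_reals_in Q (\<lambda>_. c)"
  then obtain f where "computable_in Q f" "\<And>k j. \<bar>c - rational (f (pair k j))\<bar> \<le> (1/2) ^ j"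
    unfolding uniformly_computable_reals_in_def by blast
  then show "computable_real_in Q c"
    unfolding computable_real_in_def
    by (intro exI[of _ "\<lambda>j. f (pair 0 j)"])
      (simp add: computable_compose[of Q f "pair 0"] computable_pair computable_const computable_id)
qed

text \<open>
  The hypothesis is inclusion-exclusion for growing finite unions or intersections. An upper bound
  for \<open>s m\<close> is certified by rounded upper bounds for all \<open>s l\<close>, \<open>l \<le> m\<close>, with a common denominator.
\<close>

lemma upper_semicomputable_in_telescope:
  assumes "lower_semicomputable_in Q i" "upper_semicomputable_in Q b"
    and "s 0 = real init" "\<And>m. s (Suc m) + i m = s m + b m"
    and "\<And>m. 0 \<le> s m" "\<And>m. 0 \<le> i m" "\<And>m. 0 \<le> b m"
  shows "upper_semicomputable_in Q s"
proof -
  have eq: "s m * real (Suc q) < real a \<longleftrightarrow> (\<exists>d c. init * Suc d < cnth c 0 \<and>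
      (\<forall>l<m. \<exists>\<beta> \<gamma>. b l * real (Suc d) < real \<beta> \<and> (\<gamma> = 0 \<or> real \<gamma> < i l * real (Suc d)) \<and>
        cnth c l + \<beta> \<le> cnth c (Suc l) + \<gamma>) \<and>
      cnth c m * Suc q \<le> a * Suc d)" (is "?L \<longleftrightarrow> ?R") for m q a
  proof
    assume ?R
    then obtain d c where 0: "init * Suc d < cnth c 0"
      and step: "\<And>l. l < m \<Longrightarrow> \<exists>\<beta> \<gamma>. b l * real (Suc d) < real \<beta> \<and>
        (\<gamma> = 0 \<or> real \<gamma> < i l * real (Suc d)) \<and> cnth c l + \<beta> \<le> cnth c (Suc l) + \<gamma>"
      and fin: "cnth c m * Suc q \<le> a * Suc d"
      by blast
    have "s l * real (Suc d) < real (cnth c l)" if "l \<le> m" for l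
      using that
    proof (induction l)
      case 0
      have "real (init * Suc d) < real (cnth c 0)" using \<open>init * Suc d < cnth c 0\<close> by (simp only: of_nat_less_iff)
      then show ?case unfolding assms(3) by (simp only: of_nat_mult)
    next
      case (Suc l)
      then obtain \<beta> \<gamma> where bg: "b l * real (Suc d) < real \<beta>"
        "\<gamma> = 0 \<or> real \<gamma> < i l * real (Suc d)" "cnth c l + \<beta> \<le> cnth c (Suc l) + \<gamma>"
        using step[of l] by auto
      have "real \<gamma> \<le> i l * real (Suc d)" using bg(2) assms(6)[of l] by auto
      moreover have "(s (Suc l) + i l) * real (Suc d) = (s l + b l) * real (Suc d)"
        by (simp only: assms(4))
      moreover have "real (cnth c l) + real \<beta> \<le> real (cnth c (Suc l)) + real \<gamma>"
        using bg(3) by (metis of_nat_add of_nat_le_iff)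
      ultimately show ?case
        using Suc bg(1) unfolding distrib_right by linarith
    qed
    from this[of m] have "s m * real (Suc d) * real (Suc q) < real (cnth c m) * real (Suc q)"
      by (intro mult_strict_right_mono) simp_all
    also have "\<dots> \<le> real a * real (Suc d)"
      using fin by (metis of_nat_le_iff of_nat_mult)
    finally have "(s m * real (Suc q)) * real (Suc d) < real a * real (Suc d)" by (simp add: mult_ac)
    then show ?L by (simp only: mult_less_cancel_right_pos of_nat_0_less_iff zero_less_Suc)
  next
    assume L: ?L
    \<comment> \<open>Rounding up \<open>b l\<close> and rounding down \<open>i l\<close> cost at
      most 1 each per step, and the start costs 1. The total is at most \<open>3 * m + 2\<close>,
      and the denominator is taken so large that this fits into the gap.\<close>
    then obtain d where "real (3 * m + 2) * real (Suc q) < real d * (real a - s m * real (Suc q))"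
      using reals_Archimedean3[of "real a - s m * real (Suc q)"] by auto
    then have d: "real (3 * m + 2) * real (Suc q) < real (Suc d) * (real a - s m * real (Suc q))"
      using L by (simp add: distrib_right)
    define \<beta> where "\<beta> l = nat \<lfloor>b l * real (Suc d)\<rfloor> + 1" for l
    define \<gamma> where "\<gamma> l = nat \<lceil>i l * real (Suc d)\<rceil> - 1" for l
    have \<beta>: "b l * real (Suc d) < real (\<beta> l)" "real (\<beta> l) \<le> b l * real (Suc d) + 1" for l
      unfolding \<beta>_def using mult_nonneg_nonneg[OF assms(7)[of l], of "real (Suc d)"] by (simp_all; linarith)+
    have \<gamma>: "\<gamma> l = 0 \<or> real (\<gamma> l) < i l * real (Suc d)" "i l * real (Suc d) - 1 \<le> real (\<gamma> l)" for l
      unfolding \<gamma>_def using mult_nonneg_nonneg[OF assms(6)[of l], of "real (Suc d)"] by linarith+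
    \<comment> \<open>Truncation of the subtraction at 0 does no harm, as it only makes the
      inequality demanded between successive entries easier.\<close>
    define A where "A l = rec_nat (init * Suc d + 1) (\<lambda>l r. r + \<beta> l - \<gamma> l) l" for l
    obtain c where c: "\<forall>l<Suc m. cnth c l = A l" using ex_cnth by blast
    have bound: "real (A l) \<le> s l * real (Suc d) + real (3 * l + 2)" for l
    proof (induction l)
      case 0
      then show ?case by (simp add: A_def assms(3) algebra_simps)
    next
      case (Suc l)
      have "A (Suc l) = A l + \<beta> l - \<gamma> l" by (simp add: A_def)
      then have "real (A (Suc l)) = 0 \<or> real (A (Suc l)) = real (A l) + real (\<beta> l) - real (\<gamma> l)" by linarith
      moreover have "(s (Suc l) + i l) * real (Suc d) = (s l + b l) * real (Suc d)"
        by (simp only: assms(4))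
      moreover have "0 \<le> s (Suc l) * real (Suc d)" using assms(5) by simp
      moreover have "real (3 * Suc l + 2) = real (3 * l + 2) + 3" by simp
      ultimately show ?case
        using Suc \<beta>(2)[of l] \<gamma>(2)[of l] unfolding distrib_right by linarith
    qed
    have "real (A m) * real (Suc q) \<le> (s m * real (Suc d) + real (3 * m + 2)) * real (Suc q)"
      by (intro mult_right_mono bound) simp
    also have "\<dots> \<le> real a * real (Suc d)" using d by (simp add: algebra_simps)
    finally have "real (A m * Suc q) \<le> real (a * Suc d)" by (simp only: of_nat_mult)
    then have "A m * Suc q \<le> a * Suc d" by (simp only: of_nat_le_iff)
    moreover have "init * Suc d < A 0" by (simp add: A_def)
    moreover have "A l + \<beta> l \<le> A (Suc l) + \<gamma> l" for l by (simp add: A_def)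
    then have "\<exists>\<beta> \<gamma>. b l * real (Suc d) < real \<beta> \<and> (\<gamma> = 0 \<or> real \<gamma> < i l * real (Suc d)) \<and>
        cnth c l + \<beta> \<le> cnth c (Suc l) + \<gamma>" if "l < m" for l
      using \<beta>(1)[of l] \<gamma>(1)[of l] c that 
      by - (rule exI[of _ "\<beta> l"], rule exI[of _ "\<gamma> l"], auto simp del: of_nat_Suc)
    ultimately show ?R
      using c
      by - (rule exI[of _ d], rule exI[of _ c], auto simp del: mult_Suc_right of_nat_Suc)
  qed
  show ?thesis
    unfolding upper_semicomputable_in_def eq
    by (intro re.ex re.conj re.disj re.all_less lower_semicomputable_inD[OF assms(1)]
        upper_semicomputable_inD[OF assms(2)]; (rule re.decidable)?; intro computable_intros computable_cnth)
qed


section \<open>The shift and the recurrence argument\<close>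

lemma Int_stable_cylinders: "Int_stable (insert {} (range cylinder))"
proof -
  have "cylinder \<sigma> \<inter> cylinder \<tau> \<in> insert {} (range cylinder)"
    if "length \<sigma> \<le> length \<tau>" for \<sigma> \<tau>
  proof (cases "\<forall>i<length \<sigma>. \<sigma> ! i = \<tau> ! i")
    case True
    then have "cylinder \<sigma> \<inter> cylinder \<tau> = cylinder \<tau>"
      using that by (auto simp: cylinder_def)
    then show ?thesis by auto
  next
    case False
    then have "cylinder \<sigma> \<inter> cylinder \<tau> = {}"
      using that by (auto simp: cylinder_def)
    then show ?thesis by auto
  qed
  then have "cylinder \<sigma> \<inter> cylinder \<tau> \<in> insert {} (range cylinder)" for \<sigma> \<tau>
    by (metis Int_commute nle_le)
  then show ?thesis unfolding Int_stable_def by auto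
qed

lemma sets_borel_cylinders: "sets (borel :: cantor measure) = sigma_sets UNIV (insert {} (range cylinder))"
proof (intro equalityI subsetI)
  let ?G = "insert {} (range cylinder)"
  fix B :: "cantor set" assume "B \<in> sets borel"
  then have "B \<in> sets (PiM UNIV (\<lambda>_. measure_pmf (bernoulli_pmf (1/2))))"
    using sets_fair_measure unfolding fair_measure_def by simp
  then have "B \<in> sigma_sets UNIV {{f. f i \<in> A} |i A. i \<in> (UNIV :: nat set) \<and> A \<in> (UNIV :: bool set set)}"
    by (simp add: sets_PiM_single)
  moreover have sub: "{{f. f i \<in> A} |i A. i \<in> (UNIV :: nat set) \<and> A \<in> (UNIV :: bool set set)} \<subseteq> sigma_sets UNIV ?G"
  proof clarify
    fix i :: nat and A :: "bool set"
    have "{f. f i \<in> A} = (\<Union>v\<in>{v. odd (v div 2 ^ i) \<in> A}. cylinder (bits v (Suc i)))"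
    proof (intro equalityI subsetI)
      fix f :: cantor assume "f \<in> {f. f i \<in> A}"
      moreover obtain v where "f \<in> cylinder (bits v (Suc i))" using ex_mem_cylinder_bits by blast
      ultimately show "f \<in> (\<Union>v\<in>{v. odd (v div 2 ^ i) \<in> A}. cylinder (bits v (Suc i)))"
        by (auto simp: mem_cylinder_bits)
    qed (auto simp: mem_cylinder_bits)
    moreover have "(\<Union>v\<in>{v. odd (v div 2 ^ i) \<in> A}. cylinder (bits v (Suc i))) \<in> sigma_sets UNIV ?G"
      by (intro sigma_sets_UNION) (auto intro: sigma_sets.Basic)
    ultimately show "{f. f i \<in> A} \<in> sigma_sets UNIV ?G" by simp
  qed
  ultimately show "B \<in> sigma_sets UNIV ?G" using sigma_sets_mono[OF sub] by blast
next
  fix B assume "B \<in> sigma_sets UNIV (insert {} (range cylinder))"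
  then show "B \<in> sets (borel :: cantor measure)"
    using sets.sigma_sets_subset[of "insert {} (range cylinder)" borel] cylinder_borel by auto
qed

text \<open>Dynkin's induction principle: cylinders together with the empty set are stable under
  intersection and generate the Borel sets.\<close>

lemma borel_induct_cylinder [consumes 1, case_names cylinder empty compl union]:
  assumes "B \<in> sets (borel :: cantor measure)" "\<And>\<sigma>. P (cylinder \<sigma>)" "P {}"
    and compl: "\<And>A. A \<in> sets borel \<Longrightarrow> P A \<Longrightarrow> P (- A)"
    and union: "\<And>A. disjoint_family A \<Longrightarrow> (\<And>i::nat. A i \<in> sets borel) \<Longrightarrow> (\<And>i. P (A i)) \<Longrightarrow> P (\<Union>i. A i)"
  shows "P B"
proof -
  from assms(1) have B: "B \<in> sigma_sets UNIV (insert {} (range cylinder))"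
    by (simp add: sets_borel_cylinders)
  show ?thesis
  proof (rule sigma_sets_induct_disjoint[OF Int_stable_cylinders _ B, of P])
    show "P (UNIV - A)" if "A \<in> sigma_sets UNIV (insert {} (range cylinder))" "P A" for A
      using compl[of A] that by (simp add: sets_borel_cylinders Compl_eq_Diff_UNIV)
    show "P (\<Union>i. A i)"
      if "disjoint_family A" "range A \<subseteq> sigma_sets UNIV (insert {} (range cylinder))" "\<And>i. P (A i)"
      for A :: "nat \<Rightarrow> cantor set"
      using union[of A] that by (auto simp: sets_borel_cylinders)
  qed (use assms(2,3) in auto)
qed

section \<open>The shift: independence, invariance and ergodicity\<close>

definition left_shift :: "nat \<Rightarrow> cantor \<Rightarrow> cantor" where
  "left_shift l x = (\<lambda>i. x (i + l))"

lemma measurable_left_shift: "left_shift l \<in> borel_measurable borel"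
proof (intro borel_measurable_continuous_onI continuous_on_coordinatewise_then_product)
  show "continuous_on UNIV (\<lambda>x. left_shift l x i)" for i
    unfolding left_shift_def by (rule continuous_on_product_coordinates)
qed

lemma left_shift_vimage_borel: "B \<in> sets borel \<Longrightarrow> left_shift l -` B \<in> sets borel"
  using measurable_sets[OF measurable_left_shift] by simp

text \<open>Independence of an initial segment and the tail after it. On cylinders the intersection
  is the cylinder of the concatenation, and both sides extend to Borel sets. It yields invariance
  and ergodicity of the shift and the scaling factor of \<open>prepend\<close>.\<close>

lemma measure_cylinder_Int_left_shift:
  assumes "B \<in> sets borel"
  shows "measure fair_measure (cylinder \<sigma> \<inter> left_shift (length \<sigma>) -` B)
    = (1/2) ^ length \<sigma> * measure fair_measure B"
proof -
  let ?S = "\<lambda>B. cylinder \<sigma> \<inter> left_shift (length \<sigma>) -` B"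
  have meas: "?S B \<in> sets fair_measure" if "B \<in> sets borel" for B
    using that by (auto simp: sets_fair_measure intro!: sets.Int cylinder_borel left_shift_vimage_borel)
  show ?thesis
    using assms
  proof (induction rule: borel_induct_cylinder)
    case (cylinder \<tau>)
    have "x \<in> ?S (cylinder \<tau>) \<longleftrightarrow> x \<in> cylinder (\<sigma> @ \<tau>)" for x
    proof
      assume x: "x \<in> ?S (cylinder \<tau>)"
      have "x i = (\<sigma> @ \<tau>) ! i" if "i < length (\<sigma> @ \<tau>)" for i
      proof (cases "i < length \<sigma>")
        case True
        then show ?thesis using x by (simp add: cylinder_def nth_append)
      next
        case False
        then obtain j where "i = j + length \<sigma>" by (metis le_add_diff_inverse2 not_less)
        then show ?thesis using x that by (simp add: cylinder_def left_shift_def nth_append)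
      qed
      then show "x \<in> cylinder (\<sigma> @ \<tau>)" by (simp add: cylinder_def)
    next
      assume x: "x \<in> cylinder (\<sigma> @ \<tau>)"
      have "x i = \<sigma> ! i" if "i < length \<sigma>" for i
        using x that by (auto simp: cylinder_def nth_append)
      moreover have "x (i + length \<sigma>) = \<tau> ! i" if "i < length \<tau>" for i
        using x that by (auto simp: cylinder_def nth_append dest: spec[of _ "i + length \<sigma>"])
      ultimately show "x \<in> ?S (cylinder \<tau>)" by (auto simp: cylinder_def left_shift_def)
    qed
    then have "?S (cylinder \<tau>) = cylinder (\<sigma> @ \<tau>)" by blast
    then show ?case by (simp add: measure_cylinder power_add)
  next
    case (compl A)
    then have A: "A \<in> sets borel" by simp
    have "?S (- A) = cylinder \<sigma> - ?S A" by auto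
    moreover have "measure fair_measure (cylinder \<sigma> - ?S A)
        = measure fair_measure (cylinder \<sigma>) - measure fair_measure (?S A)"
      using meas[OF A] by (intro fair.finite_measure_Diff) (auto simp: sets_fair_measure cylinder_borel)
    moreover have "measure fair_measure (- A) = 1 - measure fair_measure A"
      using fair.prob_compl[of A] A by (simp add: sets_fair_measure Compl_eq_Diff_UNIV)
    ultimately show ?case
      using compl(2) by (simp only: measure_cylinder right_diff_distrib mult_1_right)
  next
    case (union A)
    then have A: "A i \<in> sets borel" for i by simp
    have "(\<lambda>i. measure fair_measure (?S (A i))) sums measure fair_measure (\<Union>i. ?S (A i))"
      using meas[OF A] union(1)
      by (intro fair.finite_measure_UNION) (auto simp: disjoint_family_on_def)
    moreover have "(\<Union>i. ?S (A i)) = ?S (\<Union>i. A i)" by auto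
    ultimately have "(\<lambda>i. (1/2) ^ length \<sigma> * measure fair_measure (A i))
        sums measure fair_measure (?S (\<Union>i. A i))"
      using union(3) by simp
    moreover have "(\<lambda>i. (1/2) ^ length \<sigma> * measure fair_measure (A i))
        sums ((1/2) ^ length \<sigma> * measure fair_measure (\<Union>i. A i))"
      using A union(1)
      by (intro sums_mult fair.finite_measure_UNION) (auto simp: sets_fair_measure)
    ultimately show ?case by (rule sums_unique2)
  qed auto
qed

lemma measure_left_shift_vimage:
  assumes "B \<in> sets borel"
  shows "measure fair_measure (left_shift (Suc 0) -` B) = measure fair_measure B"
proof -
  let ?S = "\<lambda>b. cylinder [b] \<inter> left_shift (Suc 0) -` B"
  have meas: "?S b \<in> sets fair_measure" for b
    using assms by (auto simp: sets_fair_measure intro!: sets.Int cylinder_borel left_shift_vimage_borel)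
  have "?S True \<inter> ?S False = {}" by (auto simp: cylinder_def)
  from fair.finite_measure_Union[OF meas meas this]
  have "measure fair_measure (?S True \<union> ?S False)
      = measure fair_measure (?S True) + measure fair_measure (?S False)" .
  also have "?S True \<union> ?S False = left_shift (Suc 0) -` B" by (auto simp: cylinder_def)
  finally show ?thesis
    using measure_cylinder_Int_left_shift[OF assms, of "[True]"]
      measure_cylinder_Int_left_shift[OF assms, of "[False]"] by simp
qed

definition shift_map :: "cantor \<rightharpoonup> cantor" where
  "shift_map = (\<lambda>x. Some (left_shift (Suc 0) x))"

lemma preimage_shift_map: "preimage shift_map B = left_shift (Suc 0) -` B"
  by (auto simp: preimage_def shift_map_def)

lemma dom_shift_map [simp]: "dom shift_map = UNIV"
  by (auto simp: shift_map_def)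

lemma iterate_shift_map: "iterate shift_map k x = Some (left_shift k x)"
  by (induction k) (simp_all add: shift_map_def left_shift_def)

lemma measure_preserving_shift_map: "measure_preserving shift_map"
  unfolding measure_preserving_def
  by (simp add: preimage_shift_map left_shift_vimage_borel measure_left_shift_vimage)

text \<open>An invariant set is independent of every cylinder, hence of every Borel set and so of
  itself: its measure equals its own square.\<close>

lemma ergodic_shift_map: "ergodic shift_map"
  unfolding ergodic_def
proof (intro ballI impI)
  fix B :: "cantor set" assume B: "B \<in> sets borel" and inv: "preimage shift_map B = B"
  have invariant: "left_shift l -` B = B" for l
  proof (induction l)
    case (Suc l)
    have "left_shift (Suc l) -` B = left_shift l -` (left_shift (Suc 0) -` B)"
      by (auto simp: left_shift_def)
    then show ?case using Suc inv by (simp add: preimage_shift_map)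
  qed (auto simp: left_shift_def)
  have cyl: "measure fair_measure (cylinder \<sigma> \<inter> B)
      = measure fair_measure (cylinder \<sigma>) * measure fair_measure B" for \<sigma>
    using measure_cylinder_Int_left_shift[OF B, of \<sigma>] by (simp add: invariant measure_cylinder)
  have "measure fair_measure (A \<inter> B) = measure fair_measure A * measure fair_measure B"
    if "A \<in> sets borel" for A
    using that
  proof (induction rule: borel_induct_cylinder)
    case (cylinder \<sigma>)
    then show ?case by (rule cyl)
  next
    case (compl A)
    then have A: "A \<in> sets borel" by simp
    have "(- A) \<inter> B = B - A \<inter> B" by auto
    moreover have "measure fair_measure (B - A \<inter> B)
        = measure fair_measure B - measure fair_measure (A \<inter> B)"
      using A B by (intro fair.finite_measure_Diff) (auto simp: sets_fair_measure)
    moreover have "measure fair_measure (- A) = 1 - measure fair_measure A"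
      using fair.prob_compl[of A] A by (simp add: sets_fair_measure Compl_eq_Diff_UNIV)
    ultimately show ?case using compl(2) by (simp only: left_diff_distrib mult_1)
  next
    case (union A)
    then have A: "A i \<in> sets borel" for i by simp
    have "(\<lambda>i. measure fair_measure (A i \<inter> B)) sums measure fair_measure (\<Union>i. A i \<inter> B)"
      using A B union(1)
      by (intro fair.finite_measure_UNION) (auto simp: disjoint_family_on_def sets_fair_measure)
    moreover have "(\<Union>i. A i \<inter> B) = (\<Union>i. A i) \<inter> B" by auto
    ultimately have "(\<lambda>i. measure fair_measure (A i) * measure fair_measure B)
        sums measure fair_measure ((\<Union>i. A i) \<inter> B)"
      using union(3) by simp
    moreover have "(\<lambda>i. measure fair_measure (A i) * measure fair_measure B)
        sums (measure fair_measure (\<Union>i. A i) * measure fair_measure B)"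
      using A union(1)
      by (intro sums_mult2 fair.finite_measure_UNION) (auto simp: sets_fair_measure)
    ultimately show ?case by (rule sums_unique2)
  qed auto
  from this[OF B] show "measure fair_measure B = 0 \<or> measure fair_measure B = 1" by simp
qed

lemma computable_map_shift_map: "computable_map shift_map"
proof -
  \<comment> \<open>Putting a bit in front of a string turns its index \<open>s\<close> into
    \<open>Suc (pair bit s)\<close>, so the two alternatives are the two one-bit extensions to the
    left.\<close>
  define P where "P s t \<longleftrightarrow> t = Suc (pair 0 s) \<or> t = Suc (pair (Suc 0) s)" for s t
  have "re_in {} (\<lambda>z. P (pfst z) (psnd z))"
    unfolding P_def by (intro re.decidable computable_intros)
  then obtain f where f: "computable f" "\<And>s. ce_set {} (f s) = {t. P s t}"
    using parametrization by blast
  have P: "P (string_index \<sigma>) (string_index \<tau>) \<longleftrightarrow> \<tau> = True # \<sigma> \<or> \<tau> = False # \<sigma>" for \<sigma> \<tau>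
  proof -
    have "Suc (pair 0 (string_index \<sigma>)) = string_index (False # \<sigma>)"
      "Suc (pair (Suc 0) (string_index \<sigma>)) = string_index (True # \<sigma>)"
      by (simp_all add: string_index_def)
    then show ?thesis unfolding P_def by (auto simp: string_index_eq_iff)
  qed
  have "preimage shift_map (cylinder \<sigma>) = dom shift_map \<inter> sigma_set 1 (f (string_index \<sigma>))" for \<sigma>
  proof -
    have "sigma_set 1 (f (string_index \<sigma>)) = cylinder (True # \<sigma>) \<union> cylinder (False # \<sigma>)"
      unfolding One_nat_def sigma_set.simps f(2) mem_Collect_eq P by auto
    also have "\<dots> = left_shift (Suc 0) -` cylinder \<sigma>"
      by (auto simp: cylinder_def left_shift_def nth_Cons split: nat.splits)
    finally show ?thesis by (simp add: preimage_shift_map)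
  qed
  then show ?thesis unfolding computable_map_def using f(1) by blast
qed

text \<open>An upper bound for \<open>r\<close> and a lower bound for \<open>e\<close> over a common
  denominator \<open>Suc q\<close> bound the difference; \<open>\<epsilon> = 0\<close> serves the
  case that \<open>e k\<close> vanishes.\<close>

lemma upper_semicomputable_in_minus:
  assumes "lower_semicomputable_in Q e" "upper_semicomputable_in Q r"
    and "\<And>k. d k + e k = r k" "\<And>k. 0 \<le> r k" "\<And>k. 0 \<le> e k"
  shows "upper_semicomputable_in Q d"
proof -
  have eq: "d k * real (Suc b) < real a \<longleftrightarrow> (\<exists>q \<alpha> \<epsilon>. r k * real (Suc q) < real \<alpha> \<and>
      (\<epsilon> = 0 \<or> real \<epsilon> < e k * real (Suc q)) \<and> \<alpha> * Suc b \<le> a * Suc q + \<epsilon> * Suc b)"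
    (is "?L \<longleftrightarrow> ?R") for k a b
  proof
    assume ?R
    then obtain q \<alpha> \<epsilon> where *: "r k * real (Suc q) < real \<alpha>"
      "\<epsilon> = 0 \<or> real \<epsilon> < e k * real (Suc q)" "\<alpha> * Suc b \<le> a * Suc q + \<epsilon> * Suc b"
      by blast
    have "real \<epsilon> \<le> e k * real (Suc q)" using *(2) assms(5)[of k] by auto
    moreover have "d k * real (Suc q) = r k * real (Suc q) - e k * real (Suc q)"
      using assms(3)[of k] by (simp add: left_diff_distrib[symmetric] del: of_nat_Suc)
    ultimately have "d k * real (Suc q) < real \<alpha> - real \<epsilon>" using *(1) by linarith
    then have "d k * real (Suc q) * real (Suc b) < (real \<alpha> - real \<epsilon>) * real (Suc b)"
      by (intro mult_strict_right_mono) simp_all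
    also have "\<dots> \<le> real a * real (Suc q)"
    proof -
      have "real (\<alpha> * Suc b) \<le> real (a * Suc q + \<epsilon> * Suc b)" using *(3) by (simp only: of_nat_le_iff)
      then show ?thesis by (simp only: of_nat_mult of_nat_add left_diff_distrib)
    qed
    finally have "(d k * real (Suc b)) * real (Suc q) < real a * real (Suc q)" by (simp add: mult_ac)
    then show ?L by (simp only: mult_less_cancel_right_pos of_nat_0_less_iff zero_less_Suc)
  next
    assume L: ?L
    \<comment> \<open>The two roundings below cost at most 1 each, so the gap has to exceed 2 after
      scaling.\<close>
    then obtain q where "2 * real (Suc b) < real q * (real a - d k * real (Suc b))"
      using reals_Archimedean3[of "real a - d k * real (Suc b)"] by auto
    then have q: "2 * real (Suc b) < real (Suc q) * (real a - d k * real (Suc b))"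
      using L by (simp add: distrib_right)
    define \<alpha> where "\<alpha> = nat \<lfloor>r k * real (Suc q)\<rfloor> + 1"
    define \<epsilon> where "\<epsilon> = nat \<lceil>e k * real (Suc q)\<rceil> - 1"
    have \<alpha>: "r k * real (Suc q) < real \<alpha>" "real \<alpha> \<le> r k * real (Suc q) + 1"
      unfolding \<alpha>_def using mult_nonneg_nonneg[OF assms(4)[of k], of "real (Suc q)"] by (simp_all; linarith)+
    have \<epsilon>: "\<epsilon> = 0 \<or> real \<epsilon> < e k * real (Suc q)" "e k * real (Suc q) - 1 \<le> real \<epsilon>"
      unfolding \<epsilon>_def using mult_nonneg_nonneg[OF assms(5)[of k], of "real (Suc q)"] by linarith+
    have "d k * real (Suc q) = r k * real (Suc q) - e k * real (Suc q)"
      using assms(3)[of k] by (simp add: left_diff_distrib[symmetric] del: of_nat_Suc)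
    then have "real \<alpha> - real \<epsilon> \<le> d k * real (Suc q) + 2" using \<alpha>(2) \<epsilon>(2) by linarith
    then have "(real \<alpha> - real \<epsilon>) * real (Suc b) \<le> (d k * real (Suc q) + 2) * real (Suc b)"
      by (intro mult_right_mono) simp_all
    also have "\<dots> \<le> real a * real (Suc q)" using q by (simp add: algebra_simps)
    finally have "real (\<alpha> * Suc b) \<le> real (a * Suc q + \<epsilon> * Suc b)"
      by (simp only: of_nat_mult of_nat_add left_diff_distrib)
    then have "\<alpha> * Suc b \<le> a * Suc q + \<epsilon> * Suc b" by (simp only: of_nat_le_iff)
    then show ?R using \<alpha>(1) \<epsilon>(1) by blast
  qed
  show ?thesis
    unfolding upper_semicomputable_in_def eq
    by (intro re.ex re.conj re.disj lower_semicomputable_inD[OF assms(1)]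
        upper_semicomputable_inD[OF assms(2)]; (rule re.decidable)?; intro computable_intros)
qed

text \<open>The factor is absorbed into the denominator, which is then rewritten as a
  successor.\<close>

lemma upper_semicomputable_in_mult_power:
  assumes "upper_semicomputable_in Q r" "computable_in Q l"
  shows "upper_semicomputable_in Q (\<lambda>k. 2 ^ l k * r k)"
proof -
  have eq: "2 ^ l k * r k * real (Suc b) = r k * real (Suc (2 ^ l k * Suc b - 1))" for k b
    by (simp add: Suc_diff_1[simplified] algebra_simps of_nat_diff)
  show ?thesis
    unfolding upper_semicomputable_in_def eq
    by (intro upper_semicomputable_inD[OF assms(1)] computable_intros computable_compose[OF assms(2)])
qed

section \<open>Measures of finite unions and intersections\<close>

lemma uniformly_Sigma_UN_less:
  assumes "uniformly_Sigma (Suc n) U"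
  shows "uniformly_Sigma (Suc n) (\<lambda>m. \<Union>i<m. U i)"
proof -
  have "uniformly_Sigma (Suc n) (\<lambda>m. \<Union>i\<in>{i. i < m}. U (psnd (pair m i)))"
    by (rule uniformly_Sigma_UN)
      (intro uniformly_Sigma_subst[OF assms] re.decidable computable_intros)+
  then show ?thesis by (simp add: lessThan_def)
qed

text \<open>Each new set adds its measure minus the overlap with the earlier union, and the overlap
  is a set of the same level, hence bounded from below.\<close>

lemma upper_semicomputable_measure_UN_less:
  assumes "uniformly_Sigma (Suc n) U"
    and "upper_semicomputable_in (zero_jump n) (\<lambda>k. measure fair_measure (U k))"
  shows "upper_semicomputable_in (zero_jump n) (\<lambda>m. measure fair_measure (\<Union>i<m. U i))"
proof (rule upper_semicomputable_in_telescope[where init = 0])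
  note UN = uniformly_Sigma_UN_less[OF assms(1)]
  show "lower_semicomputable_in (zero_jump n) (\<lambda>m. measure fair_measure ((\<Union>i<m. U i) \<inter> U m))"
    by (intro lower_semicomputable_measure uniformly_Sigma_Int UN assms(1))
  show "measure fair_measure (\<Union>i<Suc m. U i) + measure fair_measure ((\<Union>i<m. U i) \<inter> U m)
      = measure fair_measure (\<Union>i<m. U i) + measure fair_measure (U m)" for m
    using measure_Un3[of "\<Union>i<m. U i" fair_measure "U m"]
      uniformly_Sigma_fair[OF UN] uniformly_Sigma_fair[OF assms(1)]
    by (simp add: lessThan_Suc Un_commute fair.fmeasurable_eq_sets)
qed (use assms(2) in auto)

lemma uniformly_Sigma_INT_initial:
  assumes "uniformly_Sigma (Suc n) U"
  shows "uniformly_Sigma (Suc n) (\<lambda>m. \<Inter>i<m. U i)"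
  using uniformly_Sigma_subst[OF uniformly_Sigma_INT_less[OF uniformly_Sigma_subst[OF assms computable_psnd[OF computable_id]]]
      computable_pair[OF computable_const computable_id]] by simp

text \<open>Dual to unions: the quantity subtracted is now the measure of the union of
  \<open>U m\<close> with the earlier intersection, and the start is the whole space.\<close>

lemma upper_semicomputable_measure_INT_less:
  assumes "uniformly_Sigma (Suc n) U"
    and "upper_semicomputable_in (zero_jump n) (\<lambda>k. measure fair_measure (U k))"
  shows "upper_semicomputable_in (zero_jump n) (\<lambda>m. measure fair_measure (\<Inter>i<m. U i))"
proof (rule upper_semicomputable_in_telescope[where init = 1])
  note INT = uniformly_Sigma_INT_initial[OF assms(1)]
  show "lower_semicomputable_in (zero_jump n) (\<lambda>m. measure fair_measure ((\<Inter>i<m. U i) \<union> U m))"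
    by (intro lower_semicomputable_measure uniformly_Sigma_Un INT assms(1))
  show "measure fair_measure (\<Inter>i<Suc m. U i) + measure fair_measure ((\<Inter>i<m. U i) \<union> U m)
      = measure fair_measure (\<Inter>i<m. U i) + measure fair_measure (U m)" for m
    using measure_Un3[of "\<Inter>i<m. U i" fair_measure "U m"]
      uniformly_Sigma_fair[OF INT] uniformly_Sigma_fair[OF assms(1)]
    by (simp add: lessThan_Suc Int_commute fair.fmeasurable_eq_sets)
  show "measure fair_measure (\<Inter>i<0. U i) = real 1"
    using fair.prob_space by simp
qed (use assms(2) in auto)

text \<open>The iterated preimages of \<open>N\<close> increase and all have the measure of
  \<open>N\<close>. Their union is exactly invariant, as the definition of ergodicity demands, and
  has the same measure; this measure is below 1 because \<open>N\<close> lies in the preimage of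
  \<open>U\<close>.\<close>

lemma measure_recurrent_eq_0:
  assumes T: "measure_preserving T" "ergodic T"
    and U: "U \<in> sets borel" "measure fair_measure U < 1"
    and N: "N \<in> sets borel" "N \<subseteq> preimage T N" "N \<subseteq> preimage T U"
  shows "measure fair_measure N = 0"
proof -
  define M where "M j = (preimage T ^^ j) N" for j
  have borel: "M j \<in> sets borel" for j
    by (induction j) (use T(1) N(1) in \<open>auto simp: M_def measure_preserving_def\<close>)
  have measure: "measure fair_measure (M j) = measure fair_measure N" for j
  proof (induction j)
    case (Suc j)
    then show ?case using T(1) borel[of j] by (auto simp: M_def measure_preserving_def)
  qed (simp add: M_def)
  have mono: "M j \<subseteq> M (Suc j)" for j
  proof (induction j)
    case (Suc j)
    then show ?case by (auto simp: M_def preimage_def)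
  qed (simp add: M_def N(2))
  define L where "L = (\<Union>j. M j)"
  have "preimage T L = (\<Union>j. M (Suc j))"
    unfolding L_def preimage_UN by (simp add: M_def)
  then have inv: "preimage T L = L"
    using mono unfolding L_def by blast
  have "(\<lambda>j. measure fair_measure (M j)) \<longlonglongrightarrow> measure fair_measure L"
    unfolding L_def using borel mono
    by (intro fair.finite_Lim_measure_incseq incseq_SucI) (auto simp: sets_fair_measure)
  then have L: "measure fair_measure L = measure fair_measure N"
    unfolding measure by (simp add: LIMSEQ_const_iff)
  have "L \<in> sets borel" unfolding L_def using borel by auto
  then have "measure fair_measure L = 0 \<or> measure fair_measure L = 1"
    using T(2) inv unfolding ergodic_def by blast
  moreover have "measure fair_measure N \<le> measure fair_measure (preimage T U)"
    using N T(1) U(1) by (intro fair.finite_measure_mono) (auto simp: measure_preserving_def sets_fair_measure)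
  then have "measure fair_measure N < 1"
    using T(1) U by (auto simp: measure_preserving_def)
  ultimately show ?thesis using L by simp
qed

theorem schnorr_random_imp_recurrent:
  assumes x: "schnorr_random (Suc n) x"
    and A: "is_Pi (Suc n) A" "measure fair_measure A > 0"
      "computable_real_in (zero_jump n) (measure fair_measure A)"
    and T: "measure_preserving T" "computable_map T" "ergodic T" "x \<in> dom T"
  shows "\<exists>k>0. \<exists>y\<in>A. iterate T k x = Some y"
proof (rule ccontr)
  assume contra: "\<not> ?thesis"
  let ?S = "sigma_set (Suc n)"
  obtain u where u: "- A = ?S u"
    using A(1) unfolding is_Pi_def is_Sigma_def Compl_eq_Diff_UNIV by blast
  have A_borel: "A \<in> sets borel"
    using borel_comp[OF sigma_set_borel[of "Suc n" u]] unfolding u[symmetric] by simp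
  obtain f where f: "computable f"
    "\<And>\<sigma>. preimage T (cylinder \<sigma>) = dom T \<inter> sigma_set 1 (f (string_index \<sigma>))"
    using T(2) unfolding computable_map_def by blast
  have "uniformly_computable_maps (\<lambda>_. T)"
    unfolding uniformly_computable_maps_def
    by (intro exI[of _ "\<lambda>z. f (psnd z)"] conjI computable_compose[OF f(1)] computable_intros)
      (simp add: f(2))
  from preimage_sigma_set[OF this, of n] obtain t' where t': "computable t'"
    "\<And>z i. preimage T (?S i) = dom T \<inter> ?S (t' (pair z i))" by blast
  define t where "t i = t' (pair 0 i)" for i
  have t: "computable t" "\<And>i. preimage T (?S i) = dom T \<inter> ?S (t i)"
    unfolding t_def using t'(2) computable_compose[OF t'(1) computable_pair[OF computable_const computable_id]]
    by auto
  have closed: "y \<in> dom T" if "T x = Some y" for x y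
    using T(1) that unfolding measure_preserving_def by blast
  have dom: "dom T \<in> sets borel" "measure fair_measure (dom T) = 1"
  proof -
    have "preimage T UNIV = dom T" by (auto simp: preimage_def)
    then show "dom T \<in> sets borel" "measure fair_measure (dom T) = 1"
      using T(1) fair.prob_space unfolding measure_preserving_def by (metis sets.top space_borel space_fair_measure)+
  qed
  \<comment> \<open>Indices obtained through \<open>t\<close> describe preimages only inside
    \<open>dom T\<close>; this transfers their measures to the whole sets.\<close>
  have measure_dom: "measure fair_measure (dom T \<inter> B) = measure fair_measure B"
    if "B \<in> sets borel" for B
  proof -
    have "AE x in fair_measure. x \<in> dom T"
      using fair.prob_eq_1[of "dom T"] dom by (simp add: sets_fair_measure)
    then show ?thesis
      using that dom(1) by (intro fair.finite_measure_eq_AE) (auto simp: sets_fair_measure)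
  qed
  \<comment> \<open>The exponent starts at 1 because only the iterates with positive exponent are
    assumed to avoid \<open>A\<close>.\<close>
  define c where "c k = (t ^^ Suc k) u" for k
  have "c k = rec_nat (t u) (\<lambda>_ r. t r) k" for k
    by (induction k) (simp_all add: c_def)
  then have "c = (\<lambda>k. rec_nat (t u) (\<lambda>_ r. t r) k)" by blast
  then have c: "computable c"
    by (simp only:) (intro computable_intros computable_compose[OF t(1)])
  have c_Suc: "c (Suc k) = t (c k)" and c_0: "c 0 = t u" for k
    by (simp_all add: c_def)
  have measure_c: "measure fair_measure (?S (c k)) = measure fair_measure (?S u)" for k
  proof -
    have t_eq: "measure fair_measure (?S (t i)) = measure fair_measure (?S i)" for i
      using T(1) measure_dom[of "?S (t i)"] unfolding measure_preserving_def t(2)[symmetric]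
      by (simp add: sigma_set_borel)
    show ?thesis by (induction k) (simp_all add: c_0 c_Suc t_eq)
  qed
  \<comment> \<open>The equivalence is kept for all indices \<open>i\<close>, so that the induction
    step can apply it to \<open>t i\<close>.\<close>
  have orbit: "\<exists>y. iterate T k x = Some y \<and> y \<in> dom T \<and> (\<forall>i. y \<in> ?S i \<longleftrightarrow> x \<in> ?S ((t ^^ k) i))" for k
  proof (induction k)
    case 0
    then show ?case using T(4) by simp
  next
    case (Suc k)
    then obtain y where y: "iterate T k x = Some y" "y \<in> dom T"
      "\<And>i. y \<in> ?S i \<longleftrightarrow> x \<in> ?S ((t ^^ k) i)" by blast
    then obtain w where w: "T y = Some w" by blast
    have "w \<in> ?S i \<longleftrightarrow> x \<in> ?S ((t ^^ Suc k) i)" for i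
    proof -
      have "w \<in> ?S i \<longleftrightarrow> y \<in> preimage T (?S i)" using w by (auto simp: preimage_def)
      then have "w \<in> ?S i \<longleftrightarrow> y \<in> ?S (t i)" unfolding t(2) using y(2) by blast
      then show ?thesis using y(3) by (simp add: funpow_swap1)
    qed
    then show ?case using y(1) w closed[OF w] by auto
  qed
  have x_mem: "x \<in> ?S (c k)" for k
  proof -
    obtain y where y: "iterate T (Suc k) x = Some y" "y \<in> ?S u \<longleftrightarrow> x \<in> ?S ((t ^^ Suc k) u)"
      using orbit by blast
    have "y \<notin> A" using contra y(1) by blast
    then have "y \<in> ?S u" unfolding u[symmetric] by simp
    then show ?thesis using y(2) by (simp add: c_def)
  qed
  define V where "V m = (\<Inter>k<m. ?S (c k))" for m
  have V: "uniformly_Sigma (Suc n) V"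
    unfolding V_def by (intro uniformly_Sigma_INT_initial uniformly_Sigma_sigma_set c)
  have "measure fair_measure (?S u) = 1 - measure fair_measure A"
    unfolding u[symmetric] using fair.prob_compl[of A] A_borel
    by (simp add: sets_fair_measure Compl_eq_Diff_UNIV)
  moreover have "upper_semicomputable_in (zero_jump n) (\<lambda>_. 1 - measure fair_measure A)"
    using A(3) unfolding computable_real_in_iff
    by (intro upper_semicomputable_in_diff uniformly_computable_realsD(1)) auto
  ultimately have "upper_semicomputable_in (zero_jump n) (\<lambda>k. measure fair_measure (?S (c k)))"
    unfolding measure_c by simp
  then have upper_V: "upper_semicomputable_in (zero_jump n) (\<lambda>m. measure fair_measure (V m))"
    unfolding V_def by (intro upper_semicomputable_measure_INT_less uniformly_Sigma_sigma_set c)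
  have limit: "(\<lambda>m. measure fair_measure (V m)) \<longlonglongrightarrow> 0"
  proof -
    have "(\<lambda>m. measure fair_measure (V m)) \<longlonglongrightarrow> measure fair_measure (\<Inter>m. V m)"
    proof (rule fair.finite_Lim_measure_decseq)
      show "range V \<subseteq> fair.events" using uniformly_Sigma_fair[OF V] by blast
      show "decseq V" unfolding decseq_def V_def by auto
    qed
    moreover have "measure fair_measure (\<Inter>m. V m) = 0"
    proof -
      have V_eq: "(\<Inter>m. V m) = (\<Inter>k. ?S (c k))" unfolding V_def using lessI by blast
      have borel: "(\<Inter>k. ?S (c k)) \<in> sets borel" by (intro sets.countable_INT) (auto simp: sigma_set_borel)
      \<comment> \<open>This is the set of points of the domain whose positive iterates all stay in
        the complement of \<open>A\<close>; it is contained in its own preimage.\<close>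
      have "measure fair_measure (dom T \<inter> (\<Inter>k. ?S (c k))) = 0"
      proof (rule measure_recurrent_eq_0[OF T(1,3), of "?S u"])
        show "measure fair_measure (?S u) < 1"
          using A(2) \<open>measure fair_measure (?S u) = 1 - measure fair_measure A\<close> by simp
        show "dom T \<inter> (\<Inter>k. ?S (c k)) \<in> sets borel" using dom(1) borel by blast
        show "dom T \<inter> (\<Inter>k. ?S (c k)) \<subseteq> preimage T (?S u)"
          unfolding t(2) c_0[symmetric] by blast
        show "dom T \<inter> (\<Inter>k. ?S (c k)) \<subseteq> preimage T (dom T \<inter> (\<Inter>k. ?S (c k)))"
        proof
          fix z assume z: "z \<in> dom T \<inter> (\<Inter>k. ?S (c k))"
          then obtain w where w: "T z = Some w" by blast
          have "w \<in> ?S (c k)" for k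
          proof -
            have "z \<in> preimage T (?S (c k))" using z unfolding t(2) c_Suc[symmetric] by blast
            then show ?thesis using w by (auto simp: preimage_def)
          qed
          then show "z \<in> preimage T (dom T \<inter> (\<Inter>k. ?S (c k)))"
            using w closed[OF w] by (auto simp: preimage_def)
        qed
      qed (simp add: sigma_set_borel)
      then show ?thesis unfolding V_eq using measure_dom[OF borel] by simp
    qed
    ultimately show ?thesis by simp
  qed
  \<comment> \<open>\<open>Suc (2 ^ j - 1)\<close> is \<open>2 ^ j\<close>, so the condition says
    that \<open>V m\<close> has measure below \<open>2^-j\<close>. Being c.e. in the oracle, it
    allows the oracle to select a suitable \<open>m\<close> for each \<open>j\<close>.\<close>
  have "re_in (zero_jump n) (\<lambda>z. measure fair_measure (V (psnd z)) * real (Suc (2 ^ pfst z - 1)) < real 1)"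
    by (intro upper_semicomputable_inD[OF upper_V] computable_intros)
  moreover have "\<exists>m. measure fair_measure (V m) * real (Suc (2 ^ j - 1)) < real 1" for j
  proof -
    have "eventually (\<lambda>m. measure fair_measure (V m) < (1/2) ^ j) sequentially"
      using limit by (intro order_tendstoD(2)) auto
    then obtain m where "measure fair_measure (V m) < (1/2) ^ j" by (auto simp: eventually_sequentially)
    then show ?thesis by (intro exI[of _ m]) (simp add: power_one_over field_simps)
  qed
  ultimately obtain g where g: "computable_in (zero_jump n) g"
    "\<And>j. measure fair_measure (V (g j)) * real (Suc (2 ^ j - 1)) < real 1"
    using computable_selection[of "zero_jump n" "\<lambda>j m. measure fair_measure (V m) * real (Suc (2 ^ j - 1)) < real 1"]
    by blast
  have "schnorr_test (Suc n) (\<lambda>j. V (g j))"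
    unfolding schnorr_test_def
  proof (intro conjI allI)
    \<comment> \<open>\<open>g\<close> is computable only in the oracle. Writing
      \<open>V (g k)\<close> as a union over a singleton that is decidable in the oracle provides
      indices by a plain computable function.\<close>
    have "uniformly_Sigma (Suc n) (\<lambda>k. \<Union>i\<in>{i. i = g k}. V (psnd (pair k i)))"
      by (rule uniformly_Sigma_UN)
        (intro uniformly_Sigma_subst[OF V] re_in_of_decidable_in computable_intros
          computable_compose[OF g(1)])+
    then show "uniformly_Sigma (Suc n) (\<lambda>j. V (g j))" by simp
    show "measure fair_measure (V (g j)) \<le> (1/2) ^ j" for j
      using g(2)[of j] by (simp add: power_one_over field_simps)
    show "uniformly_computable_reals_in (zero_jump (Suc n - 1)) (\<lambda>k. measure fair_measure (V (g k)))"
      unfolding diff_Suc_1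
      by (intro uniformly_computable_realsI upper_semicomputable_in_subst[OF upper_V g(1)]
          lower_semicomputable_in_subst[OF lower_semicomputable_measure[OF V] g(1)] measure_nonneg)
  qed
  then have "x \<notin> (\<Inter>j. V (g j))" using x unfolding schnorr_random_def by blast
  then show False using x_mem unfolding V_def by blast
qed

section \<open>From a failed test to a set that all tails avoid\<close>

definition prepend :: "nat \<Rightarrow> nat \<Rightarrow> cantor \<Rightarrow> cantor" where
  "prepend v l y = (\<lambda>i. if i < l then odd (v div 2 ^ i) else y (i - l))"

lemma prepend_left_shift: "x \<in> cylinder (bits v l) \<Longrightarrow> prepend v l (left_shift l x) = x"
  by (auto simp: prepend_def left_shift_def mem_cylinder_bits)

lemma uniformly_computable_maps_prepend:
  "uniformly_computable_maps (\<lambda>z y. Some (prepend (pfst z) (psnd z) y))"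
proof -
  \<comment> \<open>The condition says that the string with index \<open>s\<close>, placed after the
    first \<open>psnd (pfst z)\<close> bits of \<open>pfst (pfst z)\<close>, extends the string with
    index \<open>psnd z\<close>. The bound on \<open>m\<close> ensures that only bits inside
    \<open>bits u k\<close> are consulted; the equivalence of bits is split into two implications to
    match the decidability rules.\<close>
  define P where "P z s \<longleftrightarrow> (\<exists>u k w m. s = string_index (bits u k) \<and> m \<le> psnd (pfst z) + k \<and>
      string_index (bits w m) = psnd z \<and> (\<forall>i<m. (odd (w div 2 ^ i) \<longrightarrow>
        (if i < psnd (pfst z) then odd (pfst (pfst z) div 2 ^ i) else odd (u div 2 ^ (i - psnd (pfst z))))) \<and>
       (\<not> odd (w div 2 ^ i) \<longrightarrow> \<not>
        (if i < psnd (pfst z) then odd (pfst (pfst z) div 2 ^ i) else odd (u div 2 ^ (i - psnd (pfst z)))))))"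
    for z s
  have "re_in {} (\<lambda>z. P (pfst z) (psnd z))"
    unfolding P_def
    by (intro re.ex re.decidable computable_intros computable_string_index_bits)
  then have "uniformly_Sigma (Suc 0) (\<lambda>z. \<Union>w\<in>{w. P z (string_index (bits (pfst w) (psnd w)))}.
      cylinder (bits (pfst w) (psnd w)))"
  proof (rule uniformly_Sigma_1I)
    fix k x
    show "x \<in> (\<Union>w\<in>{w. P k (string_index (bits (pfst w) (psnd w)))}. cylinder (bits (pfst w) (psnd w)))
      \<longleftrightarrow> (\<exists>v l. x \<in> cylinder (bits v l) \<and> P k (string_index (bits v l)))"
      by auto (metis fst_conv snd_conv prod_encode_inverse)
  qed
  then obtain f where f: "computable f" "\<And>z. (\<Union>w\<in>{w. P z (string_index (bits (pfst w) (psnd w)))}.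
      cylinder (bits (pfst w) (psnd w))) = sigma_set (Suc 0) (f z)"
    unfolding uniformly_Sigma_def by blast
  have "prepend v l y \<in> cylinder \<sigma> \<longleftrightarrow> y \<in> sigma_set (Suc 0) (f (pair (pair v l) (string_index \<sigma>)))"
    for v l y \<sigma>
  proof -
    have P: "P (pair (pair v l) (string_index \<sigma>)) (string_index \<tau>) \<longleftrightarrow> (\<exists>u k. \<tau> = bits u k \<and>
        length \<sigma> \<le> l + k \<and> (\<forall>i<length \<sigma>. \<sigma> ! i = (if i < l then odd (v div 2 ^ i) else odd (u div 2 ^ (i - l)))))"
      (is "_ \<longleftrightarrow> ?R") for \<tau>
    proof
      assume "P (pair (pair v l) (string_index \<sigma>)) (string_index \<tau>)"
      then obtain u k w m where "\<tau> = bits u k" "m \<le> l + k" "bits w m = \<sigma>"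
        "\<forall>i<m. odd (w div 2 ^ i) = (if i < l then odd (v div 2 ^ i) else odd (u div 2 ^ (i - l)))"
        unfolding P_def string_index_eq_iff prod_encode_inverse fst_conv snd_conv by blast
      then show ?R by - (rule exI[of _ u], rule exI[of _ k], auto)
    next
      assume ?R
      then obtain u k where *: "\<tau> = bits u k" "length \<sigma> \<le> l + k"
        "\<And>i. i < length \<sigma> \<Longrightarrow> \<sigma> ! i = (if i < l then odd (v div 2 ^ i) else odd (u div 2 ^ (i - l)))"
        by blast
      obtain w where w: "bits w (length \<sigma>) = \<sigma>" using ex_bits by blast
      have "odd (w div 2 ^ i) = (if i < l then odd (v div 2 ^ i) else odd (u div 2 ^ (i - l)))"
        if "i < length \<sigma>" for i
        using *(3)[OF that] nth_bits[OF that, of w] unfolding w by simp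
      then show "P (pair (pair v l) (string_index \<sigma>)) (string_index \<tau>)"
        unfolding P_def string_index_eq_iff prod_encode_inverse fst_conv snd_conv
        using *(1,2) w by blast
    qed
    have "y \<in> sigma_set (Suc 0) (f (pair (pair v l) (string_index \<sigma>))) \<longleftrightarrow>
        (\<exists>u k. y \<in> cylinder (bits u k) \<and> P (pair (pair v l) (string_index \<sigma>)) (string_index (bits u k)))"
      unfolding f(2)[symmetric] by auto (metis fst_conv snd_conv prod_encode_inverse)
    also have "\<dots> \<longleftrightarrow> prepend v l y \<in> cylinder \<sigma>" (is "?L \<longleftrightarrow> _")
    proof
      assume ?L
      then obtain u k where uk: "y \<in> cylinder (bits u k)" "length \<sigma> \<le> l + k"
        "\<forall>i<length \<sigma>. \<sigma> ! i = (if i < l then odd (v div 2 ^ i) else odd (u div 2 ^ (i - l)))"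
        unfolding P by metis
      then show "prepend v l y \<in> cylinder \<sigma>"
        by (auto simp: cylinder_def prepend_def)
    next
      assume y: "prepend v l y \<in> cylinder \<sigma>"
      obtain u where u: "y \<in> cylinder (bits u (length \<sigma>))" using ex_mem_cylinder_bits by blast
      have "\<forall>i<length \<sigma>. \<sigma> ! i = (if i < l then odd (v div 2 ^ i) else odd (u div 2 ^ (i - l)))"
        using y u by (auto simp: cylinder_def prepend_def)
      moreover have "length \<sigma> \<le> l + length \<sigma>" by simp
      ultimately show ?L unfolding P using u by blast
    qed
    finally show ?thesis by blast
  qed
  then have "preimage (\<lambda>y. Some (prepend (pfst z) (psnd z) y)) (cylinder \<sigma>)
      = sigma_set 1 (f (pair z (string_index \<sigma>)))" for z \<sigma>
    by (auto simp: preimage_def)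
  moreover have "dom (\<lambda>y. Some (prepend v l y)) = UNIV" for v l by auto
  ultimately show ?thesis unfolding uniformly_computable_maps_def using f(1) by auto
qed

text \<open>Prepending copies the whole space onto the cylinder, which has measure
  \<open>2^-l\<close>; independence of initial segment and tail makes the scaling uniform.\<close>

lemma measure_prepend_vimage:
  assumes "{y. prepend v l y \<in> U} \<in> sets borel"
  shows "measure fair_measure {y. prepend v l y \<in> U} = 2 ^ l * measure fair_measure (U \<inter> cylinder (bits v l))"
proof -
  have "cylinder (bits v l) \<inter> left_shift l -` {y. prepend v l y \<in> U} = U \<inter> cylinder (bits v l)"
    by (auto simp: prepend_left_shift)
  then show ?thesis
    using measure_cylinder_Int_left_shift[OF assms, of "bits v l"] by (simp add: power_one_over)
qed

theorem not_schnorr_random_imp_not_recurrent: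
  assumes "\<not> schnorr_random (Suc n) x"
  shows "\<exists>A. is_Pi (Suc n) A \<and> measure fair_measure A > 0 \<and>
    computable_real_in (zero_jump n) (measure fair_measure A) \<and> (\<forall>k. left_shift k x \<notin> A)"
proof -
  let ?S = "sigma_set (Suc n)"
  obtain U where U: "uniformly_Sigma (Suc n) U" "\<And>k. measure fair_measure (U k) \<le> (1/2) ^ k"
    "uniformly_computable_reals_in (zero_jump n) (\<lambda>k. measure fair_measure (U k))"
    and x: "\<And>k. x \<in> U k"
    using assms unfolding schnorr_random_def schnorr_test_def by auto
  obtain f where f: "computable f" "\<And>k. U k = ?S (f k)"
    using U(1) unfolding uniformly_Sigma_def by blast
  obtain t where t: "computable t" "\<And>z i. preimage (\<lambda>y. Some (prepend (pfst z) (psnd z) y)) (?S i)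
      = dom (\<lambda>y. Some (prepend (pfst z) (psnd z) y)) \<inter> ?S (t (pair z i))"
    using preimage_sigma_set[OF uniformly_computable_maps_prepend] by blast
  \<comment> \<open>Here \<open>z\<close> codes a string of length \<open>psnd z\<close>. That
    summand cancels the scaling by \<open>2 ^ psnd z\<close>, and \<open>z + 2\<close> leaves bounds
    \<open>2^-(z+2)\<close> with sum \<open>1/2\<close>.\<close>
  define c where "c z = psnd z + z + 2" for z
  have c: "computable c" unfolding c_def by (intro computable_intros)
  define Y where "Y z = {y. prepend (pfst z) (psnd z) y \<in> U (c z)}" for z
  have Y_eq: "Y z = ?S (t (pair z (f (c z))))" for z
    using t(2)[of z "f (c z)"] unfolding Y_def f(2) by (auto simp: preimage_def)
  have Y: "uniformly_Sigma (Suc n) Y"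
    unfolding uniformly_Sigma_def using Y_eq
    by (intro exI[of _ "\<lambda>z. t (pair z (f (c z)))"])
      (auto intro!: computable_compose[OF t(1)] computable_compose[OF f(1)] computable_intros c)
  have measure_Y: "measure fair_measure (Y z)
      = 2 ^ psnd z * measure fair_measure (U (c z) \<inter> cylinder (bits (pfst z) (psnd z)))" for z
    unfolding Y_def by (rule measure_prepend_vimage) (use uniformly_Sigma_borel[OF Y] in \<open>simp add: Y_def\<close>)
  \<comment> \<open>The measure of \<open>U (c z)\<close> is computable and its part outside the
    cylinder is a set of the same level. Subtracting lower bounds for that part bounds the part
    inside from above.\<close>
  have "upper_semicomputable_in (zero_jump n)
      (\<lambda>z. measure fair_measure (U (c z) \<inter> cylinder (bits (pfst z) (psnd z))))"
  proof (rule upper_semicomputable_in_minus)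
    show "lower_semicomputable_in (zero_jump n)
        (\<lambda>z. measure fair_measure (U (c z) \<inter> - cylinder (bits (pfst z) (psnd z))))"
      by (intro lower_semicomputable_measure uniformly_Sigma_Int uniformly_Sigma_subst[OF U(1)] c
          uniformly_Sigma_Compl_cylinder)
    show "upper_semicomputable_in (zero_jump n) (\<lambda>z. measure fair_measure (U (c z)))"
      by (intro upper_semicomputable_in_subst[OF uniformly_computable_realsD(2)[OF U(3)]]
          computable_imp_computable_in[OF c]) auto
    fix z
    let ?C = "cylinder (bits (pfst z) (psnd z))"
    have "measure fair_measure (U (c z) \<inter> ?C \<union> U (c z) \<inter> - ?C)
        = measure fair_measure (U (c z) \<inter> ?C) + measure fair_measure (U (c z) \<inter> - ?C)"
      by (intro fair.finite_measure_Union)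
        (auto simp: sets_fair_measure Diff_eq[symmetric]
          intro!: sets.Int sets.Diff cylinder_borel uniformly_Sigma_borel[OF U(1)])
    moreover have "U (c z) \<inter> ?C \<union> U (c z) \<inter> - ?C = U (c z)" by blast
    ultimately show "measure fair_measure (U (c z) \<inter> ?C) + measure fair_measure (U (c z) \<inter> - ?C)
        = measure fair_measure (U (c z))" by simp
  qed auto
  then have "upper_semicomputable_in (zero_jump n) (\<lambda>z. measure fair_measure (Y z))"
    unfolding measure_Y by (intro upper_semicomputable_in_mult_power computable_intros)
  then have upper: "upper_semicomputable_in (zero_jump n) (\<lambda>m. measure fair_measure (\<Union>z<m. Y z))"
    by (intro upper_semicomputable_measure_UN_less Y)
  have Y_le: "measure fair_measure (Y z) \<le> (1/2) ^ (z + 2)" for z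
  proof -
    have "measure fair_measure (U (c z) \<inter> cylinder (bits (pfst z) (psnd z))) \<le> measure fair_measure (U (c z))"
      by (intro fair.finite_measure_mono uniformly_Sigma_fair[OF U(1)]) auto
    also have "\<dots> \<le> (1/2) ^ c z" by (rule U(2))
    finally have "measure fair_measure (Y z) \<le> 2 ^ psnd z * (1/2) ^ c z"
      unfolding measure_Y by simp
    also have "\<dots> = (1/2) ^ (z + 2)"
      by (simp add: c_def power_add power_one_over field_simps)
    finally show ?thesis .
  qed
  define V where "V = (\<Union>z. Y z)"
  have "uniformly_Sigma (Suc n) (\<lambda>k. \<Union>i\<in>{i. True}. Y (psnd (pair k i)))"
    by (rule uniformly_Sigma_UN)
      (intro uniformly_Sigma_subst[OF Y] re.decidable computable_intros)+
  then have V_Sigma: "uniformly_Sigma (Suc n) (\<lambda>k. V)" by (simp add: V_def)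
  then have V_fair: "V \<in> sets fair_measure" by (rule uniformly_Sigma_fair)
  \<comment> \<open>The error is the tail of the geometric series of the bounds
    \<open>2^-(z+2)\<close>. The case \<open>m = 0\<close> bounds the measure of \<open>V\<close> by
    \<open>1/2\<close> and later gives the complement positive measure.\<close>
  have tail: "measure fair_measure V \<le> measure fair_measure (\<Union>z<m. Y z) + (1/2) ^ (m + 1)" for m
  proof -
    have sums: "(\<lambda>z. (1/2) ^ (z + m + 2)) sums ((1/2::real) ^ (m + 1))"
      using sums_mult[OF geometric_sums[of "1/2::real"], of "(1/2) ^ (m + 2)"]
      by (simp add: power_add mult_ac)
    have summable: "summable (\<lambda>z. measure fair_measure (Y (z + m)))"
      using Y_le[of "_ + m"] by (intro summable_comparison_test'[OF sums_summable[OF sums]]) auto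
    have "V \<subseteq> (\<Union>z<m. Y z) \<union> (\<Union>z. Y (z + m))"
    proof
      fix y assume "y \<in> V"
      then obtain z where "y \<in> Y z" unfolding V_def by blast
      moreover have "z < m \<or> z = (z - m) + m" by linarith
      ultimately show "y \<in> (\<Union>z<m. Y z) \<union> (\<Union>z. Y (z + m))" by (metis UN_I UNIV_I UnI1 UnI2 lessThan_iff)
    qed
    then have "measure fair_measure V \<le> measure fair_measure ((\<Union>z<m. Y z) \<union> (\<Union>z. Y (z + m)))"
      using uniformly_Sigma_fair[OF Y] by (intro fair.finite_measure_mono) auto
    also have "\<dots> \<le> measure fair_measure (\<Union>z<m. Y z) + measure fair_measure (\<Union>z. Y (z + m))"
      using uniformly_Sigma_fair[OF Y] by (intro measure_Un_le) auto
    also have "measure fair_measure (\<Union>z. Y (z + m)) \<le> (\<Sum>z. measure fair_measure (Y (z + m)))"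
      using uniformly_Sigma_fair[OF Y] summable
      by (intro fair.finite_measure_subadditive_countably) auto
    also have "\<dots> \<le> (1/2) ^ (m + 1)"
      using suminf_le[OF _ summable sums_summable[OF sums]] Y_le[of "_ + m"] sums_unique[OF sums] by simp
    finally show ?thesis by simp
  qed
  have upper_V: "upper_semicomputable_in (zero_jump n) (\<lambda>k. measure fair_measure V)"
  proof -
    \<comment> \<open>The finite unions plus the tail bound approximate \<open>V\<close> from above.
      On the right this comparison has its denominators cleared; the subtraction truncates only when
      the comparison fails anyway.\<close>
    have eq: "measure fair_measure V * real (Suc b) < real a \<longleftrightarrow>
      (\<exists>m. measure fair_measure (\<Union>z<m. Y z) * real (Suc (2 ^ (m + 1) * Suc b - 1))
        < real (a * 2 ^ (m + 1) - Suc b))" (is "?L \<longleftrightarrow> ?R") for a b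
    proof -
      have iff: "measure fair_measure (\<Union>z<m. Y z) * real (Suc (2 ^ (m + 1) * Suc b - 1))
          < real (a * 2 ^ (m + 1) - Suc b) \<longleftrightarrow>
        (measure fair_measure (\<Union>z<m. Y z) + (1/2) ^ (m + 1)) * real (Suc b) < real a" for m
      proof -
        define r where "r = measure fair_measure (\<Union>z<m. Y z)"
        define p where "p = (2::real) ^ (m + 1)"
        have p: "0 < p" by (simp add: p_def)
        have r: "0 \<le> r" by (simp add: r_def)
        have "(r + (1/2) ^ (m + 1)) * real (Suc b) < real a \<longleftrightarrow>
            r * (p * real (Suc b)) < real a * p - real (Suc b)"
        proof -
          have "(r + (1/2) ^ (m + 1)) * real (Suc b) < real a \<longleftrightarrow>
              ((r + (1/2) ^ (m + 1)) * real (Suc b)) * p < real a * p"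
            using p by simp
          also have "((r + (1/2) ^ (m + 1)) * real (Suc b)) * p = r * (p * real (Suc b)) + real (Suc b)"
            by (simp add: p_def power_one_over field_simps)
          finally show ?thesis by (simp add: less_diff_eq)
        qed
        moreover have "real (Suc (2 ^ (m + 1) * Suc b - 1)) = p * real (Suc b)"
          by (simp add: p_def algebra_simps of_nat_diff)
        moreover have "r * (p * real (Suc b)) < real (a * 2 ^ (m + 1) - Suc b) \<longleftrightarrow>
            r * (p * real (Suc b)) < real a * p - real (Suc b)"
        proof (cases "Suc b \<le> a * 2 ^ (m + 1)")
          case True
          then show ?thesis by (simp add: of_nat_diff p_def)
        next
          case False
          then have "real (a * 2 ^ (m + 1)) < real (Suc b)" by (simp only: of_nat_less_iff not_le)
          then have "real a * p < real (Suc b)" by (simp add: p_def)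
          moreover have "0 \<le> r * (p * real (Suc b))" using r p by simp
          moreover have "a * 2 ^ (m + 1) - Suc b = 0" using False by simp
          ultimately show ?thesis by linarith
        qed
        ultimately show ?thesis unfolding r_def by simp
      qed
      show ?thesis
        unfolding iff
      proof
        assume L: ?L
        have "(\<lambda>m. (measure fair_measure V + (1/2) ^ (m + 1)) * real (Suc b))
            \<longlonglongrightarrow> (measure fair_measure V + 0) * real (Suc b)"
          by (intro tendsto_intros LIMSEQ_ignore_initial_segment LIMSEQ_power_zero) simp
        then have "eventually (\<lambda>m. (measure fair_measure V + (1/2) ^ (m + 1)) * real (Suc b) < real a) sequentially"
          using L by (intro order_tendstoD(2)) auto
        then obtain m where m: "(measure fair_measure V + (1/2) ^ (m + 1)) * real (Suc b) < real a"
          by (auto simp: eventually_sequentially)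
        have "measure fair_measure (\<Union>z<m. Y z) \<le> measure fair_measure V"
          using V_fair unfolding V_def by (intro fair.finite_measure_mono) auto
        then have "(measure fair_measure (\<Union>z<m. Y z) + (1/2) ^ (m + 1)) * real (Suc b)
            \<le> (measure fair_measure V + (1/2) ^ (m + 1)) * real (Suc b)"
          by (intro mult_right_mono) auto
        then show "\<exists>m. (measure fair_measure (\<Union>z<m. Y z) + (1/2) ^ (m + 1)) * real (Suc b) < real a"
          using m by (intro exI[of _ m]) linarith
      next
        assume "\<exists>m. (measure fair_measure (\<Union>z<m. Y z) + (1/2) ^ (m + 1)) * real (Suc b) < real a"
        then obtain m where "(measure fair_measure (\<Union>z<m. Y z) + (1/2) ^ (m + 1)) * real (Suc b) < real a" ..
        moreover have "measure fair_measure V * real (Suc b)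
            \<le> (measure fair_measure (\<Union>z<m. Y z) + (1/2) ^ (m + 1)) * real (Suc b)"
          using tail[of m] by (intro mult_right_mono) auto
        ultimately show ?L by linarith
      qed
    qed
    show ?thesis
      unfolding upper_semicomputable_in_def eq
      by (intro re.ex upper_semicomputable_inD[OF upper] computable_intros)
  qed
  have measure_A: "measure fair_measure (- V) = 1 - measure fair_measure V"
    using fair.prob_compl[OF V_fair] by (simp add: Compl_eq_Diff_UNIV)
  show ?thesis
  proof (intro exI[of _ "- V"] conjI allI)
    show "is_Pi (Suc n) (- V)"
      using V_Sigma unfolding is_Pi_def is_Sigma_def uniformly_Sigma_def
      by (auto simp: Compl_eq_Diff_UNIV[symmetric])
    show "measure fair_measure (- V) > 0"
      using tail[of 0] unfolding measure_A by simp
    show "computable_real_in (zero_jump n) (measure fair_measure (- V))"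
      unfolding computable_real_in_iff measure_A
      by (intro uniformly_computable_realsI lower_semicomputable_in_diff upper_semicomputable_in_diff
          upper_V lower_semicomputable_measure[OF V_Sigma]) auto
    show "left_shift k x \<notin> - V" for k
    proof -
      \<comment> \<open>Prepending the removed initial segment restores \<open>x\<close>, which lies
        in every component of the test and so in the one chosen for this string.\<close>
      obtain v where "x \<in> cylinder (bits v k)" using ex_mem_cylinder_bits by blast
      then have "left_shift k x \<in> Y (pair v k)"
        unfolding Y_def using x by (simp add: prepend_left_shift)
      then show ?thesis unfolding V_def by blast
    qed
  qed
qed

theorem theorem3p3:
  fixes n :: nat and x :: cantor
  assumes "n \<ge> 1"
  shows "schnorr_random n x \<longleftrightarrow>
    (\<forall>A T. is_Pi n A \<and> measure fair_measure A > 0 \<and>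
       computable_real_in (zero_jump (n - 1)) (measure fair_measure A) \<and>
       measure_preserving T \<and> computable_map T \<and> ergodic T \<and> x \<in> dom T \<longrightarrow>
       (\<exists>k>0. \<exists>y\<in>A. iterate T k x = Some y))"
proof -
  obtain m where n: "n = Suc m" using assms by (cases n) auto
  show ?thesis
    unfolding n diff_Suc_1
  proof
    assume "schnorr_random (Suc m) x"
    then show "\<forall>A T. is_Pi (Suc m) A \<and> measure fair_measure A > 0 \<and>
       computable_real_in (zero_jump m) (measure fair_measure A) \<and>
       measure_preserving T \<and> computable_map T \<and> ergodic T \<and> x \<in> dom T \<longrightarrow>
       (\<exists>k>0. \<exists>y\<in>A. iterate T k x = Some y)"
      using schnorr_random_imp_recurrent by blast
  next
    assume recurrent: "\<forall>A T. is_Pi (Suc m) A \<and> measure fair_measure A > 0 \<and>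
       computable_real_in (zero_jump m) (measure fair_measure A) \<and>
       measure_preserving T \<and> computable_map T \<and> ergodic T \<and> x \<in> dom T \<longrightarrow>
       (\<exists>k>0. \<exists>y\<in>A. iterate T k x = Some y)"
    show "schnorr_random (Suc m) x"
    proof (rule ccontr)
      assume "\<not> schnorr_random (Suc m) x"
      then obtain A where A: "is_Pi (Suc m) A" "measure fair_measure A > 0"
        "computable_real_in (zero_jump m) (measure fair_measure A)" "\<And>k. left_shift k x \<notin> A"
        using not_schnorr_random_imp_not_recurrent by blast
      then have "\<exists>k>0. \<exists>y\<in>A. iterate shift_map k x = Some y"
        using recurrent measure_preserving_shift_map computable_map_shift_map ergodic_shift_map by simp
      then show False using A(4) by (auto simp: iterate_shift_map)
    qed
  qed
qed

end
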